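(* Let $1\le p<\infty$ and let $\alpha,\beta\in\mathbb{C}$ satisfy $|\alpha|^2+|\beta|^2=1$ and $\alpha\neq 0$. Let $T:H^p_{\alpha,\beta}\to \mathrm{Hol}(\mathbb{D})$ be a continuous linear map such that $(Tg)(z)\neq 0$ for every cyclic function $g\in H^p_{\alpha,\beta}$ and every $z\in\mathbb{D}$. Then there exist holomorphic functions $\phi:\mathbb{D}\to\mathbb{D}$ and $\psi:\mathbb{D}\to\mathbb{C}\setminus\{0\}$ such that $Tf=\psi\cdot(f\circ\phi)$ for every $f\in H^p_{\alpha,\beta}$.
   Context: $\mathbb{D}$ is the open unit disc in $\mathbb{C}$; $\mathrm{Hol}(\mathbb{D})$ is the space of holomorphic functions on $\mathbb{D}$ with its Fréchet-space topology (uniform convergence on compact subsets). For $1\le p<\infty$, $H^p$ is the Hardy space of analytic functions on $\mathbb{D}$ with its usual norm, and $H^\infty$ is the algebra of bounded analytic functions on $\mathbb{D}$. For $\alpha,\beta\in\mathbb{C}$ with $|\alpha|^2+|\beta|^2=1$, $H^p_{\alpha,\beta}=\mathrm{span}\{\alpha+\beta z,\ z^2H^p\}$, i.e. the set of functions $c(\alpha+\beta z)+z^2g$ with $c\in\mathbb{C}$, $g\in H^p$; it is a closed subspace of $H^p$ and carries the $H^p$ norm. Put $H^\infty_1=\{f\in H^\infty: f'(0)=0\}$. A function $f\in H^p_{\alpha,\beta}$ is called cyclic if $\overline{fH^\infty_1}=H^p_{\alpha,\beta}$, where $fH^\infty_1=\{fh:h\in H^\infty_1\}$ and the closure is taken in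 the $H^p$ norm. *)

theory Defs
  imports "HOL-Complex_Analysis.Complex_Analysis"
begin

text \<open>
  A function on the open unit disc is represented by any total function of type
  \<open>complex \<Rightarrow> complex\<close>; its values outside the disc are irrelevant. Norms and topologies
  below only see the values on the disc, so two representatives of the same function on the disc
  are topologically indistinguishable. In particular a map that is continuous from
  \<open>Hp_topology\<close> to \<open>Hol_topology\<close> automatically respects equality on the disc.
\<close>

abbreviation unit_disc :: "complex set"
  where "unit_disc \<equiv> ball 0 1"

definition Hol :: "(complex \<Rightarrow> complex) set"
  where "Hol = {f. f holomorphic_on unit_disc}"

text \<open>Uniform convergence on compact subsets: the sets
  \<open>{g. \<forall>z\<in>K. cmod (g z - f z) < e}\<close> form a neighbourhood base of \<open>f\<close>.\<close>

definition Hol_topology :: "(complex \<Rightarrow> complex) topology"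
  where "Hol_topology = topology (\<lambda>U. U \<subseteq> Hol \<and>
    (\<forall>f\<in>U. \<exists>K e. compact K \<and> K \<subseteq> unit_disc \<and> 0 < e \<and>
       (\<forall>g\<in>Hol. (\<forall>z\<in>K. cmod (g z - f z) < e) \<longrightarrow> g \<in> U)))"

definition Hp_mean :: "real \<Rightarrow> (complex \<Rightarrow> complex) \<Rightarrow> real \<Rightarrow> real"
  where "Hp_mean p f r =
    (1 / (2 * pi) * integral {0..2 * pi} (\<lambda>t. cmod (f (of_real r * cis t)) powr p)) powr (1 / p)"

definition Hp :: "real \<Rightarrow> (complex \<Rightarrow> complex) set"
  where "Hp p = {f \<in> Hol. bdd_above (Hp_mean p f ` {0..<1})}"

definition Hp_norm :: "real \<Rightarrow> (complex \<Rightarrow> complex) \<Rightarrow> real"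
  where "Hp_norm p f = (SUP r\<in>{0..<1}. Hp_mean p f r)"

definition Hp_topology :: "real \<Rightarrow> (complex \<Rightarrow> complex) topology"
  where "Hp_topology p = topology (\<lambda>U. U \<subseteq> Hp p \<and>
    (\<forall>f\<in>U. \<exists>e>0. \<forall>g\<in>Hp p. Hp_norm p (\<lambda>z. g z - f z) < e \<longrightarrow> g \<in> U))"

definition Hp_ab :: "real \<Rightarrow> complex \<Rightarrow> complex \<Rightarrow> (complex \<Rightarrow> complex) set"
  where "Hp_ab p \<alpha> \<beta> =
    {f. \<exists>c. \<exists>g\<in>Hp p. \<forall>z\<in>unit_disc. f z = c * (\<alpha> + \<beta> * z) + z\<^sup>2 * g z}"

definition Hinf :: "(complex \<Rightarrow> complex) set"
  where "Hinf = {f \<in> Hol. bounded (f ` unit_disc)}"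

definition Hinf1 :: "(complex \<Rightarrow> complex) set"
  where "Hinf1 = {f \<in> Hinf. deriv f 0 = 0}"

definition cyclic :: "real \<Rightarrow> complex \<Rightarrow> complex \<Rightarrow> (complex \<Rightarrow> complex) \<Rightarrow> bool"
  where "cyclic p \<alpha> \<beta> f \<longleftrightarrow> f \<in> Hp_ab p \<alpha> \<beta> \<and>
    Hp_topology p closure_of {\<lambda>z. f z * h z | h. h \<in> Hinf1} = Hp_ab p \<alpha> \<beta>"

text \<open>Linearity of a map into functions on the disc; the values of the images outside the disc
  are again disregarded.\<close>

definition linear_on_Hp_ab ::
    "real \<Rightarrow> complex \<Rightarrow> complex \<Rightarrow> ((complex \<Rightarrow> complex) \<Rightarrow> complex \<Rightarrow> complex) \<Rightarrow> bool"
  where "linear_on_Hp_ab p \<alpha> \<beta> T \<longleftrightarrow>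
    (\<forall>f\<in>Hp_ab p \<alpha> \<beta>. \<forall>g\<in>Hp_ab p \<alpha> \<beta>. \<forall>z\<in>unit_disc. T (\<lambda>w. f w + g w) z = T f z + T g z) \<and>
    (\<forall>c. \<forall>f\<in>Hp_ab p \<alpha> \<beta>. \<forall>z\<in>unit_disc. T (\<lambda>w. c * f w) z = c * T f z)"

lemma openin_Hol_topology:
  "openin Hol_topology U \<longleftrightarrow> U \<subseteq> Hol \<and>
    (\<forall>f\<in>U. \<exists>K e. compact K \<and> K \<subseteq> unit_disc \<and> 0 < e \<and>
       (\<forall>g\<in>Hol. (\<forall>z\<in>K. cmod (g z - f z) < e) \<longrightarrow> g \<in> U))"
proof -
  let ?P = "\<lambda>U f. \<exists>K e. compact K \<and> K \<subseteq> unit_disc \<and> (0::real) < e \<and>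
       (\<forall>g\<in>Hol. (\<forall>z\<in>K. cmod (g z - f z) < e) \<longrightarrow> g \<in> U)"
  have int: "?P (S \<inter> T) f" if S: "?P S f" and T: "?P T f" for S T f
  proof -
    obtain K e where K: "compact K" "K \<subseteq> unit_disc" "0 < e"
      "\<forall>g\<in>Hol. (\<forall>z\<in>K. cmod (g z - f z) < e) \<longrightarrow> g \<in> S" using S by blast
    obtain L d where L: "compact L" "L \<subseteq> unit_disc" "0 < d"
      "\<forall>g\<in>Hol. (\<forall>z\<in>L. cmod (g z - f z) < d) \<longrightarrow> g \<in> T" using T by blast
    have "\<forall>g\<in>Hol. (\<forall>z\<in>K \<union> L. cmod (g z - f z) < min e d) \<longrightarrow> g \<in> S \<inter> T"
    proof (intro ballI impI IntI)
      fix g assume g: "g \<in> Hol" "\<forall>z\<in>K \<union> L. cmod (g z - f z) < min e d"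
      show "g \<in> S" using bspec[OF K(4) g(1)] g(2) by simp
      show "g \<in> T" using bspec[OF L(4) g(1)] g(2) by simp
    qed
    then have *: "compact (K \<union> L) \<and> K \<union> L \<subseteq> unit_disc \<and> 0 < min e d \<and>
        (\<forall>g\<in>Hol. (\<forall>z\<in>K \<union> L. cmod (g z - f z) < min e d) \<longrightarrow> g \<in> S \<inter> T)"
      using K(1-3) L(1-3) compact_Un[OF K(1) L(1)] by simp
    show ?thesis
      by (rule exI[of _ "K \<union> L"], rule exI[of _ "min e d"], rule *)
  qed
  have mono: "?P T f" if S: "?P S f" and ST: "S \<subseteq> T" for S T f
  proof -
    obtain K e where K: "compact K" "K \<subseteq> unit_disc" "0 < e"
      "\<forall>g\<in>Hol. (\<forall>z\<in>K. cmod (g z - f z) < e) \<longrightarrow> g \<in> S" using S by blast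
    have *: "compact K \<and> K \<subseteq> unit_disc \<and> 0 < e \<and>
        (\<forall>g\<in>Hol. (\<forall>z\<in>K. cmod (g z - f z) < e) \<longrightarrow> g \<in> T)"
      using K(1-3) bspec[OF K(4)] ST by (simp add: subset_iff)
    show ?thesis by (rule exI[of _ K], rule exI[of _ e], rule *)
  qed
  have "istopology (\<lambda>U. U \<subseteq> Hol \<and> (\<forall>f\<in>U. ?P U f))"
    unfolding istopology_def
  proof (intro conjI allI impI ballI)
    fix S T f
    assume "S \<subseteq> Hol \<and> (\<forall>f\<in>S. ?P S f)" "T \<subseteq> Hol \<and> (\<forall>f\<in>T. ?P T f)" "f \<in> S \<inter> T"
    then have "?P S f" "?P T f" by blast+
    then show "?P (S \<inter> T) f" by (rule int)
  next
    fix \<K> f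
    assume *: "\<forall>U\<in>\<K>. U \<subseteq> Hol \<and> (\<forall>f\<in>U. ?P U f)" and "f \<in> \<Union>\<K>"
    then obtain V where V: "V \<in> \<K>" "f \<in> V" by (elim UnionE)
    note U = V(1) bspec[OF conjunct2[OF bspec[OF * V(1)]] V(2)]
    show "?P (\<Union>\<K>) f" by (rule mono[OF U(2)]) (use U(1) in blast)
  qed auto
  then show ?thesis unfolding Hol_topology_def by (simp add: topology_inverse')
qed

lemma topspace_Hol_topology [simp]: "topspace Hol_topology = Hol"
proof (rule subset_antisym)
  have "openin Hol_topology Hol"
    unfolding openin_Hol_topology
    by (intro conjI ballI exI[of _ "{}"] exI[of _ "1::real"]) simp_all
  then show "Hol \<subseteq> topspace Hol_topology" by (rule openin_subset)
  show "topspace Hol_topology \<subseteq> Hol"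
    using openin_topspace[of Hol_topology] unfolding openin_Hol_topology by blast
qed

lemma openin_Hp_topology:
  "openin (Hp_topology p) U \<longleftrightarrow> U \<subseteq> Hp p \<and>
    (\<forall>f\<in>U. \<exists>e>0. \<forall>g\<in>Hp p. Hp_norm p (\<lambda>z. g z - f z) < e \<longrightarrow> g \<in> U)"
proof -
  let ?P = "\<lambda>U f. \<exists>e>0. \<forall>g\<in>Hp p. Hp_norm p (\<lambda>z. g z - f z) < e \<longrightarrow> g \<in> U"
  have int: "?P (S \<inter> T) f" if S: "?P S f" and T: "?P T f" for S T f
  proof -
    obtain e where e: "0 < e" "\<forall>g\<in>Hp p. Hp_norm p (\<lambda>z. g z - f z) < e \<longrightarrow> g \<in> S"
      using S by blast
    obtain d where d: "0 < d" "\<forall>g\<in>Hp p. Hp_norm p (\<lambda>z. g z - f z) < d \<longrightarrow> g \<in> T"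
      using T by blast
    show ?thesis by (rule exI[of _ "min e d"]) (use e d in auto)
  qed
  have "istopology (\<lambda>U. U \<subseteq> Hp p \<and> (\<forall>f\<in>U. ?P U f))"
    unfolding istopology_def
  proof (intro conjI allI impI ballI)
    fix S T f
    assume "S \<subseteq> Hp p \<and> (\<forall>f\<in>S. ?P S f)" "T \<subseteq> Hp p \<and> (\<forall>f\<in>T. ?P T f)" "f \<in> S \<inter> T"
    then have "?P S f" "?P T f" by blast+
    then show "?P (S \<inter> T) f" by (rule int)
  next
    fix \<K> f
    assume *: "\<forall>U\<in>\<K>. U \<subseteq> Hp p \<and> (\<forall>f\<in>U. ?P U f)" and "f \<in> \<Union>\<K>"
    then obtain V where V: "V \<in> \<K>" "f \<in> V" by (elim UnionE)
    note U = V(1) bspec[OF conjunct2[OF bspec[OF * V(1)]] V(2)]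
    from U(2) obtain e where e: "e > 0" "\<forall>g\<in>Hp p. Hp_norm p (\<lambda>z. g z - f z) < e \<longrightarrow> g \<in> V"
      by blast
    then show "?P (\<Union>\<K>) f" using U(1) by blast
  qed auto
  then show ?thesis unfolding Hp_topology_def by (simp add: topology_inverse')
qed

lemma topspace_Hp_topology [simp]: "topspace (Hp_topology p) = Hp p"
proof (rule subset_antisym)
  have "openin (Hp_topology p) (Hp p)"
    unfolding openin_Hp_topology
    by (intro conjI ballI exI[of _ "1::real"]) simp_all
  then show "Hp p \<subseteq> topspace (Hp_topology p)" by (rule openin_subset)
  show "topspace (Hp_topology p) \<subseteq> Hp p"
    using openin_topspace[of "Hp_topology p"] unfolding openin_Hp_topology by blast
qed

lemma Hp_ab_subset_Hp:
  assumes p: "1 \<le> p"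
  shows "Hp_ab p \<alpha> \<beta> \<subseteq> Hp p"
proof
  fix f assume "f \<in> Hp_ab p \<alpha> \<beta>"
  then obtain c g where g: "g \<in> Hp p"
    and f: "\<And>z. z \<in> unit_disc \<Longrightarrow> f z = c * (\<alpha> + \<beta> * z) + z\<^sup>2 * g z"
    unfolding Hp_ab_def by blast
  have gh: "g holomorphic_on unit_disc" using g by (simp add: Hp_def Hol_def)
  have "(\<lambda>z. c * (\<alpha> + \<beta> * z) + z\<^sup>2 * g z) holomorphic_on unit_disc"
    by (intro holomorphic_intros gh)
  then have fh: "f holomorphic_on unit_disc"
    by (rule holomorphic_transform) (simp add: f)
  obtain M where M: "\<And>r. r \<in> {0..<1} \<Longrightarrow> Hp_mean p g r \<le> M"
    using g unfolding Hp_def bdd_above_def by blast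
  define C where "C = cmod c * (cmod \<alpha> + cmod \<beta>)"
  have C0: "C \<ge> 0" by (simp add: C_def)
  have pow: "(a + b) powr p \<le> 2 powr p * (a powr p + b powr p)" if "a \<ge> 0" "b \<ge> 0" for a b :: real
  proof -
    have "(a + b) powr p \<le> (2 * max a b) powr p" using that p by (intro powr_mono2) auto
    also have "\<dots> = 2 powr p * max a b powr p" using that by (simp add: powr_mult)
    also have "\<dots> \<le> 2 powr p * (a powr p + b powr p)"
      by (intro mult_left_mono) (auto simp: max_def)
    finally show ?thesis .
  qed
  have cont: "(\<lambda>t. cmod (h (of_real r * cis t)) powr p) integrable_on {0..2 * pi}"
    if r: "r \<in> {0..<1}" and h: "h holomorphic_on unit_disc" for h r
  proof (rule integrable_continuous_interval)
    have "continuous_on {0..2 * pi} (\<lambda>t. h (of_real r * cis t))"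
      by (rule continuous_on_compose2[OF holomorphic_on_imp_continuous_on[OF h]])
        (use r in \<open>auto intro!: continuous_intros simp: norm_mult\<close>)
    then show "continuous_on {0..2 * pi} (\<lambda>t. cmod (h (of_real r * cis t)) powr p)"
      using p by (intro continuous_on_powr') (auto intro!: continuous_intros)
  qed
  let ?I = "\<lambda>h r. integral {0..2 * pi} (\<lambda>t. cmod (h (of_real r * cis t)) powr p)"
  have "Hp_mean p f r \<le> (1 / (2 * pi) * (2 powr p * (2 * pi * C powr p + 2 * pi * M powr p))) powr (1 / p)"
    if r: "r \<in> {0..<1}" for r
  proof -
    have I0: "?I h r \<ge> 0" if "h holomorphic_on unit_disc" for h
      using cont[OF r that] by (intro integral_nonneg) auto
    have "?I f r \<le> integral {0..2 * pi}
        (\<lambda>t. 2 powr p * (C powr p + cmod (g (of_real r * cis t)) powr p))"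
    proof (rule integral_le[OF cont[OF r fh]])
      show "(\<lambda>t. 2 powr p * (C powr p + cmod (g (of_real r * cis t)) powr p)) integrable_on {0..2 * pi}"
        using integrable_cmul[OF integrable_add[OF integrable_const_ivl cont[OF r gh]]]
        by (simp add: cbox_interval)
      fix t :: real
      let ?z = "of_real r * cis t"
      have z: "cmod ?z < 1" using r by (simp add: norm_mult)
      have "cmod (f ?z) \<le> cmod (c * (\<alpha> + \<beta> * ?z)) + cmod (?z\<^sup>2 * g ?z)"
        using z by (subst f) (auto intro: norm_triangle_ineq)
      also have "cmod (c * (\<alpha> + \<beta> * ?z)) \<le> C"
      proof -
        have "cmod (\<alpha> + \<beta> * ?z) \<le> cmod \<alpha> + cmod (\<beta> * ?z)" by (rule norm_triangle_ineq)
        also have "cmod (\<beta> * ?z) \<le> cmod \<beta>"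
          unfolding norm_mult[of \<beta>] using z by (intro mult_left_le) auto
        finally show ?thesis unfolding C_def norm_mult[of c] by (intro mult_left_mono) auto
      qed
      also have "cmod (?z\<^sup>2 * g ?z) \<le> cmod (g ?z)"
        unfolding norm_mult[of "?z\<^sup>2"] norm_power using z
        by (intro mult_left_le_one_le) (auto intro: power_le_one)
      finally have "cmod (f ?z) powr p \<le> (C + cmod (g ?z)) powr p"
        using p by (intro powr_mono2) auto
      also have "\<dots> \<le> 2 powr p * (C powr p + cmod (g ?z) powr p)" using C0 by (intro pow) auto
      finally show "cmod (f ?z) powr p \<le> 2 powr p * (C powr p + cmod (g ?z) powr p)" .
    qed
    also have "\<dots> = 2 powr p * (2 * pi * C powr p + ?I g r)"
      using integral_add[OF integrable_const_ivl cont[OF r gh], of "C powr p"] by simp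
    also have "?I g r \<le> 2 * pi * M powr p"
    proof -
      have "1 / (2 * pi) * ?I g r = Hp_mean p g r powr p"
        unfolding Hp_mean_def using p I0[OF gh] by (simp add: powr_powr)
      also have "\<dots> \<le> M powr p"
        using p M[OF r] by (intro powr_mono2) (auto simp: Hp_mean_def)
      finally show ?thesis by (simp add: field_simps)
    qed
    finally have "?I f r \<le> 2 powr p * (2 * pi * C powr p + 2 * pi * M powr p)"
      by simp
    then show ?thesis
      unfolding Hp_mean_def using p I0[OF fh] by (intro powr_mono2 mult_left_mono) auto
  qed
  then have "bdd_above (Hp_mean p f ` {0..<1})"
    by (intro bdd_aboveI2)
  then show "f \<in> Hp p"
    using fh by (simp add: Hp_def Hol_def)
qed

end

theory Submission
  imports Defs
begin

text \<open>
  Put \<open>E z = exp (\<beta> z / \<alpha>)\<close>. The space consists of the products \<open>E k\<close> with \<open>k\<close> in the Hardy space and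
  \<open>k'(0) = 0\<close>, and \<open>E exp k\<close> is cyclic for every \<open>k\<close> in \<open>Hinf1\<close>. For fixed \<open>z\<close>, the functional
  \<open>\<mu> k = T (E k) z\<close> thus does not vanish on exponentials, so it is a multiple of a character of \<open>Hinf1\<close>
  by the Gleason--Kahane--Zelazko argument. On monomials the character is evaluation at a point \<open>w\<close>,
  continuity in the Hardy norm forces \<open>w\<close> into the disc, and density of the dilates extends the formula to
  the whole space. The map \<open>\<phi>\<close> that sends \<open>z\<close> to \<open>w\<close> is holomorphic since \<open>\<phi>\<^sup>2\<close> and \<open>\<phi>\<^sup>3\<close> are quotients of
  values of \<open>T\<close>.

  Density of the dilates for all exponents \<open>p \<ge> 1\<close> is obtained without boundary values: every
  function in the Hardy space is a product of two functions with exponent \<open>2 p\<close>, where Clarkson's inequality applies.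
\<close>

subsection \<open>Circle means and the Poisson integral\<close>

text \<open>The space is cut out of the Hardy space by
  \<open>\<alpha> * deriv f 0 = \<beta> * f 0\<close>; for functions not vanishing at 0 this fixes
  the logarithmic derivative there as \<beta> / \<alpha>. The affine function \<alpha> + \<beta> z
  has that logarithmic derivative too, but it may vanish in the closed disc and so cannot serve as a
  divisor. \<open>E\<close> is bounded above and away from 0 on the disc, so multiplying and
  dividing by it changes norms only by constants.

  The obstacle is that z itself is not in \<open>Hinf1\<close>: the admissible exponents form the
  semigroup generated by 2 and 3, and a point of the disc has to be recovered from its square and
  its cube.

  Dilates serve twice, to prove that functions bounded above and below are cyclic and to leave the
  bounded functions at the end. Norm estimates are reduced to \<open>cmean\<close> on circles inside
  the disc. These means increase with the radius, so an estimate on a large circle controls all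
  smaller ones. The elementary form of Clarkson's inequality requires an exponent of at least 2,
  hence the doubling of p.\<close>

definition cavg :: "real \<Rightarrow> (complex \<Rightarrow> real) \<Rightarrow> real"
  where "cavg r \<phi> = 1 / (2 * pi) * integral {0..2 * pi} (\<lambda>t. \<phi> (of_real r * cis t))"

text \<open>This is the p-th power of \<open>Hp_mean\<close>: without the outer root, pointwise
  inequalities between p-th powers integrate directly.\<close>

definition cmean :: "real \<Rightarrow> (complex \<Rightarrow> complex) \<Rightarrow> real \<Rightarrow> real"
  where "cmean p f r = cavg r (\<lambda>z. cmod (f z) powr p)"

lemma continuous_on_circle_param:
  fixes \<phi> :: "complex \<Rightarrow> 'a::topological_space"
  assumes "0 \<le> r" "continuous_on (sphere 0 r) \<phi>"
  shows "continuous_on A (\<lambda>t. \<phi> (of_real r * cis t))"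
  by (rule continuous_on_compose2[OF assms(2)])
     (use assms(1) in \<open>auto intro!: continuous_intros simp: norm_mult\<close>)

lemma cavg_integrable:
  fixes \<phi> :: "complex \<Rightarrow> real"
  assumes "0 \<le> r" "continuous_on (sphere 0 r) \<phi>"
  shows "(\<lambda>t. \<phi> (of_real r * cis t)) integrable_on {0..2 * pi}"
  using continuous_on_circle_param[OF assms] by (rule integrable_continuous_interval)

lemma cavg_mono:
  assumes "0 \<le> r" "continuous_on (sphere 0 r) \<phi>" "continuous_on (sphere 0 r) \<psi>"
    and "\<And>z. cmod z = r \<Longrightarrow> \<phi> z \<le> \<psi> z"
  shows "cavg r \<phi> \<le> cavg r \<psi>"
  unfolding cavg_def
  using integral_le[OF cavg_integrable[OF assms(1,2)] cavg_integrable[OF assms(1,3)]] assms(1,4)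
  by (intro mult_left_mono) (auto simp: norm_mult)

lemma cavg_cong:
  assumes "0 \<le> r" "\<And>z. cmod z = r \<Longrightarrow> \<phi> z = \<psi> z"
  shows "cavg r \<phi> = cavg r \<psi>"
  unfolding cavg_def
  using assms by (intro arg_cong2[where f = "(*)"] integral_cong) (auto simp: norm_mult)

lemma cavg_add:
  assumes "0 \<le> r" "continuous_on (sphere 0 r) \<phi>" "continuous_on (sphere 0 r) \<psi>"
  shows "cavg r (\<lambda>z. \<phi> z + \<psi> z) = cavg r \<phi> + cavg r \<psi>"
  unfolding cavg_def
  using integral_add[OF cavg_integrable[OF assms(1,2)] cavg_integrable[OF assms(1,3)]]
  by (simp add: field_simps)

lemma cavg_cmult: "cavg r (\<lambda>z. c * \<phi> z) = c * cavg r \<phi>"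
  unfolding cavg_def by simp

lemma cavg_const [simp]: "cavg r (\<lambda>z. c) = c"
  unfolding cavg_def by simp

lemma cavg_nonneg:
  assumes "0 \<le> r" "continuous_on (sphere 0 r) \<phi>" "\<And>z. cmod z = r \<Longrightarrow> 0 \<le> \<phi> z"
  shows "0 \<le> cavg r \<phi>"
  using cavg_mono[OF assms(1) _ assms(2), of "\<lambda>_. 0"] assms(3) by simp

lemma continuous_on_cmod_powr:
  fixes f :: "'a::topological_space \<Rightarrow> complex"
  assumes "0 < p" "continuous_on S f"
  shows "continuous_on S (\<lambda>z. cmod (f z) powr p)"
  using assms by (intro continuous_on_powr') (auto intro!: continuous_intros)

lemma cmean_nonneg:
  assumes "0 \<le> r" "0 < p" "continuous_on (sphere 0 r) f"
  shows "0 \<le> cmean p f r"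
  unfolding cmean_def using assms by (intro cavg_nonneg continuous_on_cmod_powr) auto

lemma cmean_le_const:
  assumes "0 \<le> r" "0 < p" "continuous_on (sphere 0 r) f" "\<And>z. cmod z = r \<Longrightarrow> cmod (f z) \<le> c"
  shows "cmean p f r \<le> c powr p"
proof -
  have "cmean p f r \<le> cavg r (\<lambda>_. c powr p)"
    unfolding cmean_def using assms
    by (intro cavg_mono continuous_on_cmod_powr powr_mono2) auto
  then show ?thesis by simp
qed

lemma Hp_mean_eq_cmean: "Hp_mean p f r = cmean p f r powr (1 / p)"
  unfolding Hp_mean_def cmean_def cavg_def by simp

section \<open>The Poisson kernel, growth estimates and monotonicity of circle means\<close>

definition poisson :: "real \<Rightarrow> complex \<Rightarrow> complex \<Rightarrow> real"
  where "poisson R z \<zeta> = (R\<^sup>2 - (cmod z)\<^sup>2) / (cmod (\<zeta> - z))\<^sup>2"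

lemma poisson_nonneg: "cmod z \<le> R \<Longrightarrow> 0 \<le> poisson R z \<zeta>"
  unfolding poisson_def by (auto intro!: divide_nonneg_nonneg power_mono)

lemma continuous_on_poisson:
  assumes "cmod z < R"
  shows "continuous_on (sphere 0 R) (poisson R z)"
  unfolding poisson_def using assms by (auto intro!: continuous_intros)

lemma poisson_le:
  assumes "cmod z < R" "cmod \<zeta> = R"
  shows "poisson R z \<zeta> \<le> (R + cmod z) / (R - cmod z)"
proof -
  have *: "R - cmod z \<le> cmod (\<zeta> - z)"
    using norm_triangle_ineq2[of \<zeta> z] assms by simp
  have "poisson R z \<zeta> \<le> (R\<^sup>2 - (cmod z)\<^sup>2) / (R - cmod z)\<^sup>2"
    unfolding poisson_def using assms * by (intro divide_left_mono power_mono) (auto intro!: power_mono mult_pos_pos zero_less_power)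
  also have "\<dots> = (R + cmod z) / (R - cmod z)"
    using assms by (simp add: power2_eq_square square_diff_square_factored)
  finally show ?thesis .
qed

text \<open>Cauchy's integral formula is applied to \<open>g\<close> instead of \<open>h\<close>.
  The extra factor is 1 at z, and on the circle, where R^2 is \<zeta> times its conjugate, it turns
  the Cauchy kernel into the Poisson kernel.\<close>

lemma poisson_formula:
  assumes "continuous_on (cball 0 R) h" "h holomorphic_on ball 0 R" "cmod z < R"
  shows "((\<lambda>t. of_real (poisson R z (of_real R * cis t)) * h (of_real R * cis t))
            has_integral 2 * of_real pi * h z) {0..2 * pi}"
proof -
  have R: "R > 0" using assms(3) norm_ge_zero[of z] by linarith
  define g where "g \<zeta> = h \<zeta> * (of_real (R\<^sup>2 - (cmod z)\<^sup>2) / (of_real (R\<^sup>2) - cnj z * \<zeta>))" for \<zeta>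
  have nz: "of_real (R\<^sup>2) - cnj z * \<zeta> \<noteq> 0" if "cmod \<zeta> \<le> R" for \<zeta>
  proof
    assume "of_real (R\<^sup>2) - cnj z * \<zeta> = 0"
    then have "R\<^sup>2 = cmod (cnj z * \<zeta>)"
      using R by (metis eq_iff_diff_eq_0 norm_of_real abs_of_nonneg zero_le_power2)
    also have "\<dots> \<le> cmod z * R" using that by (auto simp: norm_mult intro: mult_left_mono)
    also have "\<dots> < R * R" using assms(3) R by simp
    finally show False by (simp add: power2_eq_square)
  qed
  have "continuous_on (cball 0 R) g" unfolding g_def
    using nz by (intro continuous_intros assms) auto
  moreover have "g holomorphic_on ball 0 R" unfolding g_def
    using nz by (intro holomorphic_intros assms) auto
  ultimately have "((\<lambda>u. g u / (u - z)) has_contour_integral (2 * of_real pi * \<i> * g z)) (circlepath 0 R)"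
    using assms(3) by (intro Cauchy_integral_circlepath) auto
  moreover have "g z = h z"
    unfolding g_def using nz[of z] assms(3) by (simp add: mult.commute complex_norm_square flip: of_real_power)
  ultimately have "((\<lambda>t. g (of_real R * cis t) / (of_real R * cis t - z) * R * \<i> * cis t)
      has_integral (2 * of_real pi * \<i> * h z)) {0..2 * pi}"
    unfolding circlepath_def by (subst (asm) has_contour_integral_part_circlepath_iff) auto
  then have "((\<lambda>t. (1 / \<i>) * (g (of_real R * cis t) / (of_real R * cis t - z) * R * \<i> * cis t))
      has_integral (1 / \<i>) * (2 * of_real pi * \<i> * h z)) {0..2 * pi}"
    by (rule has_integral_mult_right)
  moreover have "(1 / \<i>) * (g \<zeta> / (\<zeta> - z) * R * \<i> * cis t)
      = of_real (poisson R z \<zeta>) * h \<zeta>" if \<zeta>: "\<zeta> = of_real R * cis t" for t \<zeta>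
  proof -
    have n: "cmod \<zeta> = R" using \<zeta> R by (simp add: norm_mult)
    have sq: "of_real (R\<^sup>2) = \<zeta> * cnj \<zeta>"
      using n complex_norm_square[of \<zeta>] by simp
    have d: "\<zeta> - z \<noteq> 0" using n assms(3) by auto
    have "of_real (R\<^sup>2) - cnj z * \<zeta> = \<zeta> * cnj (\<zeta> - z)"
      unfolding sq by (simp add: algebra_simps)
    moreover have *: "(1 / \<i>) * (A * B * \<i> * C) = A * (B * C)" for A B C
      by (simp add: field_simps)
    ultimately have "(1 / \<i>) * (g \<zeta> / (\<zeta> - z) * R * \<i> * cis t)
       = h \<zeta> * of_real (R\<^sup>2 - (cmod z)\<^sup>2) / (\<zeta> * cnj (\<zeta> - z)) / (\<zeta> - z) * \<zeta>"
      unfolding g_def by (simp only: \<zeta> * times_divide_eq_right)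
    also have "\<dots> = h \<zeta> * of_real (R\<^sup>2 - (cmod z)\<^sup>2) / ((\<zeta> - z) * cnj (\<zeta> - z))"
    proof -
      have "\<zeta> \<noteq> 0" using n R by auto
      then have "A / (\<zeta> * B) / C * \<zeta> = A / (C * B)" for A B C
        by (cases "B = 0"; cases "C = 0"; simp add: field_simps)
      then show ?thesis .
    qed
    also have "\<dots> = of_real (poisson R z \<zeta>) * h \<zeta>"
      unfolding poisson_def complex_norm_square[of "\<zeta> - z", symmetric] by simp
    finally show ?thesis .
  qed
  moreover have "(1 / \<i>) * (2 * of_real pi * \<i> * h z) = 2 * of_real pi * h z"
    by (simp add: field_simps)
  ultimately show ?thesis by (simp only:)
qed

lemma cavg_poisson:
  assumes "cmod z < R"
  shows "cavg R (poisson R z) = 1"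
proof -
  have "((\<lambda>t. complex_of_real (poisson R z (of_real R * cis t))) has_integral of_real (2 * pi)) {0..2 * pi}"
    using poisson_formula[of R "\<lambda>_. 1", OF _ _ assms] by simp
  from has_integral_linear[OF this bounded_linear_Re]
  have "((\<lambda>t. poisson R z (of_real R * cis t)) has_integral 2 * pi) {0..2 * pi}"
    by (simp add: o_def)
  then show ?thesis unfolding cavg_def by (simp add: integral_unique)
qed

text \<open>The tangent inequality for the convex power stands in for Jensen's inequality below. The
  endpoint y = 0 lies outside the open interval on which the power is differentiated and is treated
  by hand.\<close>

lemma powr_ge_tangent:
  fixes a y p :: real
  assumes "1 \<le> p" "0 < a" "0 \<le> y"
  shows "a powr p + p * a powr (p - 1) * (y - a) \<le> y powr p"
proof (cases "y = 0")
  case True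
  have "a powr (p - 1) * a = a powr p" using assms by (simp add: powr_diff)
  moreover have "a powr p \<le> p * a powr p" using assms by simp
  ultimately show ?thesis using True assms by (simp add: mult.assoc)
next
  case False
  have "y powr p - a powr p \<ge> p * a powr (p - 1) * (y - a)"
  proof (rule convex_on_imp_above_tangent[where A = "{0<..}"])
    show "convex_on {0<..} (\<lambda>x::real. x powr p)"
      using assms powr_convex[of p] by (auto intro: convex_on_subset)
    show "((\<lambda>x. x powr p) has_real_derivative p * a powr (p - 1)) (at a within {0<..})"
      using assms by (auto intro!: derivative_eq_intros)
  qed (use assms False in \<open>auto simp: interior_open\<close>)
  then show ?thesis by simp
qed

text \<open>This is Jensen's inequality for the Poisson kernel, which has mean 1: the tangent
  inequality at a = |h z| is integrated against it, and the linear term has the right sign because a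
  is at most the Poisson average of |h|.\<close>

lemma powr_le_cavg_poisson:
  assumes "1 \<le> p" "continuous_on (cball 0 R) h" "h holomorphic_on ball 0 R" "cmod z < R"
  shows "cmod (h z) powr p \<le> cavg R (\<lambda>\<zeta>. poisson R z \<zeta> * cmod (h \<zeta>) powr p)"
proof -
  have R: "R > 0" using assms(4) norm_ge_zero[of z] by linarith
  have ch: "continuous_on (sphere 0 R) h" using assms(2) by (rule continuous_on_subset) auto
  note cont = continuous_on_poisson[OF assms(4)] ch continuous_on_cmod_powr[OF _ ch, of p]
  have nn: "poisson R z \<zeta> \<ge> 0" for \<zeta> using assms(4) by (intro poisson_nonneg) auto
  show ?thesis
  proof (cases "h z = 0")
    case True
    have "0 \<le> cavg R (\<lambda>\<zeta>. poisson R z \<zeta> * cmod (h \<zeta>) powr p)"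
      using assms R nn by (intro cavg_nonneg continuous_intros cont) auto
    then show ?thesis using True by simp
  next
    case False
    define a where "a = cmod (h z)"
    have a: "a > 0" using False by (simp add: a_def)
    have cP: "continuous_on (sphere 0 R) (\<lambda>\<zeta>. poisson R z \<zeta> * cmod (h \<zeta>))"
      by (intro continuous_intros cont)
    have "a \<le> cavg R (\<lambda>\<zeta>. poisson R z \<zeta> * cmod (h \<zeta>))"
    proof -
      note I = poisson_formula[OF assms(2-4)]
      have "norm (2 * of_real pi * h z) \<le> integral {0..2*pi} (\<lambda>t. poisson R z (of_real R * cis t) * cmod (h (of_real R * cis t)))"
        unfolding integral_unique[OF I, symmetric]
        using R cP nn by (intro integral_norm_bound_integral has_integral_integrable[OF I] cavg_integrable)
          (auto simp: norm_mult)
      then show ?thesis unfolding a_def cavg_def by (simp add: norm_mult field_simps)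
    qed
    then have "a powr p + p * a powr (p - 1) * a
        \<le> a powr p + p * a powr (p - 1) * cavg R (\<lambda>\<zeta>. poisson R z \<zeta> * cmod (h \<zeta>))"
      using assms a by (intro add_left_mono mult_left_mono) auto
    also have "\<dots> = a powr p * cavg R (poisson R z)
        + p * a powr (p - 1) * cavg R (\<lambda>\<zeta>. poisson R z \<zeta> * cmod (h \<zeta>))"
      by (simp add: cavg_poisson[OF assms(4)])
    also have "\<dots> = cavg R (\<lambda>\<zeta>. a powr p * poisson R z \<zeta> + p * a powr (p - 1) * (poisson R z \<zeta> * cmod (h \<zeta>)))"
      using R by (subst cavg_add) (auto intro!: continuous_intros cont simp: cavg_cmult)
    also have "\<dots> \<le> cavg R (\<lambda>\<zeta>. poisson R z \<zeta> * cmod (h \<zeta>) powr p + p * a powr (p - 1) * a * poisson R z \<zeta>)"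
    proof (intro cavg_mono)
      fix \<zeta>
      have "poisson R z \<zeta> * (a powr p + p * a powr (p - 1) * (cmod (h \<zeta>) - a)) \<le> poisson R z \<zeta> * cmod (h \<zeta>) powr p"
        using assms a by (intro mult_left_mono nn powr_ge_tangent) auto
      then show "a powr p * poisson R z \<zeta> + p * a powr (p - 1) * (poisson R z \<zeta> * cmod (h \<zeta>))
        \<le> poisson R z \<zeta> * cmod (h \<zeta>) powr p + p * a powr (p - 1) * a * poisson R z \<zeta>"
        by (simp add: algebra_simps)
    qed (use R assms in \<open>auto intro!: continuous_intros cont\<close>)
    also have "\<dots> = cavg R (\<lambda>\<zeta>. poisson R z \<zeta> * cmod (h \<zeta>) powr p) + p * a powr (p - 1) * a"
      using R assms by (subst cavg_add) (auto intro!: continuous_intros cont simp: cavg_cmult cavg_poisson)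
    finally show ?thesis by (simp add: a_def)
  qed
qed

lemma powr_le_cmean:
  assumes "1 \<le> p" "continuous_on (cball 0 R) h" "h holomorphic_on ball 0 R" "cmod z < R"
  shows "cmod (h z) powr p \<le> (R + cmod z) / (R - cmod z) * cmean p h R"
proof -
  have R: "R > 0" using assms(4) norm_ge_zero[of z] by linarith
  have ch: "continuous_on (sphere 0 R) h" using assms(2) by (rule continuous_on_subset) auto
  note cont = continuous_on_poisson[OF assms(4)] continuous_on_cmod_powr[OF _ ch, of p]
  have "cmod (h z) powr p \<le> cavg R (\<lambda>\<zeta>. poisson R z \<zeta> * cmod (h \<zeta>) powr p)"
    by (rule powr_le_cavg_poisson[OF assms])
  also have "\<dots> \<le> cavg R (\<lambda>\<zeta>. (R + cmod z) / (R - cmod z) * cmod (h \<zeta>) powr p)"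
    using R assms by (intro cavg_mono mult_right_mono poisson_le continuous_intros cont) auto
  finally show ?thesis unfolding cavg_cmult cmean_def .
qed

text \<open>The distance between the two points depends only on their radii and the difference of
  the angles. In \<open>cmean_mono\<close> this turns an integral over the inner circle into one
  over the outer circle, whose value \<open>cavg_poisson\<close> gives.\<close>

lemma poisson_swap:
  "0 \<le> r \<Longrightarrow> poisson R (of_real r * cis s) (of_real R * cis t) = poisson R (of_real r * cis t) (of_real R * cis s)"
proof -
  assume "0 \<le> r"
  have "of_real R * cis t - of_real r * cis s = cis (s + t) * cnj (of_real R * cis s - of_real r * cis t)"
    by (simp add: cis_cnj ring_distribs mult.left_commute cis_mult)
  then have "cmod (of_real R * cis t - of_real r * cis s) = cmod (of_real R * cis s - of_real r * cis t)"
    by (simp only: norm_mult norm_cis complex_mod_cnj mult_1)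
  then show ?thesis using \<open>0 \<le> r\<close> unfolding poisson_def by (simp add: norm_mult)
qed

text \<open>Each value on the inner circle is bounded by its Poisson average over the outer one.
  After integration over the inner circle and Fubini, the kernel integrates to 1 by
  \<open>poisson_swap\<close>.\<close>

lemma cmean_mono:
  assumes "1 \<le> p" "continuous_on (cball 0 R) h" "h holomorphic_on ball 0 R" "0 \<le> r" "r < R"
  shows "cmean p h r \<le> cmean p h R"
proof -
  have R: "R > 0" using assms by linarith
  have ch: "continuous_on (sphere 0 R) h" using assms(2) by (rule continuous_on_subset) auto
  have chr: "continuous_on (sphere 0 r) h" using assms(2) by (rule continuous_on_subset) (use assms in auto)
  note cont = continuous_on_cmod_powr[OF _ ch, of p] continuous_on_cmod_powr[OF _ chr, of p]
  let ?z = "\<lambda>s. of_real r * cis s" and ?w = "\<lambda>t. of_real R * cis t"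
  let ?h = "\<lambda>t. cmod (h (?w t)) powr p"
  have z: "cmod (?z s) < R" for s using assms by (simp add: norm_mult)
  have "cmod (?w t) \<noteq> cmod (?z s)" for s t using assms by (simp add: norm_mult)
  then have ne: "?w t - ?z s \<noteq> 0" for s t by (metis right_minus_eq)
  have cP: "continuous_on A (\<lambda>(s, t). poisson R (?z s) (?w t))" for A
    unfolding poisson_def case_prod_unfold using ne by (intro continuous_intros) auto
  have cH: "continuous_on A ?h" for A
    using continuous_on_circle_param[OF _ cont(1)] R assms by auto
  have c2: "continuous_on A (\<lambda>(s, t). poisson R (?z s) (?w t) * ?h t)" for A
    unfolding case_prod_unfold
    by (intro continuous_intros cP[unfolded case_prod_unfold] continuous_on_compose2[OF cH[of UNIV]]) auto
  have c3: "continuous_on {0..2*pi} (\<lambda>s. integral {0..2*pi} (\<lambda>t. poisson R (?z s) (?w t) * ?h t))"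
    by (rule integral_continuous_on_param[where a = 0 and b = "2*pi", unfolded cbox_interval, OF c2])
  have "integral {0..2*pi} (\<lambda>s. cmod (h (?z s)) powr p)
     \<le> integral {0..2*pi} (\<lambda>s. 1/(2*pi) * integral {0..2*pi} (\<lambda>t. poisson R (?z s) (?w t) * ?h t))"
  proof (rule integral_le)
    show "(\<lambda>s. cmod (h (?z s)) powr p) integrable_on {0..2*pi}"
      using assms by (intro cavg_integrable cont) auto
    show "(\<lambda>s. 1/(2*pi) * integral {0..2*pi} (\<lambda>t. poisson R (?z s) (?w t) * ?h t)) integrable_on {0..2*pi}"
      by (intro integrable_continuous_interval continuous_intros c3)
    show "cmod (h (?z s)) powr p \<le> 1/(2*pi) * integral {0..2*pi} (\<lambda>t. poisson R (?z s) (?w t) * ?h t)" for s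
      using powr_le_cavg_poisson[OF assms(1-3) z[of s]] unfolding cavg_def .
  qed
  also have "\<dots> = 1/(2*pi) * integral {0..2*pi} (\<lambda>s. integral {0..2*pi} (\<lambda>t. poisson R (?z s) (?w t) * ?h t))"
    by simp
  also have "integral {0..2*pi} (\<lambda>s. integral {0..2*pi} (\<lambda>t. poisson R (?z s) (?w t) * ?h t))
     = integral {0..2*pi} (\<lambda>t. integral {0..2*pi} (\<lambda>s. poisson R (?z s) (?w t) * ?h t))"
    using integral_swap_continuous[OF c2, unfolded cbox_interval] .
  also have "\<dots> = integral {0..2*pi} (\<lambda>t. 2 * pi * ?h t)"
  proof (rule integral_cong)
    fix t
    have "integral {0..2*pi} (\<lambda>s. poisson R (?z s) (?w t) * ?h t)
      = integral {0..2*pi} (\<lambda>s. poisson R (?z t) (?w s)) * ?h t"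
      using assms(4) by (simp add: poisson_swap)
    also have "integral {0..2*pi} (\<lambda>s. poisson R (?z t) (?w s)) = 2 * pi"
      using cavg_poisson[OF z[of t]] unfolding cavg_def by (simp add: field_simps)
    finally show "integral {0..2*pi} (\<lambda>s. poisson R (?z s) (?w t) * ?h t) = 2 * pi * ?h t" .
  qed
  finally show ?thesis unfolding cmean_def cavg_def by (simp add: field_simps)
qed

subsection \<open>Dilations in Hardy spaces\<close>

lemma powr_add_le_add_powr:
  fixes a b m :: real
  assumes "1 \<le> m" "0 \<le> a" "0 \<le> b"
  shows "a powr m + b powr m \<le> (a + b) powr m"
proof -
  have *: "x powr m \<le> x * (a + b) powr (m - 1)" if "0 \<le> x" "x \<le> a + b" for x
  proof (cases "x = 0")
    case False
    then have "x powr m = x * x powr (m - 1)" using that by (simp add: powr_diff)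
    also have "\<dots> \<le> x * (a + b) powr (m - 1)"
      using that assms by (intro mult_left_mono powr_mono2) auto
    finally show ?thesis .
  qed simp
  have "a powr m + b powr m \<le> (a + b) * (a + b) powr (m - 1)"
    using *[of a] *[of b] assms by (simp add: ring_distribs)
  also have "\<dots> = (a + b) powr m"
    using assms by (cases "a + b = 0") (auto simp: powr_diff)
  finally show ?thesis .
qed

lemma powr_midpoint_le:
  fixes a b m :: real
  assumes "1 \<le> m" "0 \<le> a" "0 \<le> b"
  shows "((a + b) / 2) powr m \<le> (a powr m + b powr m) / 2"
proof (cases "a + b = 0")
  case False
  then have "(a + b) / 2 > 0" using assms by auto
  from powr_ge_tangent[OF assms(1) this assms(2)] powr_ge_tangent[OF assms(1) this assms(3)]
  show ?thesis by (simp add: field_simps)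
qed (use assms in auto)

text \<open>With m = q / 2, superadditivity of the m-th power joins the two terms on the left, the
  parallelogram law evaluates the sum of squares, and convexity of the m-th power separates again.
  Both power inequalities require m \<ge> 1.\<close>

lemma clarkson_ge2:
  fixes x y :: complex and q :: real
  assumes "2 \<le> q"
  shows "cmod ((x + y) / 2) powr q + cmod ((x - y) / 2) powr q \<le> (cmod x powr q + cmod y powr q) / 2"
proof -
  define m where "m = q / 2"
  have m: "1 \<le> m" using assms by (simp add: m_def)
  have sq: "w powr q = (w\<^sup>2) powr m" if "0 \<le> w" for w :: real
    using that powr_powr[of w 2 m] by (simp add: m_def)
  have "cmod ((x + y) / 2) powr q + cmod ((x - y) / 2) powr q
     \<le> ((cmod ((x + y) / 2))\<^sup>2 + (cmod ((x - y) / 2))\<^sup>2) powr m"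
    using m by (auto simp: sq intro!: powr_add_le_add_powr)
  also have "(cmod ((x + y) / 2))\<^sup>2 + (cmod ((x - y) / 2))\<^sup>2 = ((cmod x)\<^sup>2 + (cmod y)\<^sup>2) / 2"
    unfolding cmod_power2 by (simp add: power2_eq_square field_simps)
  also have "\<dots> powr m \<le> (((cmod x)\<^sup>2) powr m + ((cmod y)\<^sup>2) powr m) / 2"
    using m by (intro powr_midpoint_le) auto
  finally show ?thesis by (simp add: sq)
qed

lemma powr_add_le:
  fixes a b p :: real
  assumes "0 < p" "0 \<le> a" "0 \<le> b"
  shows "(a + b) powr p \<le> 2 powr p * (a powr p + b powr p)"
proof -
  have "(a + b) powr p \<le> (2 * max a b) powr p" using assms by (intro powr_mono2) auto
  also have "\<dots> = 2 powr p * max a b powr p" using assms by (simp add: powr_mult)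
  also have "\<dots> \<le> 2 powr p * (a powr p + b powr p)"
    by (intro mult_left_mono) (auto simp: max_def)
  finally show ?thesis .
qed

lemma continuous_on_cavg:
  assumes "0 \<le> r" "continuous_on (U \<times> sphere 0 r) (\<lambda>(x, z). \<phi> x z)"
  shows "continuous_on U (\<lambda>x. cavg r (\<phi> x))"
proof -
  have "continuous_on (U \<times> {0..2 * pi}) (\<lambda>(x, t). \<phi> x (of_real r * cis t))"
    unfolding case_prod_unfold
    by (rule continuous_on_compose2[OF assms(2)[unfolded case_prod_unfold],
          where f = "\<lambda>x. (fst x, of_real r * cis (snd x))", simplified])
       (use assms(1) in \<open>auto simp: norm_mult intro!: continuous_intros\<close>)
  then show ?thesis unfolding cavg_def
    by (intro continuous_intros integral_continuous_on_param[where a = 0 and b = "2 * pi", unfolded cbox_interval])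
qed

text \<open>The arithmetic of uniform convexity: \<open>h\<close> and \<open>h'\<close> are means of
  the midpoint of two functions on a fixed and on a larger circle, \<open>x\<close> and
  \<open>x'\<close> means of half their difference on a target circle and the larger one, and
  \<open>a\<close>, \<open>b\<close> the means of the two functions themselves.\<close>

lemma le_of_midpoint_bounds:
  fixes x x' h h' a b L \<epsilon> :: real
  assumes "h' + x' \<le> (a + b) / 2" "a \<le> L" "b \<le> L" "L - \<epsilon> < h" "h \<le> h'" "x \<le> x'"
  shows "x \<le> \<epsilon>"
proof -
  have "(a + b) / 2 \<le> L" using assms(2,3) by simp
  then have "h' + x' \<le> L" using assms(1) by (rule order.trans[rotated])
  moreover have "h + x \<le> h' + x'" using assms(5,6) by (rule add_mono)
  ultimately have "h + x \<le> L" by simp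
  then show ?thesis using assms(4) by (simp add: less_diff_eq)
qed

section \<open>Convergence of dilates for exponents at least 2\<close>

lemma cmean_dilate: "cmean p (\<lambda>z. f (of_real s * z)) r = cmean p f (s * r)"
  unfolding cmean_def cavg_def by (simp add: mult.assoc)

lemma holomorphic_on_disc_continuous_on:
  assumes "h holomorphic_on unit_disc" "S \<subseteq> unit_disc"
  shows "continuous_on S h"
  using assms holomorphic_on_imp_continuous_on continuous_on_subset by blast

lemma cmean_mono_disc:
  assumes "1 \<le> p" "h holomorphic_on unit_disc" "0 \<le> r" "r \<le> R" "R < 1"
  shows "cmean p h r \<le> cmean p h R"
proof (cases "r = R")
  case False
  have "continuous_on (cball 0 R) h" "h holomorphic_on ball 0 R"
    using assms by (auto intro!: holomorphic_on_disc_continuous_on[OF assms(2)] holomorphic_on_subset[OF assms(2)])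
  then show ?thesis using assms False by (intro cmean_mono) auto
qed simp

lemma holomorphic_on_dilate:
  assumes "f holomorphic_on unit_disc" "0 \<le> s" "s \<le> 1"
  shows "(\<lambda>z. f (of_real s * z)) holomorphic_on unit_disc"
proof -
  have "cmod (of_real s * z) < 1" if "cmod z < 1" for z
    using that assms mult_left_le_one_le[of "cmod z" s] by (simp add: norm_mult)
  then show ?thesis
    by (intro holomorphic_on_compose_gen[OF _ assms(1), unfolded o_def] holomorphic_intros) auto
qed

text \<open>Uniform convexity: the midpoint of \<open>f\<close> and a dilate has almost the same mean as \<open>f\<close> on a fixed
  circle, hence by monotonicity on all larger circles.\<close>

lemma dilate_tendsto_ge2:
  assumes q: "2 \<le> q" and f: "f holomorphic_on unit_disc"
    and B: "\<And>r. 0 \<le> r \<Longrightarrow> r < 1 \<Longrightarrow> cmean q f r \<le> B" and e: "0 < e"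
  shows "\<exists>d<1. 0 \<le> d \<and> (\<forall>s R. d < s \<longrightarrow> s < 1 \<longrightarrow> 0 \<le> R \<longrightarrow> R < 1 \<longrightarrow>
           cmean q (\<lambda>z. f (of_real s * z) - f z) R \<le> e)"
proof -
  define L where "L = (SUP r\<in>{0..<1}. cmean q f r)"
  \<comment> \<open>The factor \<open>2 powr q\<close> pays for the halving of the difference in
    Clarkson's inequality.\<close>
  define \<epsilon> where "\<epsilon> = e / (2 * 2 powr q)"
  have \<epsilon>: "\<epsilon> > 0" using e by (simp add: \<epsilon>_def)
  have bdd: "bdd_above ((\<lambda>r. cmean q f r) ` {0..<1})" using B by (intro bdd_aboveI2) auto
  have L: "cmean q f r \<le> L" if "0 \<le> r" "r < 1" for r
    unfolding L_def using that by (intro cSUP_upper bdd) auto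
  have "\<exists>\<rho>\<in>{0..<1}. L - \<epsilon> < cmean q f \<rho>"
    using \<epsilon> unfolding L_def by (subst less_cSUP_iff[symmetric]) (auto simp: bdd)
  then obtain \<rho> where \<rho>: "0 \<le> \<rho>" "\<rho> < 1" "L - \<epsilon> < cmean q f \<rho>" by auto
  define H where "H s z = (f (of_real s * z) + f z) / 2" for s :: real and z
  have le1: "cmod (of_real s * z) < 1" if "cmod z < 1" "0 \<le> s" "s \<le> 1" for s z
    using that mult_left_le_one_le[of "cmod z" s] by (simp add: norm_mult)
  \<comment> \<open>The circle of radius \<rho> is fixed and lies inside the disc, so the mean of
    the midpoint is continuous in s up to s = 1, where the midpoint is \<open>f\<close>
    itself.\<close>
  have "continuous_on {0..1} (\<lambda>s. cmean q (H s) \<rho>)"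
    unfolding cmean_def
  proof (rule continuous_on_cavg[OF \<rho>(1)])
    have "continuous_on ({0..1} \<times> sphere 0 \<rho>) (\<lambda>x. H (fst x) (snd x))"
      unfolding H_def using \<rho> le1
      by (intro continuous_intros continuous_on_compose2[OF holomorphic_on_imp_continuous_on[OF f]]) auto
    then show "continuous_on ({0..1} \<times> sphere 0 \<rho>) (\<lambda>(s, z). cmod (H s z) powr q)"
      using q by (auto simp: case_prod_unfold intro!: continuous_on_cmod_powr)
  qed
  then have "((\<lambda>s. cmean q (H s) \<rho>) \<longlongrightarrow> cmean q (H 1) \<rho>) (at 1 within {0..1})"
    by (simp add: continuous_on_def)
  moreover have "H 1 = f" by (auto simp: H_def)
  ultimately have "\<forall>\<^sub>F s in at 1 within {0..1}. L - \<epsilon> < cmean q (H s) \<rho>"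
    using \<rho>(3) by (auto intro: order_tendstoD)
  then obtain \<eta> where \<eta>: "\<eta> > 0"
    "\<And>s. \<lbrakk>0 \<le> s; s \<le> 1; s \<noteq> 1; dist s 1 < \<eta>\<rbrakk> \<Longrightarrow> L - \<epsilon> < cmean q (H s) \<rho>"
    unfolding eventually_at by auto
  define d where "d = max 0 (1 - \<eta>)"
  have "cmean q (\<lambda>z. f (of_real s * z) - f z) R \<le> e" if s: "d < s" "s < 1" and R: "0 \<le> R" "R < 1" for s R
  proof -
    let ?fs = "\<lambda>z. f (of_real s * z)"
    have s0: "0 \<le> s" using s by (auto simp: d_def)
    have fs: "?fs holomorphic_on unit_disc" using holomorphic_on_dilate[OF f s0] s by simp
    have Hs: "H s holomorphic_on unit_disc" unfolding H_def by (intro holomorphic_intros fs f) auto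
    have Ds: "(\<lambda>z. (?fs z - f z) / 2) holomorphic_on unit_disc" by (intro holomorphic_intros fs f) auto
    \<comment> \<open>Clarkson's inequality is integrated on a circle beyond both the target radius
      and \<rho>; monotonicity then brings in the lower bound from \<rho> and carries the result
      down to \<open>R\<close>. This makes the choice of s independent of \<open>R\<close>.\<close>
    define R' where "R' = max R \<rho>"
    have R': "0 \<le> R'" "R' < 1" "R \<le> R'" "\<rho> \<le> R'" using R \<rho> by (auto simp: R'_def)
    have sub: "sphere 0 R' \<subseteq> unit_disc" using R' by auto
    note cont = holomorphic_on_disc_continuous_on[OF _ sub]
    have q0: "0 < q" using q by simp
    note cH = continuous_on_cmod_powr[OF q0 cont[OF Hs]] and cD = continuous_on_cmod_powr[OF q0 cont[OF Ds]]
      and cfs = continuous_on_cmod_powr[OF q0 cont[OF fs]] and cf = continuous_on_cmod_powr[OF q0 cont[OF f]]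
    have "cmean q (H s) R' + cmean q (\<lambda>z. (?fs z - f z) / 2) R' \<le> (cmean q ?fs R' + cmean q f R') / 2"
    proof -
      have "cmean q (H s) R' + cmean q (\<lambda>z. (?fs z - f z) / 2) R'
        = cavg R' (\<lambda>z. cmod (H s z) powr q + cmod ((?fs z - f z) / 2) powr q)"
        unfolding cmean_def by (subst cavg_add[OF R'(1) cH cD]) (rule refl)
      also have "\<dots> \<le> cavg R' (\<lambda>z. 1/2 * (cmod (?fs z) powr q + cmod (f z) powr q))"
        using clarkson_ge2[OF q]
        by (intro cavg_mono R'(1) continuous_on_add continuous_on_mult continuous_on_const cH cD cfs cf) (simp add: H_def)
      also have "\<dots> = (cmean q ?fs R' + cmean q f R') / 2"
        unfolding cavg_cmult cmean_def by (subst cavg_add[OF R'(1) cfs cf]) simp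
      finally show ?thesis .
    qed
    moreover have "cmean q ?fs R' \<le> L" unfolding cmean_dilate using s0 R' s mult_left_le_one_le[of R' s]
      by (intro L) auto
    moreover have "cmean q f R' \<le> L" by (intro L R')
    moreover have "L - \<epsilon> < cmean q (H s) \<rho>" using s s0 by (intro \<eta>) (auto simp: d_def dist_real_def)
    moreover have "cmean q (H s) \<rho> \<le> cmean q (H s) R'"
      using q R' \<rho> by (intro cmean_mono_disc Hs) auto
    moreover have "cmean q (\<lambda>z. (?fs z - f z) / 2) R \<le> cmean q (\<lambda>z. (?fs z - f z) / 2) R'"
      using q R' R by (intro cmean_mono_disc Ds) auto
    ultimately have "cmean q (\<lambda>z. (?fs z - f z) / 2) R \<le> \<epsilon>" by (rule le_of_midpoint_bounds)
    moreover have "cmean q (\<lambda>z. ?fs z - f z) R = 2 powr q * cmean q (\<lambda>z. (?fs z - f z) / 2) R"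
      unfolding cmean_def cavg_cmult[symmetric] by (simp add: norm_divide powr_divide)
    ultimately have "cmean q (\<lambda>z. ?fs z - f z) R \<le> 2 powr q * \<epsilon>" by simp
    also have "\<dots> \<le> e" using e by (simp add: \<epsilon>_def)
    finally show ?thesis .
  qed
  moreover have "d < 1" "0 \<le> d" using \<eta>(1) by (auto simp: d_def)
  ultimately show ?thesis by blast
qed

section \<open>Factorization of a Hardy space function into two factors of doubled exponent\<close>

lemma holomorphic_factor_zero:
  assumes F: "F holomorphic_on S" and S: "open S" "connected S" "a \<in> S" and "\<exists>w\<in>S. F w \<noteq> 0"
  shows "\<exists>n G. G holomorphic_on S \<and> G a \<noteq> 0 \<and> (\<forall>z\<in>S. F z = (z - a) ^ n * G z)"
proof -
  define n where "n = nat (zorder F a)"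
  define g where "g = zor_poly F a"
  obtain r where r: "r > 0" "cball a r \<subseteq> S" "g holomorphic_on cball a r"
    "\<And>w. w \<in> cball a r \<Longrightarrow> F w = g w * (w - a) ^ n \<and> g w \<noteq> 0"
    using zorder_exist_zero[OF assms(1-5)] unfolding n_def g_def by blast
  \<comment> \<open>The quotient is holomorphic off a, and near a it agrees with the zero-free local
    factor \<open>g\<close>; the two open pieces cover \<open>S\<close>. If \<open>F a\<close> is
    nonzero, the order n is 0.\<close>
  define G where "G z = (if z = a then g a else F z / (z - a) ^ n)" for z
  have Gg: "G z = g z" if "z \<in> ball a r" for z
    using r(4)[of z] that by (auto simp: G_def)
  have "G holomorphic_on ball a r"
    using holomorphic_on_subset[OF r(3) ball_subset_cball] by (rule holomorphic_transform) (simp add: Gg)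
  moreover have "(\<lambda>z. F z / (z - a) ^ n) holomorphic_on S - {a}"
    by (intro holomorphic_intros holomorphic_on_subset[OF F]) auto
  then have "G holomorphic_on S - {a}"
    by (rule holomorphic_transform) (auto simp: G_def)
  ultimately have "G holomorphic_on ball a r \<union> (S - {a})"
    using S by (intro holomorphic_on_Un) auto
  moreover have "ball a r \<union> (S - {a}) = S" using r S ball_subset_cball[of a r] by auto
  ultimately have "G holomorphic_on S" by simp
  moreover have "G a \<noteq> 0" using r by (auto simp: G_def)
  moreover have "\<forall>z\<in>S. F z = (z - a) ^ n * G z"
    using r(1) r(4)[of a] by (auto simp: G_def)
  ultimately show ?thesis by blast
qed

lemma cmod_blaschke_circle:
  assumes "cmod z = 1"
  shows "cmod (z - a) = cmod (1 - cnj a * z)"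
proof -
  have "1 - cnj a * z = z * cnj (z - a)"
    using complex_norm_square[of z] assms by (simp add: algebra_simps)
  then show ?thesis using assms by (simp only: norm_mult complex_mod_cnj)
qed

text \<open>Each zero in the disc is split off as a Blaschke factor, which is collected in \<open>u\<close>; the remaining
  zero-free function has a square root.\<close>

lemma circle_factorization:
  assumes "1 < R" "F holomorphic_on ball 0 R" "\<And>z. cmod z = 1 \<Longrightarrow> F z \<noteq> 0"
  shows "\<exists>u v. continuous_on (cball 0 1) u \<and> u holomorphic_on unit_disc \<and>
           continuous_on (cball 0 1) v \<and> v holomorphic_on unit_disc \<and>
           (\<forall>z\<in>cball 0 1. F z = u z * v z) \<and> (\<forall>z. cmod z = 1 \<longrightarrow> cmod (u z) = cmod (v z))"
proof -
  have fin: "finite {z\<in>cball 0 1. F z = 0}" if F: "F holomorphic_on ball 0 R" "\<And>z. cmod z = 1 \<Longrightarrow> F z \<noteq> 0" for F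
  proof (cases "F constant_on ball 0 R")
    case True
    then obtain c where "\<And>z. z \<in> ball 0 R \<Longrightarrow> F z = c" unfolding constant_on_def by blast
    then have "F z \<noteq> 0" if "z \<in> cball 0 1" for z using that F(2)[of 1] \<open>1 < R\<close> by auto
    then have "{z\<in>cball 0 1. F z = 0} = {}" by blast
    then show ?thesis by (simp only: finite.emptyI)
  next
    case False
    then show ?thesis using \<open>1 < R\<close>
      by (intro holomorphic_compact_finite_zeros[OF F(1)]) auto
  qed
  show ?thesis using assms(2,3)
  proof (induction "card {z\<in>cball 0 1. F z = 0}" arbitrary: F)
    case 0
    then have nz: "F z \<noteq> 0" if "z \<in> cball 0 1" for z using fin[OF 0(2,3)] that by auto
    \<comment> \<open>The square root is taken on a disc slightly larger than the closed unit disc,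
      which makes it continuous up to the circle.\<close>
    define U where "U = ball 0 R \<inter> F -` (- {0})"
    have "open U" unfolding U_def
      using 0(2) by (intro continuous_open_preimage holomorphic_on_imp_continuous_on) auto
    moreover have "cball 0 1 \<subseteq> U" using nz \<open>1 < R\<close> by (auto simp: U_def)
    ultimately obtain \<epsilon> where \<epsilon>: "\<epsilon> > 0" "(\<Union>x\<in>cball 0 1. ball x \<epsilon>) \<subseteq> U"
      using compact_subset_open_imp_ball_epsilon_subset[OF compact_cball] by metis
    define \<delta> where "\<delta> = min 1 \<epsilon>"
    have sub: "ball 0 (1 + \<delta>) \<subseteq> U"
    proof
      fix z :: complex assume z: "z \<in> ball 0 (1 + \<delta>)"
      show "z \<in> U"
      proof (cases "cmod z \<le> 1")
        case True then show ?thesis using \<open>cball 0 1 \<subseteq> U\<close> by auto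
      next
        case False
        \<comment> \<open>\<open>sgn z\<close> is the radial projection of z to the unit circle, and
          its distance from z is |z| - 1.\<close>
        have "sgn z \<in> cball 0 1" by (simp add: norm_sgn)
        moreover have "dist (sgn z) z < \<epsilon>"
        proof -
          have "sgn z - z = (1 - cmod z) *\<^sub>R sgn z"
            using False by (cases "z = 0") (auto simp: sgn_div_norm algebra_simps scaleR_diff_left)
          then have "norm (sgn z - z) = \<bar>1 - cmod z\<bar>"
            using False by (auto simp: norm_sgn)
          then show ?thesis using z False by (simp add: dist_norm \<delta>_def)
        qed
        ultimately have "z \<in> (\<Union>x\<in>cball 0 1. ball x \<epsilon>)" by (intro UN_I[of "sgn z"]) auto
        then show ?thesis using \<epsilon>(2) by blast
      qed
    qed
    have hF: "F holomorphic_on ball 0 (1 + \<delta>)"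
      using 0(2) by (rule holomorphic_on_subset) (use sub in \<open>auto simp: U_def\<close>)
    obtain g where g: "g holomorphic_on ball 0 (1 + \<delta>)" "\<And>z. z \<in> ball 0 (1 + \<delta>) \<Longrightarrow> F z = g z ^ 2"
      using contractible_imp_holomorphic_sqrt[OF hF] convex_imp_contractible[OF convex_ball] sub
      by (auto simp: U_def subset_iff)
    have "cball 0 1 \<subseteq> ball (0::complex) (1 + \<delta>)" using \<epsilon>(1) by (auto simp: \<delta>_def)
    moreover from this have "unit_disc \<subseteq> ball (0::complex) (1 + \<delta>)" using ball_subset_cball by blast
    ultimately show ?case
      using g holomorphic_on_subset[OF g(1)] continuous_on_subset[OF holomorphic_on_imp_continuous_on[OF g(1)]]
      by (intro exI[of _ g]) (auto simp: power2_eq_square subset_iff)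
  next
    case (Suc k)
    then have "{z\<in>cball 0 1. F z = 0} \<noteq> {}" by (metis card.empty nat.distinct(1))
    then obtain a where a: "cmod a \<le> 1" "F a = 0" by auto
    have a1: "cmod a < 1" using a Suc(4)[of a] by force
    have ex: "\<exists>w\<in>ball 0 R. F w \<noteq> 0"
      using Suc(4)[of 1] \<open>1 < R\<close> by (intro bexI[of _ 1]) auto
    have "a \<in> ball 0 R" using a1 \<open>1 < R\<close> by simp
    from holomorphic_factor_zero[OF Suc(3) open_ball connected_ball this ex]
    obtain n G where "G holomorphic_on ball 0 R \<and> G a \<noteq> 0 \<and> (\<forall>z\<in>ball 0 R. F z = (z - a) ^ n * G z)"
      by (elim exE)
    then have G: "G holomorphic_on ball 0 R" "G a \<noteq> 0" "\<And>z. z \<in> ball 0 R \<Longrightarrow> F z = (z - a) ^ n * G z"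
      by simp_all
    \<comment> \<open>The zero at a is moved out of the closed disc to its reflection in the unit
      circle. The modulus on the circle stays the same, and the number of distinct zeros drops by
      one, whatever the order n.\<close>
    define F' where "F' z = (1 - cnj a * z) ^ n * G z" for z
    have nz: "1 - cnj a * z \<noteq> 0" if "cmod z \<le> 1" for z
    proof
      assume "1 - cnj a * z = 0"
      then have "cmod (cnj a * z) = 1" by (metis eq_iff_diff_eq_0 norm_one)
      moreover have "cmod a * cmod z \<le> cmod a * 1" using that by (intro mult_left_mono) auto
      ultimately show False using a1 by (simp add: norm_mult)
    qed
    have n: "n > 0" using a G(2) G(3)[of a] \<open>1 < R\<close> by (cases n) auto
    have F': "F' holomorphic_on ball 0 R" unfolding F'_def by (intro holomorphic_intros G)
    have zF: "F z = 0 \<longleftrightarrow> z = a \<or> F' z = 0" if "cmod z \<le> 1" for z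
      using G(3)[of z] nz[OF that] that \<open>1 < R\<close> n by (auto simp: F'_def)
    have "F' a \<noteq> 0" using nz[of a] a G(2) by (auto simp: F'_def)
    then have "{z\<in>cball 0 1. F' z = 0} = {z\<in>cball 0 1. F z = 0} - {a}" using zF by auto
    then have card: "k = card {z\<in>cball 0 1. F' z = 0}"
      using Suc(2) a fin[OF Suc(3,4)] by (simp add: card_Diff_singleton)
    have nz': "F' z \<noteq> 0" if "cmod z = 1" for z using zF[of z] Suc(4)[OF that] that by auto
    have "\<exists>u v. continuous_on (cball 0 1) u \<and> u holomorphic_on unit_disc \<and>
           continuous_on (cball 0 1) v \<and> v holomorphic_on unit_disc \<and>
           (\<forall>z\<in>cball 0 1. F' z = u z * v z) \<and> (\<forall>z. cmod z = 1 \<longrightarrow> cmod (u z) = cmod (v z))"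
      by (rule Suc(1)[OF card F']) (rule nz')
    then obtain u v where uv: "continuous_on (cball 0 1) u" "u holomorphic_on unit_disc"
        "continuous_on (cball 0 1) v" "v holomorphic_on unit_disc"
        "\<And>z. z \<in> cball 0 1 \<Longrightarrow> F' z = u z * v z" "\<And>z. cmod z = 1 \<Longrightarrow> cmod (u z) = cmod (v z)"
      by blast
    define w where "w z = u z * ((z - a) / (1 - cnj a * z)) ^ n" for z
    have "continuous_on (cball 0 1) w" "w holomorphic_on unit_disc"
      unfolding w_def using nz by (auto intro!: continuous_intros holomorphic_intros uv)
    moreover have "F z = w z * v z" if "z \<in> cball 0 1" for z
    proof -
      have "F z = (z - a) ^ n * G z" using that \<open>1 < R\<close> by (intro G) auto
      also have "\<dots> = ((z - a) / (1 - cnj a * z)) ^ n * F' z"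
        using nz[of z] that by (simp add: F'_def power_divide)
      finally show ?thesis using uv(5)[OF that] by (simp add: w_def)
    qed
    moreover have "cmod (w z) = cmod (v z)" if "cmod z = 1" for z
      using cmod_blaschke_circle[OF that, of a] nz[of z] uv(6)[OF that] that
      by (simp add: w_def norm_mult norm_power norm_divide)
    ultimately show ?case using uv(3,4) by (intro exI[of _ w] exI[of _ v] conjI ballI allI impI)
  qed
qed

lemma cmean_limit_le:
  assumes "0 \<le> r" "0 < q" "\<And>n. continuous_on (sphere 0 r) (u n)"
    and "\<And>n z. cmod z = r \<Longrightarrow> cmod (u n z) \<le> M"
    and "\<And>z. cmod z = r \<Longrightarrow> (\<lambda>n. u n z) \<longlonglongrightarrow> v z"
    and "\<And>n. cmean q (u n) r \<le> B"
  shows "cmean q v r \<le> B"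
proof -
  let ?z = "\<lambda>t. of_real r * cis t :: complex"
  have z: "cmod (?z t) = r" for t using assms(1) by (simp add: norm_mult)
  have "(\<lambda>n. integral {0..2*pi} (\<lambda>t. cmod (u n (?z t)) powr q)) \<longlonglongrightarrow> integral {0..2*pi} (\<lambda>t. cmod (v (?z t)) powr q)"
  proof (rule dominated_convergence(2)[where h = "\<lambda>_. M powr q"])
    show "(\<lambda>t. cmod (u n (?z t)) powr q) integrable_on {0..2*pi}" for n
      by (intro cavg_integrable continuous_on_cmod_powr assms)
    show "norm (cmod (u n (?z t)) powr q) \<le> M powr q" for n t
      using assms(2) z by (auto intro!: powr_mono2 assms(4))
    show "(\<lambda>n. cmod (u n (?z t)) powr q) \<longlonglongrightarrow> cmod (v (?z t)) powr q" for t
      using assms(2) z by (intro tendsto_powr' tendsto_norm assms(5)) auto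
  qed auto
  then have "(\<lambda>n. cmean q (u n) r) \<longlonglongrightarrow> cmean q v r"
    unfolding cmean_def cavg_def by (intro tendsto_intros)
  then show ?thesis using assms(6) by (intro LIMSEQ_le_const2) auto
qed

text \<open>Dilates of f without zeros on the unit circle are split by
  \<open>circle_factorization\<close>. On the circle both factors have modulus |f|^(1/2), so their
  2p-means there equal the p-mean of the dilate and inherit the bound \<open>B\<close>. Montel's
  theorem, applied twice, gives limits of the factors as the dilates tend to f.\<close>

lemma Hp_factorization:
  assumes p: "1 \<le> p" and f: "f holomorphic_on unit_disc"
    and B: "\<And>r. 0 \<le> r \<Longrightarrow> r < 1 \<Longrightarrow> cmean p f r \<le> B"
  shows "\<exists>u v. u holomorphic_on unit_disc \<and> v holomorphic_on unit_disc \<and> (\<forall>z\<in>unit_disc. f z = u z * v z) \<and>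
           (\<forall>r. 0 \<le> r \<longrightarrow> r < 1 \<longrightarrow> cmean (2 * p) u r \<le> B \<and> cmean (2 * p) v r \<le> B)"
proof (cases "\<forall>z\<in>unit_disc. f z = 0")
  case True
  have "0 \<le> cmean p f 0" using p by (intro cmean_nonneg holomorphic_on_disc_continuous_on[OF f]) auto
  then have "B \<ge> 0" using B[of 0] by simp
  moreover have "cmean (2 * p) (\<lambda>_. 0) r = 0" for r using p by (simp add: cmean_def)
  ultimately show ?thesis using True
    by (intro exI[of _ "\<lambda>_. 0"]) auto
next
  case False
  have ex_s: "\<exists>s. c < s \<and> s < 1 \<and> (\<forall>z. cmod z = s \<longrightarrow> f z \<noteq> 0)" if c: "0 \<le> c" "c < 1" for c
  proof -
    \<comment> \<open>The compact disc of radius \<open>b\<close> contains only finitely many zeros,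
      so infinitely many radii between \<open>c\<close> and \<open>b\<close> meet none of
      them.\<close>
    define b where "b = (c + 1) / 2"
    have b: "c < b" "b < 1" using c by (auto simp: b_def)
    have "finite {z\<in>cball 0 b. f z = 0}"
    proof (cases "f constant_on unit_disc")
      case True
      then have "{z\<in>cball 0 b. f z = 0} = {}" using False b
        unfolding constant_on_def by (auto simp: subset_iff)
      then show ?thesis by (simp only: finite.emptyI)
    next
      case False
      then show ?thesis using b by (intro holomorphic_compact_finite_zeros[OF f]) auto
    qed
    then have "infinite ({c<..<b} - cmod ` {z\<in>cball 0 b. f z = 0})"
      using b by (intro Diff_infinite_finite) auto
    then obtain s where s: "s \<in> {c<..<b} - cmod ` {z\<in>cball 0 b. f z = 0}"
      using infinite_imp_nonempty by blast
    then have "f z \<noteq> 0" if "cmod z = s" for z using that by auto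
    then show ?thesis using s b by (intro exI[of _ s]) auto
  qed
  have "\<exists>s. 1 - 1 / real (Suc n) < s \<and> s < 1 \<and> (\<forall>z. cmod z = s \<longrightarrow> f z \<noteq> 0)" for n
    by (intro ex_s) (auto simp: field_simps)
  then obtain s where s: "\<And>n. 1 - 1 / real (Suc n) < s n" "\<And>n. s n < 1" "\<And>n z. cmod z = s n \<Longrightarrow> f z \<noteq> 0"
    by metis
  have s0: "0 < s n" for n using s(1)[of n] by (smt (verit) divide_le_eq_1 of_nat_Suc of_nat_0_le_iff)
  have s_lim: "s \<longlonglongrightarrow> 1"
  proof (rule tendsto_sandwich[of "\<lambda>n. 1 - 1 / real (Suc n)" s sequentially "\<lambda>_. 1"])
    show "(\<lambda>n. 1 - 1 / real (Suc n)) \<longlonglongrightarrow> 1"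
      using tendsto_diff[OF tendsto_const LIMSEQ_inverse_real_of_nat, of 1] by (simp add: inverse_eq_divide)
  qed (use s in \<open>auto intro!: always_eventually less_imp_le\<close>)
  define P where "P n u v \<longleftrightarrow> continuous_on (cball 0 1) u \<and> u holomorphic_on unit_disc \<and>
           continuous_on (cball 0 1) v \<and> v holomorphic_on unit_disc \<and>
           (\<forall>z\<in>cball 0 1. f (of_real (s n) * z) = u z * v z) \<and> (\<forall>z. cmod z = 1 \<longrightarrow> cmod (u z) = cmod (v z))"
    for n u v
  have "\<exists>u v. P n u v" for n
    unfolding P_def
  proof (rule circle_factorization)
    show "1 < 1 / s n" using s0[of n] s(2)[of n] by simp
    have "cmod (of_real (s n) * z) < 1" if "cmod z < 1 / s n" for z
      using that s0[of n] by (simp add: norm_mult field_simps)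
    then show "(\<lambda>z. f (of_real (s n) * z)) holomorphic_on ball 0 (1 / s n)"
      by (intro holomorphic_on_compose_gen[OF _ f, unfolded o_def] holomorphic_intros) auto
    show "f (of_real (s n) * z) \<noteq> 0" if "cmod z = 1" for z
      using that s0[of n] by (intro s(3)[of _ n]) (auto simp: norm_mult)
  qed
  then obtain u v where uv: "\<And>n. P n (u n) (v n)" by metis
  \<comment> \<open>The last clause is the local boundedness that Montel's theorem requires. It
    follows from the bound on the means; x \<le> 1 + x^(2p) spares the extraction of a root and
    accounts for the summand 1.\<close>
  define H where "H = {h. h holomorphic_on unit_disc \<and> (\<forall>r. 0 \<le> r \<longrightarrow> r < 1 \<longrightarrow> cmean (2 * p) h r \<le> B) \<and>
      (\<forall>z\<in>unit_disc. cmod (h z) \<le> 1 + (1 + cmod z) / (1 - cmod z) * B)}"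
  have H: "h \<in> H" if h: "continuous_on (cball 0 1) h" "h holomorphic_on unit_disc" "cmean (2 * p) h 1 \<le> B" for h
  proof -
    have "cmean (2 * p) h r \<le> B" if "0 \<le> r" "r < 1" for r
      using cmean_mono[OF _ h(1,2) that, of "2 * p"] h(3) p by simp
    moreover have "cmod (h z) \<le> 1 + (1 + cmod z) / (1 - cmod z) * B" if z: "cmod z < 1" for z
    proof -
      have "cmod (h z) powr (2 * p) \<le> (1 + cmod z) / (1 - cmod z) * cmean (2 * p) h 1"
        using p z by (intro powr_le_cmean h) auto
      also have "\<dots> \<le> (1 + cmod z) / (1 - cmod z) * B"
        using z h(3) by (intro mult_left_mono) auto
      finally have *: "cmod (h z) powr (2 * p) \<le> (1 + cmod z) / (1 - cmod z) * B" .
      have "cmod (h z) \<le> 1 + cmod (h z) powr (2 * p)"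
      proof (cases "cmod (h z) \<le> 1")
        case False
        then have "cmod (h z) powr 1 \<le> cmod (h z) powr (2 * p)" using p by (intro powr_mono) auto
        then show ?thesis using False by simp
      qed (simp add: add_increasing2)
      with * show ?thesis by simp
    qed
    ultimately show ?thesis using h(2) by (simp add: H_def)
  qed
  have mean: "cmean (2 * p) w 1 \<le> B" if "P n (u n) (v n)" "\<And>z. cmod z = 1 \<Longrightarrow> cmod (w z) = cmod (v n z)" for w n
  proof -
    have "cmod (w z) powr (2 * p) = cmod (f (of_real (s n) * z)) powr p" if z: "cmod z = 1" for z
    proof -
      have "cmod (f (of_real (s n) * z)) = cmod (w z) powr 2"
        using that(1) \<open>P n (u n) (v n)\<close> \<open>\<And>z. cmod z = 1 \<Longrightarrow> cmod (w z) = cmod (v n z)\<close>[OF z]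
        unfolding P_def by (simp add: norm_mult power2_eq_square)
      then show ?thesis by (simp only: powr_powr)
    qed
    then have "cmean (2 * p) w 1 = cmean p (\<lambda>z. f (of_real (s n) * z)) 1"
      unfolding cmean_def by (intro cavg_cong) auto
    also have "\<dots> = cmean p f (s n)" by (simp add: cmean_dilate)
    also have "\<dots> \<le> B" using s0[of n] s(2)[of n] by (intro B) auto
    finally show ?thesis .
  qed
  have uH: "u n \<in> H" and vH: "v n \<in> H" for n
    using uv[of n] mean[OF uv[of n], of "u n"] mean[OF uv[of n], of "v n"] by (auto intro!: H simp: P_def)
  have B0: "B \<ge> 0"
    using B[of 0] cmean_nonneg[of 0 p f] p holomorphic_on_disc_continuous_on[OF f, of "sphere 0 0"] by auto
  have bnd: "cmod (h z) \<le> 1 + 2 / (1 - \<rho>) * B" if "h \<in> H" "cmod z \<le> \<rho>" "\<rho> < 1" for h z \<rho>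
  proof -
    have "cmod (h z) \<le> 1 + (1 + cmod z) / (1 - cmod z) * B" using that by (auto simp: H_def)
    also have "\<dots> \<le> 1 + 2 / (1 - \<rho>) * B"
      using that B0 by (intro add_left_mono mult_right_mono frac_le) auto
    finally show ?thesis .
  qed
  have bnd': "\<exists>C. \<forall>h\<in>H. \<forall>z\<in>K. cmod (h z) \<le> C" if K: "compact K" "K \<subseteq> unit_disc" for K
  proof (cases "K = {}")
    case False
    have "continuous_on K cmod" by (intro continuous_intros)
    from continuous_attains_sup[OF K(1) False this]
    obtain z0 where "z0 \<in> K" "\<And>z. z \<in> K \<Longrightarrow> cmod z \<le> cmod z0" by blast
    then show ?thesis using bnd[of _ _ "cmod z0"] K(2)
      by (intro exI[of _ "1 + 2 / (1 - cmod z0) * B"]) auto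
  qed auto
  have lim_le: "cmean (2 * p) g r \<le> B" if "\<And>n. h n \<in> H" "\<And>z. z \<in> unit_disc \<Longrightarrow> (\<lambda>n. h n z) \<longlonglongrightarrow> g z"
     "0 \<le> r" "r < 1" for h g r
    using that p
    by (intro cmean_limit_le[of r "2 * p" h "1 + 2 / (1 - r) * B" g] bnd) (auto simp: H_def intro!: holomorphic_on_disc_continuous_on)
  have rngH: "range (\<lambda>n. h (k n)) \<subseteq> H" if "\<And>n. h n \<in> H" for h and k :: "nat \<Rightarrow> nat" using that by auto
  obtain g r where g: "g holomorphic_on unit_disc" "strict_mono (r :: nat \<Rightarrow> nat)"
      "\<And>z. z \<in> unit_disc \<Longrightarrow> (\<lambda>n. u (r n) z) \<longlonglongrightarrow> g z"
    by (rule Montel[of unit_disc H u]) (use uH bnd' in \<open>auto simp: H_def\<close>)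
  obtain k r' where k: "k holomorphic_on unit_disc" "strict_mono (r' :: nat \<Rightarrow> nat)"
      "\<And>z. z \<in> unit_disc \<Longrightarrow> (\<lambda>n. v (r (r' n)) z) \<longlonglongrightarrow> k z"
    by (rule Montel[of unit_disc H "\<lambda>n. v (r n)"]) (use vH bnd' in \<open>auto simp: H_def\<close>)
  have rr: "strict_mono (\<lambda>n. r (r' n))" using g(2) k(2) by (auto simp: strict_mono_def)
  have "f z = g z * k z" if z: "z \<in> unit_disc" for z
  proof -
    have "(\<lambda>n. u (r (r' n)) z * v (r (r' n)) z) \<longlonglongrightarrow> g z * k z"
      using LIMSEQ_subseq_LIMSEQ[OF g(3)[OF z] k(2)] by (intro tendsto_mult k(3)[OF z]) (simp add: o_def)
    moreover have "u n z * v n z = f (of_real (s n) * z)" for n using uv[of n] z by (auto simp: P_def)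
    moreover have "(\<lambda>n. f (of_real (s (r (r' n))) * z)) \<longlonglongrightarrow> f z"
    proof (rule isCont_tendsto_compose[where g = f])
      show "isCont f z" using z holomorphic_on_imp_continuous_on[OF f] continuous_on_eq_continuous_at[OF open_ball] by blast
      show "(\<lambda>n. of_real (s (r (r' n))) * z) \<longlonglongrightarrow> z"
        using tendsto_mult[OF tendsto_of_real[OF LIMSEQ_subseq_LIMSEQ[OF s_lim rr]] tendsto_const, of z] by (simp add: o_def)
    qed
    ultimately show ?thesis using LIMSEQ_unique by fastforce
  qed
  then show ?thesis using g k uH vH
      lim_le[of "\<lambda>n. u (r n)" g] lim_le[of "\<lambda>n. v (r (r' n))" k]
    by (intro exI[of _ g] exI[of _ k]) auto
qed

text \<open>If f = u v and the index s denotes dilation, then f_s - f = u_s (v_s - v) + v (u_s - u).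
  In each product one factor has bounded 2p-mean and the other a small one.\<close>

lemma dilate_tendsto:
  assumes p: "1 \<le> p" and f: "f holomorphic_on unit_disc"
    and B: "\<And>r. 0 \<le> r \<Longrightarrow> r < 1 \<Longrightarrow> cmean p f r \<le> B" and e: "0 < e"
  shows "\<exists>d<1. 0 \<le> d \<and> (\<forall>s R. d < s \<longrightarrow> s < 1 \<longrightarrow> 0 \<le> R \<longrightarrow> R < 1 \<longrightarrow>
           cmean p (\<lambda>z. f (of_real s * z) - f z) R \<le> e)"
proof -
  obtain u v where uv: "u holomorphic_on unit_disc" "v holomorphic_on unit_disc" "\<And>z. z \<in> unit_disc \<Longrightarrow> f z = u z * v z"
    and Bu: "\<And>r. 0 \<le> r \<Longrightarrow> r < 1 \<Longrightarrow> cmean (2 * p) u r \<le> B"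
    and Bv: "\<And>r. 0 \<le> r \<Longrightarrow> r < 1 \<Longrightarrow> cmean (2 * p) v r \<le> B"
    using Hp_factorization[OF p f B] by blast
  have B0: "B \<ge> 0"
    using B[of 0] cmean_nonneg[of 0 p f] p holomorphic_on_disc_continuous_on[OF f, of "sphere 0 0"] by auto
  \<comment> \<open>The final bound is
    \<open>2 powr p * \<delta> * B + 2 powr p * \<epsilon> / \<delta>\<close>. Here \<delta> makes
    the first summand at most e / 2, also for B = 0, and \<epsilon>, chosen afterwards, makes the
    second equal to e / 2.\<close>
  define \<delta> where "\<delta> = e / (2 powr p * 2 * (B + 1))"
  have \<delta>: "\<delta> > 0" using e B0 by (simp add: \<delta>_def)
  define \<epsilon> where "\<epsilon> = \<delta> * e / (2 powr p * 2)"
  have \<epsilon>: "\<epsilon> > 0" using e \<delta> by (simp add: \<epsilon>_def)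
  have p2: "2 \<le> 2 * p" using p by simp
  obtain d1 where d1: "d1 < 1" "0 \<le> d1" "\<And>s R. d1 < s \<Longrightarrow> s < 1 \<Longrightarrow> 0 \<le> R \<Longrightarrow> R < 1 \<Longrightarrow>
           cmean (2 * p) (\<lambda>z. u (of_real s * z) - u z) R \<le> \<epsilon>"
    using dilate_tendsto_ge2[OF p2 uv(1) Bu \<epsilon>] by blast
  obtain d2 where d2: "d2 < 1" "0 \<le> d2" "\<And>s R. d2 < s \<Longrightarrow> s < 1 \<Longrightarrow> 0 \<le> R \<Longrightarrow> R < 1 \<Longrightarrow>
           cmean (2 * p) (\<lambda>z. v (of_real s * z) - v z) R \<le> \<epsilon>"
    using dilate_tendsto_ge2[OF p2 uv(2) Bv \<epsilon>] by blast
  have "cmean p (\<lambda>z. f (of_real s * z) - f z) R \<le> e" if s: "max d1 d2 < s" "s < 1" and R: "0 \<le> R" "R < 1" for s R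
  proof -
    let ?C = "2 powr p / 2"
    let ?us = "\<lambda>z. u (of_real s * z)" and ?vs = "\<lambda>z. v (of_real s * z)"
    let ?du = "\<lambda>z. ?us z - u z" and ?dv = "\<lambda>z. ?vs z - v z"
    have s0: "0 \<le> s" "s \<le> 1" using s d1 by auto
    have sR: "s * R < 1" "0 \<le> s * R" using s0 R mult_left_le_one_le[of R s] by auto
    have sub: "sphere 0 R \<subseteq> unit_disc" using R by auto
    note hol = holomorphic_on_dilate[OF uv(1) s0] holomorphic_on_dilate[OF uv(2) s0] holomorphic_on_dilate[OF f s0]
    note cont = holomorphic_on_disc_continuous_on[OF _ sub]
    have q0: "0 < 2 * p" "0 < p" using p by auto
    have hdu: "?du holomorphic_on unit_disc" and hdv: "?dv holomorphic_on unit_disc"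
      by (intro holomorphic_intros hol uv)+
    have hdf: "(\<lambda>z. f (of_real s * z) - f z) holomorphic_on unit_disc"
      by (intro holomorphic_intros hol f)
    note c1 = continuous_on_cmod_powr[OF q0(1) cont[OF hol(1)]] continuous_on_cmod_powr[OF q0(1) cont[OF hdv]]
      continuous_on_cmod_powr[OF q0(1) cont[OF uv(2)]] continuous_on_cmod_powr[OF q0(1) cont[OF hdu]]
      continuous_on_cmod_powr[OF q0(2) cont[OF hdf]]
    \<comment> \<open>The weighted arithmetic-geometric mean inequality replaces the Cauchy-Schwarz
      inequality for means; the weight \<delta> goes to the merely bounded factor.\<close>
    have amgm: "cmod (x * y) powr p \<le> (\<delta> * cmod x powr (2 * p) + cmod y powr (2 * p) / \<delta>) / 2" for x y
    proof -
      define a where "a = cmod x powr p"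
      define b where "b = cmod y powr p"
      have "0 \<le> (\<delta> * a - b)\<^sup>2 / \<delta>" using \<delta> by simp
      also have "\<dots> = \<delta> * a\<^sup>2 + b\<^sup>2 / \<delta> - 2 * (a * b)" using \<delta> by (simp add: field_simps power2_eq_square)
      finally have "a * b \<le> (\<delta> * a\<^sup>2 + b\<^sup>2 / \<delta>) / 2" by simp
      moreover have "a\<^sup>2 = cmod x powr (2 * p)" "b\<^sup>2 = cmod y powr (2 * p)"
        by (simp_all add: a_def b_def power2_eq_square flip: powr_add)
      ultimately show ?thesis by (simp add: a_def b_def norm_mult powr_mult)
    qed
    have pt: "cmod (f (of_real s * z) - f z) powr p \<le>
       ?C * (\<delta> * cmod (?us z) powr (2 * p) + 1 / \<delta> * cmod (?dv z) powr (2 * p)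
         + (\<delta> * cmod (v z) powr (2 * p) + 1 / \<delta> * cmod (?du z) powr (2 * p)))" if z: "cmod z = R" for z
    proof -
      have "of_real s * z \<in> unit_disc" using sR z s0 by (simp add: norm_mult)
      moreover have "z \<in> unit_disc" using z R by simp
      ultimately have "f (of_real s * z) - f z = ?us z * ?dv z + v z * ?du z"
        by (simp add: uv(3) algebra_simps)
      then have "cmod (f (of_real s * z) - f z) powr p \<le> (cmod (?us z * ?dv z) + cmod (v z * ?du z)) powr p"
        using p by (metis norm_triangle_ineq norm_ge_zero powr_mono2 order.trans zero_le_one)
      also have "\<dots> \<le> 2 powr p * (cmod (?us z * ?dv z) powr p + cmod (v z * ?du z) powr p)"
        using p by (intro powr_add_le) auto
      also have "\<dots> \<le> 2 powr p * ((\<delta> * cmod (?us z) powr (2 * p) + cmod (?dv z) powr (2 * p) / \<delta>) / 2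
          + (\<delta> * cmod (v z) powr (2 * p) + cmod (?du z) powr (2 * p) / \<delta>) / 2)"
        by (intro mult_left_mono add_mono amgm) auto
      also have "\<dots> = ?C * (\<delta> * cmod (?us z) powr (2 * p) + 1 / \<delta> * cmod (?dv z) powr (2 * p)
         + (\<delta> * cmod (v z) powr (2 * p) + 1 / \<delta> * cmod (?du z) powr (2 * p)))" by (simp add: field_simps)
      finally show ?thesis .
    qed
    have "cmean p (\<lambda>z. f (of_real s * z) - f z) R \<le> cavg R (\<lambda>z. ?C * (\<delta> * cmod (?us z) powr (2 * p) + 1 / \<delta> * cmod (?dv z) powr (2 * p)
         + (\<delta> * cmod (v z) powr (2 * p) + 1 / \<delta> * cmod (?du z) powr (2 * p))))"
      unfolding cmean_def
      by (rule cavg_mono[OF R(1) _ _ pt])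
         (intro continuous_on_add continuous_on_mult continuous_on_const c1)+
    also have "\<dots> = ?C * (\<delta> * cmean (2 * p) ?us R + 1 / \<delta> * cmean (2 * p) ?dv R
        + (\<delta> * cmean (2 * p) v R + 1 / \<delta> * cmean (2 * p) ?du R))"
    proof -
      have *: "cavg R (\<lambda>z. a * \<phi> z + b * \<psi> z) = a * cavg R \<phi> + b * cavg R \<psi>"
        if "continuous_on (sphere 0 R) \<phi>" "continuous_on (sphere 0 R) \<psi>" for a b \<phi> \<psi>
        using that R by (subst cavg_add) (auto intro!: continuous_intros simp: cavg_cmult)
      show ?thesis
        unfolding cmean_def cavg_cmult
        by (subst cavg_add[OF R(1)]; (intro continuous_on_add continuous_on_mult continuous_on_const c1)?)
           (simp only: *[OF c1(1,2)] *[OF c1(3,4)])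
    qed
    also have "\<dots> \<le> ?C * (\<delta> * B + 1 / \<delta> * \<epsilon> + (\<delta> * B + 1 / \<delta> * \<epsilon>))"
      using \<delta> s R sR d1 d2 by (intro mult_left_mono add_mono Bv) (auto simp: cmean_dilate[of _ u] intro!: Bu d1(3) d2(3) divide_right_mono)
    also have "\<dots> = 2 powr p * \<delta> * B + 2 powr p * \<epsilon> / \<delta>" by (simp add: field_simps)
    also have "2 powr p * \<delta> * B = e / 2 * (B / (B + 1))"
      using B0 by (simp add: \<delta>_def)
    also have "\<dots> \<le> e / 2 * 1" using B0 e by (intro mult_left_mono) auto
    also have "2 powr p * \<epsilon> / \<delta> = e / 2" using \<delta> by (simp add: \<epsilon>_def)
    finally show ?thesis by simp
  qed
  then show ?thesis using d1 d2 by (intro exI[of _ "max d1 d2"]) auto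
qed

subsection \<open>Zero-free entire functions of exponential type\<close>

text \<open>The map x / (2 - x) fixes 0 and takes the half-plane Re x < 1 into the unit disc.
  Schwarz's lemma bounds the image w by 1 / 2, and H = 2 w / (1 + w) then gives the constant
  2.\<close>

lemma Borel_Caratheodory_half:
  assumes H: "H holomorphic_on unit_disc" "H 0 = 0" "\<And>z. z \<in> unit_disc \<Longrightarrow> Re (H z) < 1" and z: "cmod z \<le> 1 / 2"
  shows "cmod (H z) \<le> 2"
proof -
  define w where "w z = H z / (2 - H z)" for z
  have ne: "2 - H z \<noteq> 0" if "z \<in> unit_disc" for z using H(3)[OF that]
    by (metis eq_iff_diff_eq_0 complex_Re_numeral not_numeral_less_one)
  have lt: "cmod (H z) < cmod (2 - H z)" if "z \<in> unit_disc" for z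
  proof -
    have "(cmod (H z))\<^sup>2 < (cmod (2 - H z))\<^sup>2"
      using H(3)[OF that] unfolding cmod_power2 by (simp add: power2_eq_square algebra_simps)
    then show ?thesis by (rule power2_less_imp_less) simp
  qed
  have "w holomorphic_on unit_disc" unfolding w_def using ne by (intro holomorphic_intros H) auto
  moreover have "w 0 = 0" using H(2) by (simp add: w_def)
  moreover have "cmod (w z) < 1" if "cmod z < 1" for z
    using lt[of z] ne[of z] that by (simp add: w_def norm_divide divide_less_eq_1)
  ultimately have "cmod (w z) \<le> cmod z" using z by (intro Schwarz_Lemma(1)[of w]) auto
  then have w: "cmod (w z) \<le> 1 / 2" using z by simp
  have "H z * (1 + w z) = 2 * w z" using ne[of z] z by (simp add: w_def field_simps)
  then have "cmod (H z) * cmod (1 + w z) = 2 * cmod (w z)" by (metis norm_mult norm_numeral)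
  moreover have "1 / 2 \<le> cmod (1 + w z)" using w norm_diff_ineq[of 1 "w z"] by simp
  then have "cmod (H z) * (1 / 2) \<le> cmod (H z) * cmod (1 + w z)" by (intro mult_left_mono) auto
  ultimately show ?thesis using w by simp
qed

text \<open>A holomorphic logarithm \<open>G\<close> of \<open>F\<close> has a real part of at most
  linear growth. The Borel-Caratheodory estimate transfers this growth to the modulus, and
  Liouville's theorem makes \<open>G\<close> a polynomial of degree at most 1.\<close>

lemma entire_zero_free_exponential_type:
  assumes F: "F holomorphic_on UNIV" "\<And>z. F z \<noteq> 0" and A: "0 \<le> A" and le: "\<And>z. cmod (F z) \<le> C * exp (A * cmod z)"
  shows "\<exists>a b. \<forall>z. F z = exp (a + b * z)"
proof -
  obtain G where G: "G holomorphic_on UNIV" "\<And>z. exp (G z) = F z"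
    by (rule holomorphic_logarithm_exists[OF convex_UNIV open_UNIV F(1), of 0]) (use F(2) in auto)
  have C: "C > 0" 
  proof -
    have "0 < cmod (F 0)" using F(2) by simp
    also have "\<dots> \<le> C" using le[of 0] by simp
    finally show ?thesis .
  qed
  have Re: "Re (G z) \<le> ln C + A * cmod z" for z
  proof -
    have "exp (Re (G z)) \<le> C * exp (A * cmod z)" using le[of z] by (simp flip: G(2))
    also have "\<dots> = exp (ln C + A * cmod z)" using C by (simp add: exp_add)
    finally show ?thesis by simp
  qed
  \<comment> \<open>\<open>M \<rho>\<close> bounds the real part of G - G 0 on the disc of radius 2
    \<rho>, and the leading 1 makes the bound strict. Points of modulus \<rho> become points of
    modulus 1 / 2 after rescaling.\<close>
  define M where "M \<rho> = 1 + \<bar>ln C\<bar> + 2 * A * \<rho> + \<bar>Re (G 0)\<bar>" for \<rho>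
  have bound: "cmod (G z - G 0) \<le> 2 * M (cmod z)" if z: "cmod z \<ge> 1" for z
  proof -
    define \<rho> where "\<rho> = cmod z"
    have \<rho>: "\<rho> \<ge> 1" using z by (simp add: \<rho>_def)
    have M: "M \<rho> > 0" using A \<rho> unfolding M_def by (intro add_pos_nonneg) auto
    define H where "H \<zeta> = (G (of_real (2 * \<rho>) * \<zeta>) - G 0) / of_real (M \<rho>)" for \<zeta>
    have "cmod (H (z / of_real (2 * \<rho>))) \<le> 2"
    proof (rule Borel_Caratheodory_half[of H])
      have "(\<lambda>\<zeta>. G (of_real (2 * \<rho>) * \<zeta>)) holomorphic_on unit_disc"
        by (rule holomorphic_on_compose_gen[OF _ G(1), unfolded o_def]) (auto intro!: holomorphic_intros)
      then show "H holomorphic_on unit_disc" unfolding H_def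
        using M by (intro holomorphic_intros) auto
      show "H 0 = 0" by (simp add: H_def)
      show "Re (H \<zeta>) < 1" if "\<zeta> \<in> unit_disc" for \<zeta>
      proof -
        have "A * (2 * \<rho> * cmod \<zeta>) \<le> A * (2 * \<rho> * 1)"
          using that \<rho> A by (intro mult_left_mono) auto
        then have "Re (G (of_real (2 * \<rho>) * \<zeta>) - G 0) < M \<rho>"
          using Re[of "of_real (2 * \<rho>) * \<zeta>"] \<rho> by (simp add: M_def norm_mult)
        then show ?thesis using M by (simp add: H_def)
      qed
    qed (use \<rho> in \<open>simp add: norm_divide \<rho>_def\<close>)
    moreover have "z \<noteq> 0" using z by auto
    ultimately show ?thesis using M \<rho> by (simp add: H_def norm_divide \<rho>_def divide_le_eq)
  qed
  define B where "B = cmod (G 0) + 2 * (1 + \<bar>ln C\<bar> + 2 * A + \<bar>Re (G 0)\<bar>)"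
  have "cmod (G z) \<le> B * cmod z ^ 1" if z: "1 \<le> cmod z" for z
  proof -
    have "cmod (G z) \<le> cmod (G 0) + cmod (G z - G 0)" using norm_triangle_sub[of "G z" "G 0"] by simp
    also have "\<dots> \<le> cmod (G 0) * cmod z + 2 * M (cmod z)"
      using bound[OF z] z by (intro add_mono) (simp_all add: mult_le_cancel_left1)
    also have "M (cmod z) \<le> (1 + \<bar>ln C\<bar> + 2 * A + \<bar>Re (G 0)\<bar>) * cmod z"
    proof -
      have "1 + \<bar>ln C\<bar> + \<bar>Re (G 0)\<bar> \<le> (1 + \<bar>ln C\<bar> + \<bar>Re (G 0)\<bar>) * cmod z"
        using z by (simp add: mult_le_cancel_left1)
      then show ?thesis by (simp add: M_def algebra_simps)
    qed
    finally show ?thesis by (simp add: B_def algebra_simps)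
  qed
  then have "G z = (\<Sum>k\<le>1. (deriv ^^ k) G 0 / fact k * z ^ k)" for z
    by (rule Liouville_polynomial[OF G(1)])
  moreover have "(\<Sum>k\<le>1. (deriv ^^ k) G 0 / fact k * z ^ k) = G 0 + deriv G 0 * z" for z by simp
  ultimately have "F z = exp (G 0 + deriv G 0 * z)" for z using G(2)[of z] by metis
  then show ?thesis by blast
qed

text \<open>Off its zeros, f is the quotient of its cube by its square. Unless f vanishes
  identically, its zeros are those of a nonzero holomorphic function and hence isolated. At a zero,
  |f| is the square root of the continuous function |f^2|, so f tends to 0 and the singularity is
  removable.\<close>

lemma holomorphic_of_square_cube:
  assumes S: "open S" "connected S"
    and f2: "(\<lambda>z. f z ^ 2) holomorphic_on S" and f3: "(\<lambda>z. f z ^ 3) holomorphic_on S"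
  shows "f holomorphic_on S"
proof (cases "\<exists>w\<in>S. f w \<noteq> 0")
  case False
  then show ?thesis by (intro holomorphic_transform[of "\<lambda>_. 0" S f]) auto
next
  case True
  then have ex: "\<exists>w\<in>S. f w ^ 2 \<noteq> 0" by simp
  have quot: "f holomorphic_on U" if "U \<subseteq> S" "\<And>z. z \<in> U \<Longrightarrow> f z \<noteq> 0" for U
  proof -
    have "(\<lambda>z. f z ^ 3 / f z ^ 2) holomorphic_on U"
      using that by (intro holomorphic_on_divide holomorphic_on_subset[OF f2] holomorphic_on_subset[OF f3]) auto
    then show ?thesis
      by (rule holomorphic_transform) (use that in \<open>auto simp: power2_eq_square power3_eq_cube\<close>)
  qed
  have "\<exists>d>0. f holomorphic_on ball a d" if a: "a \<in> S" for a
  proof -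
    obtain n G where "G holomorphic_on S \<and> G a \<noteq> 0 \<and> (\<forall>z\<in>S. f z ^ 2 = (z - a) ^ n * G z)"
      using holomorphic_factor_zero[OF f2 S a ex] by (elim exE)
    then have G: "G holomorphic_on S" "G a \<noteq> 0" "\<And>z. z \<in> S \<Longrightarrow> f z ^ 2 = (z - a) ^ n * G z" by simp_all
    have "isCont G a"
      using holomorphic_on_imp_continuous_on[OF G(1)] continuous_on_eq_continuous_at[OF S(1)] a by blast
    from continuous_at_avoid[OF this G(2)]
    obtain d1 where d1: "d1 > 0" "\<And>z. dist a z < d1 \<Longrightarrow> G z \<noteq> 0" by blast
    obtain d2 where d2: "d2 > 0" "ball a d2 \<subseteq> S" using S(1) a open_contains_ball by blast
    define d where "d = min d1 d2"
    have d: "d > 0" "ball a d \<subseteq> S" using d1 d2 by (auto simp: d_def)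
    have nz: "f z \<noteq> 0" if "z \<in> ball a d - {a}" for z
      using G(3)[of z] d1(2)[of z] d that by (auto simp: d_def subset_iff)
    show ?thesis
    proof (cases "f a = 0")
      case False
      then have "f z \<noteq> 0" if "z \<in> ball a d" for z using nz that by blast
      then show ?thesis using quot d by blast
    next
      case True
      have "f holomorphic_on ball a d"
      proof (rule no_isolated_singularity'[where K = "{a}"])
        fix z assume "z \<in> {a}"
        have "continuous_on (ball a d) (\<lambda>z. f z ^ 2)"
          using f2 d holomorphic_on_imp_continuous_on continuous_on_subset by blast
        then have "((\<lambda>z. f z ^ 2) \<longlongrightarrow> f a ^ 2) (at a within ball a d)"
          using d by (auto simp: continuous_on_def)
        then have "((\<lambda>z. sqrt (cmod (f z ^ 2))) \<longlongrightarrow> sqrt (cmod (f a ^ 2))) (at a within ball a d)"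
          by (intro tendsto_real_sqrt tendsto_norm)
        then have "((\<lambda>z. cmod (f z)) \<longlongrightarrow> 0) (at a within ball a d)"
          using True by (simp add: norm_power)
        then have "(f \<longlongrightarrow> 0) (at a within ball a d)" by (rule tendsto_norm_zero_cancel)
        then show "(f \<longlongrightarrow> f z) (at z within ball a d)"
          using \<open>z \<in> {a}\<close> True by simp
      qed (use quot[of "ball a d - {a}"] nz d in auto)
      then show ?thesis using d by blast
    qed
  qed
  then have "f field_differentiable at a within S" if "a \<in> S" for a
    using that holomorphic_on_imp_differentiable_at[OF _ open_ball] field_differentiable_at_within
    by (metis centre_in_ball)
  then show ?thesis unfolding holomorphic_on_def by blast
qed

subsection \<open>The Hardy space topology and cyclic functions\<close>

lemma Hp_holomorphic: "f \<in> Hp p \<Longrightarrow> f holomorphic_on unit_disc"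
  by (simp add: Hp_def Hol_def)

lemma Hp_disc_continuous_on: "f \<in> Hp p \<Longrightarrow> 0 \<le> r \<Longrightarrow> r < 1 \<Longrightarrow> continuous_on (sphere 0 r) f"
  by (rule holomorphic_on_disc_continuous_on[OF Hp_holomorphic]) auto

lemma subset_unit_disc:
  assumes "r < 1"
  shows "sphere 0 r \<subseteq> unit_disc" "cball 0 r \<subseteq> unit_disc" "ball 0 r \<subseteq> unit_disc"
  using assms by auto

lemma Hp_norm_le:
  assumes "1 \<le> p" "f holomorphic_on unit_disc" "\<And>r. 0 \<le> r \<Longrightarrow> r < 1 \<Longrightarrow> cmean p f r \<le> B"
  shows "f \<in> Hp p" "Hp_norm p f \<le> B powr (1 / p)"
proof -
  have *: "Hp_mean p f r \<le> B powr (1 / p)" if "r \<in> {0..<1}" for r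
    unfolding Hp_mean_eq_cmean using assms that
    by (intro powr_mono2 cmean_nonneg holomorphic_on_disc_continuous_on[OF assms(2)] subset_unit_disc) auto
  then have "bdd_above (Hp_mean p f ` {0..<1})" by (rule bdd_aboveI2)
  then show "f \<in> Hp p" using assms(2) by (simp add: Hp_def Hol_def)
  show "Hp_norm p f \<le> B powr (1 / p)" unfolding Hp_norm_def using * by (intro cSUP_least) auto
qed

lemma Hp_norm_nonneg: "f \<in> Hp p \<Longrightarrow> 0 \<le> Hp_norm p f"
  unfolding Hp_norm_def
  by (rule cSUP_upper2[of _ _ 0]) (auto simp: Hp_def Hp_mean_eq_cmean)

lemma cmean_le_Hp_norm:
  assumes "1 \<le> p" "f \<in> Hp p" "0 \<le> r" "r < 1"
  shows "cmean p f r \<le> Hp_norm p f powr p"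
proof -
  have "cmean p f r powr (1 / p) \<le> Hp_norm p f"
    unfolding Hp_norm_def Hp_mean_eq_cmean[symmetric] using assms
    by (intro cSUP_upper) (auto simp: Hp_def)
  then have "(cmean p f r powr (1 / p)) powr p \<le> Hp_norm p f powr p"
    using assms by (intro powr_mono2) auto
  moreover have "0 \<le> cmean p f r" using assms by (intro cmean_nonneg Hp_disc_continuous_on) auto
  ultimately show ?thesis using assms by (simp add: powr_powr)
qed

lemma Hp_mult_bounded:
  assumes p: "1 \<le> p" and f: "f \<in> Hp p" and g: "g holomorphic_on unit_disc" "\<And>z. z \<in> unit_disc \<Longrightarrow> cmod (g z) \<le> M"
  shows "(\<lambda>z. g z * f z) \<in> Hp p" "Hp_norm p (\<lambda>z. g z * f z) \<le> M * Hp_norm p f"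
proof -
  have M: "0 \<le> M" using order_trans[OF norm_ge_zero g(2)[of 0]] by simp
  have hol: "(\<lambda>z. g z * f z) holomorphic_on unit_disc"
    by (intro holomorphic_intros g(1) Hp_holomorphic[OF f])
  have le: "cmean p (\<lambda>z. g z * f z) r \<le> (M * Hp_norm p f) powr p" if r: "0 \<le> r" "r < 1" for r
  proof -
    have sub: "sphere 0 r \<subseteq> unit_disc" using r by auto
    have "cmean p (\<lambda>z. g z * f z) r \<le> cavg r (\<lambda>z. M powr p * cmod (f z) powr p)"
      unfolding cmean_def
    proof (rule cavg_mono[OF r(1)])
      show "continuous_on (sphere 0 r) (\<lambda>z. cmod (g z * f z) powr p)"
        using p by (intro continuous_on_cmod_powr holomorphic_on_disc_continuous_on[OF hol sub]) auto
      show "continuous_on (sphere 0 r) (\<lambda>z. M powr p * cmod (f z) powr p)"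
        using p by (intro continuous_on_mult continuous_on_const continuous_on_cmod_powr Hp_disc_continuous_on[OF f] r) auto
      show "cmod (g z * f z) powr p \<le> M powr p * cmod (f z) powr p" if "cmod z = r" for z
        using p g(2)[of z] r that by (simp add: norm_mult powr_mult mult_right_mono powr_mono2)
    qed
    also have "\<dots> \<le> M powr p * Hp_norm p f powr p"
      unfolding cavg_cmult using cmean_le_Hp_norm[OF p f r] by (intro mult_left_mono) (auto simp: cmean_def)
    finally show ?thesis using M Hp_norm_nonneg[OF f] by (simp add: powr_mult)
  qed
  show "(\<lambda>z. g z * f z) \<in> Hp p" using Hp_norm_le(1)[OF p hol le] .
  have "0 \<le> M * Hp_norm p f" using M Hp_norm_nonneg[OF f] by simp
  then show "Hp_norm p (\<lambda>z. g z * f z) \<le> M * Hp_norm p f"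
    using Hp_norm_le(2)[OF p hol le] p by (simp add: powr_powr)
qed

lemma bounded_Hp:
  assumes "1 \<le> p" "f holomorphic_on unit_disc" "\<And>z. z \<in> unit_disc \<Longrightarrow> cmod (f z) \<le> M"
  shows "f \<in> Hp p" "Hp_norm p f \<le> M"
proof -
  have M: "0 \<le> M" using order_trans[OF norm_ge_zero assms(3)[of 0]] by simp
  have le: "cmean p f r \<le> M powr p" if "0 \<le> r" "r < 1" for r
    using assms that by (intro cmean_le_const holomorphic_on_disc_continuous_on[OF assms(2)]) auto
  show "f \<in> Hp p" "Hp_norm p f \<le> M"
    using Hp_norm_le[OF assms(1,2) le] M assms(1) by (simp_all add: powr_powr)
qed

lemma Hp_add:
  assumes p: "1 \<le> p" and f: "f \<in> Hp p" and g: "g \<in> Hp p"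
  shows "(\<lambda>z. f z + g z) \<in> Hp p"
proof (rule Hp_norm_le(1)[OF p])
  have p0: "0 < p" using p by simp
  show hol: "(\<lambda>z. f z + g z) holomorphic_on unit_disc"
    by (intro holomorphic_intros Hp_holomorphic[OF f] Hp_holomorphic[OF g])
  fix r :: real assume r: "0 \<le> r" "r < 1"
  have sub: "sphere 0 r \<subseteq> unit_disc" using r by auto
  note c = continuous_on_cmod_powr[OF p0 Hp_disc_continuous_on[OF f r]] continuous_on_cmod_powr[OF p0 Hp_disc_continuous_on[OF g r]]
  have "cmean p (\<lambda>z. f z + g z) r \<le> cavg r (\<lambda>z. 2 powr p * (cmod (f z) powr p + cmod (g z) powr p))"
    unfolding cmean_def
  proof (rule cavg_mono[OF r(1)])
    show "continuous_on (sphere 0 r) (\<lambda>z. cmod (f z + g z) powr p)"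
      by (intro continuous_on_cmod_powr holomorphic_on_disc_continuous_on[OF hol sub] p0)
    show "continuous_on (sphere 0 r) (\<lambda>z. 2 powr p * (cmod (f z) powr p + cmod (g z) powr p))"
      by (intro continuous_on_mult continuous_on_const continuous_on_add c)
    show "cmod (f z + g z) powr p \<le> 2 powr p * (cmod (f z) powr p + cmod (g z) powr p)" for z
    proof -
      have "cmod (f z + g z) powr p \<le> (cmod (f z) + cmod (g z)) powr p"
        using p by (intro powr_mono2 norm_triangle_ineq) auto
      also have "\<dots> \<le> 2 powr p * (cmod (f z) powr p + cmod (g z) powr p)" using p by (intro powr_add_le) auto
      finally show ?thesis .
    qed
  qed
  also have "\<dots> = 2 powr p * (cmean p f r + cmean p g r)"
    unfolding cavg_cmult cmean_def by (simp add: cavg_add[OF r(1) c])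
  also have "\<dots> \<le> 2 powr p * (Hp_norm p f powr p + Hp_norm p g powr p)"
    using cmean_le_Hp_norm[OF p _ r] f g by (intro mult_left_mono add_mono) auto
  finally show "cmean p (\<lambda>z. f z + g z) r \<le> 2 powr p * (Hp_norm p f powr p + Hp_norm p g powr p)" .
qed

lemma Hp_cmult:
  assumes "1 \<le> p" "f \<in> Hp p"
  shows "(\<lambda>z. c * f z) \<in> Hp p"
  using Hp_mult_bounded(1)[OF assms, of "\<lambda>_. c" "cmod c"] by simp

lemma Hp_diff:
  assumes "1 \<le> p" "f \<in> Hp p" "g \<in> Hp p"
  shows "(\<lambda>z. f z - g z) \<in> Hp p"
  using Hp_add[OF assms(1,2) Hp_cmult[OF assms(1,3), of "-1"]] by simp

lemma cmod_le_Hp_norm: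
  assumes p: "1 \<le> p" and f: "f \<in> Hp p" and z: "cmod z < 1"
  shows "cmod (f z) \<le> (1 + 3 * cmod z) / (1 - cmod z) * Hp_norm p f"
proof -
  \<comment> \<open>With \<open>R\<close> halfway between |z| and 1, the factor of
    \<open>powr_le_cmean\<close> is exactly \<open>K\<close>. As K \<ge> 1, it can be enlarged to
    \<open>K powr p\<close>, so that taking the p-th root leaves the constant
    \<open>K\<close>.\<close>
  define R where "R = (1 + cmod z) / 2"
  define K where "K = (1 + 3 * cmod z) / (1 - cmod z)"
  have R: "cmod z < R" "R < 1" "0 \<le> R" using z by (auto simp: R_def)
  have K: "1 \<le> K" using z by (simp add: K_def field_simps)
  have "(R + cmod z) / (R - cmod z) = K"
    using z by (simp add: R_def K_def field_simps)
  then have "cmod (f z) powr p \<le> K * cmean p f R"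
    using powr_le_cmean[OF p holomorphic_on_disc_continuous_on[OF Hp_holomorphic[OF f] subset_unit_disc(2)[OF R(2)]]
      holomorphic_on_subset[OF Hp_holomorphic[OF f] subset_unit_disc(3)[OF R(2)]] R(1)] by simp
  also have "\<dots> \<le> K powr p * Hp_norm p f powr p"
  proof (intro mult_mono cmean_le_Hp_norm p f R)
    show "K \<le> K powr p" using K p powr_mono[of 1 p K] by simp
    show "0 \<le> cmean p f R" using p R by (intro cmean_nonneg Hp_disc_continuous_on[OF f]) auto
  qed auto
  also have "\<dots> = (K * Hp_norm p f) powr p"
    using K Hp_norm_nonneg[OF f] by (simp add: powr_mult)
  finally have "cmod (f z) powr p \<le> (K * Hp_norm p f) powr p" .
  then have "cmod (f z) \<le> K * Hp_norm p f"
    using powr_less_mono2[of p "K * Hp_norm p f" "cmod (f z)"] p K Hp_norm_nonneg[OF f]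
    by (intro leI notI) auto
  then show ?thesis by (simp add: K_def)
qed

lemma cmod_deriv_0_le_Hp_norm:
  assumes p: "1 \<le> p" and f: "f \<in> Hp p"
  shows "cmod (deriv f 0) \<le> 10 * Hp_norm p f"
proof -
  \<comment> \<open>Cauchy's inequality on the circle of radius 1 / 2: the constant of
    \<open>cmod_le_Hp_norm\<close> is 5 there, and dividing by the radius gives 10.\<close>
  have "cmod ((deriv ^^ 1) f 0) \<le> fact 1 * (5 * Hp_norm p f) / (1 / 2) ^ 1"
  proof (rule Cauchy_inequality)
    have "(1 / 2 :: real) < 1" by simp
    note sub = subset_unit_disc[OF this]
    show "f holomorphic_on ball 0 (1 / 2)" by (rule holomorphic_on_subset[OF Hp_holomorphic[OF f] sub(3)])
    show "continuous_on (cball 0 (1 / 2)) f" by (rule holomorphic_on_disc_continuous_on[OF Hp_holomorphic[OF f] sub(2)])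
    show "cmod (f x) \<le> 5 * Hp_norm p f" if "cmod (0 - x) = 1 / 2" for x
    proof -
      have x: "cmod x = 1 / 2" using that by simp
      have "cmod (f x) \<le> (1 + 3 * cmod x) / (1 - cmod x) * Hp_norm p f"
        using x by (intro cmod_le_Hp_norm[OF p f]) simp
      also have "(1 + 3 * cmod x) / (1 - cmod x) = 5" unfolding x by simp
      finally show ?thesis .
    qed
  qed auto
  then show ?thesis by simp
qed

text \<open>A linear condition on the 1-jet at 0 is easy to check for limits, products and
  quotients. For the converse direction, subtracting c (\<alpha> + \<beta> z) leaves a zero of order
  at least 2 at 0, and what remains is to show that dividing by z^2 stays in the Hardy
  space.\<close>

lemma Hp_ab_iff:
  assumes p: "1 \<le> p" and \<alpha>: "\<alpha> \<noteq> 0"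
  shows "f \<in> Hp_ab p \<alpha> \<beta> \<longleftrightarrow> f \<in> Hp p \<and> \<alpha> * deriv f 0 = \<beta> * f 0"
proof
  assume f: "f \<in> Hp_ab p \<alpha> \<beta>"
  then obtain c g where g: "g \<in> Hp p" and fe: "\<And>z. z \<in> unit_disc \<Longrightarrow> f z = c * (\<alpha> + \<beta> * z) + z\<^sup>2 * g z"
    unfolding Hp_ab_def by blast
  have "(g has_field_derivative deriv g 0) (at 0)"
    using holomorphic_derivI[OF Hp_holomorphic[OF g] open_ball] by simp
  then have "((\<lambda>z. c * (\<alpha> + \<beta> * z) + z\<^sup>2 * g z) has_field_derivative c * \<beta>) (at 0)"
    by (auto intro!: derivative_eq_intros)
  then have "(f has_field_derivative c * \<beta>) (at 0)"
    by (rule has_field_derivative_transform_within_open[OF _ open_ball[of 0 1]]) (auto simp: fe)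
  then have "deriv f 0 = c * \<beta>" by (rule DERIV_imp_deriv)
  moreover have "f 0 = c * \<alpha>" using fe[of 0] by simp
  ultimately show "f \<in> Hp p \<and> \<alpha> * deriv f 0 = \<beta> * f 0" using f Hp_ab_subset_Hp[OF p] by auto
next
  assume f: "f \<in> Hp p \<and> \<alpha> * deriv f 0 = \<beta> * f 0"
  define c where "c = f 0 / \<alpha>"
  define f1 where "f1 z = f z - c * (\<alpha> + \<beta> * z)" for z
  have hf: "f holomorphic_on unit_disc" using f Hp_holomorphic by blast
  have h1: "f1 holomorphic_on unit_disc" unfolding f1_def by (intro holomorphic_intros hf)
  have "(f has_field_derivative deriv f 0) (at 0)"
    using holomorphic_derivI[OF hf open_ball] by simp
  then have "(f1 has_field_derivative deriv f 0 - c * \<beta>) (at 0)"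
    unfolding f1_def by (auto intro!: derivative_eq_intros)
  moreover have "deriv f 0 - c * \<beta> = 0" using f \<alpha> by (simp add: c_def field_simps)
  ultimately have d1: "deriv f1 0 = 0" by (simp add: DERIV_imp_deriv)
  have "f1 0 = 0" using \<alpha> by (simp add: f1_def c_def)
  from Schwarz3[OF h1 this] obtain h where h: "h holomorphic_on unit_disc" "\<And>z. cmod z < 1 \<Longrightarrow> f1 z = z * h z" "h 0 = 0"
    using d1 by metis
  from Schwarz3[OF h(1,3)] obtain g where g: "g holomorphic_on unit_disc" "\<And>z. cmod z < 1 \<Longrightarrow> h z = z * g z"
    by metis
  have fg: "f z = c * (\<alpha> + \<beta> * z) + z\<^sup>2 * g z" if "z \<in> unit_disc" for z
    using h(2)[of z] g(2)[of z] that by (simp add: f1_def power2_eq_square algebra_simps)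
  have "f1 \<in> Hp p"
    unfolding f1_def
  proof (rule Hp_diff[OF p])
    have "cmod (c * (\<alpha> + \<beta> * z)) \<le> cmod c * (cmod \<alpha> + cmod \<beta>)" if "z \<in> unit_disc" for z
    proof -
      have "cmod (\<alpha> + \<beta> * z) \<le> cmod \<alpha> + cmod (\<beta> * z)" by (rule norm_triangle_ineq)
      also have "cmod (\<beta> * z) \<le> cmod \<beta>" using that by (simp add: norm_mult mult_left_le)
      finally show ?thesis by (simp add: norm_mult mult_left_mono)
    qed
    then show "(\<lambda>z. c * (\<alpha> + \<beta> * z)) \<in> Hp p" by (intro bounded_Hp(1)[OF p]) (auto intro!: holomorphic_intros)
  qed (use f in simp)
  \<comment> \<open>For |z| \<ge> 1 / 2, division by z^2 costs at most a factor 4. Smaller radii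
    follow by monotonicity of the means.\<close>
  have le: "cmean p g r \<le> 4 powr p * Hp_norm p f1 powr p" if r: "1 / 2 \<le> r" "r < 1" for r
  proof -
    have r0: "0 \<le> r" using r by simp
    have "cmean p g r \<le> cavg r (\<lambda>z. 4 powr p * cmod (f1 z) powr p)"
      unfolding cmean_def
    proof (rule cavg_mono[OF r0])
      show "continuous_on (sphere 0 r) (\<lambda>z. cmod (g z) powr p)"
        using p r by (intro continuous_on_cmod_powr holomorphic_on_disc_continuous_on[OF g(1)]) auto
      show "continuous_on (sphere 0 r) (\<lambda>z. 4 powr p * cmod (f1 z) powr p)"
        using p r by (intro continuous_on_mult continuous_on_const continuous_on_cmod_powr holomorphic_on_disc_continuous_on[OF h1]) auto
      fix z :: complex assume z: "cmod z = r"
      have "cmod (f1 z) = r\<^sup>2 * cmod (g z)" using h(2)[of z] g(2)[of z] z r by (simp add: norm_mult power2_eq_square)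
      moreover have "(1 / 2)\<^sup>2 \<le> r\<^sup>2" using r by (intro power_mono) auto
      then have "(1 / 4) * cmod (g z) \<le> r\<^sup>2 * cmod (g z)" by (intro mult_right_mono) (auto simp: power2_eq_square)
      ultimately have "cmod (g z) \<le> 4 * cmod (f1 z)" by simp
      then have "cmod (g z) powr p \<le> (4 * cmod (f1 z)) powr p" using p by (intro powr_mono2) auto
      then show "cmod (g z) powr p \<le> 4 powr p * cmod (f1 z) powr p" by (simp add: powr_mult)
    qed
    also have "\<dots> \<le> 4 powr p * Hp_norm p f1 powr p"
      unfolding cavg_cmult using cmean_le_Hp_norm[OF p \<open>f1 \<in> Hp p\<close> r0 r(2)] by (simp add: cmean_def)
    finally show ?thesis .
  qed
  have "cmean p g r \<le> 4 powr p * Hp_norm p f1 powr p" if "0 \<le> r" "r < 1" for r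
  proof -
    have "cmean p g r \<le> cmean p g (max r (1/2))" using that by (intro cmean_mono_disc[OF p g(1)]) auto
    also have "\<dots> \<le> 4 powr p * Hp_norm p f1 powr p" using that by (intro le) auto
    finally show ?thesis .
  qed
  then have "g \<in> Hp p" by (rule Hp_norm_le(1)[OF p g(1)])
  then show "f \<in> Hp_ab p \<alpha> \<beta>" unfolding Hp_ab_def using fg by blast
qed

text \<open>The space is the kernel of the functional \<open>D\<close>, whose norm is at most
  \<open>K\<close> by the estimates for the value and the derivative at 0. If D f is nonzero, the
  ball of radius |D f| / K around f avoids the kernel.\<close>

lemma closedin_Hp_ab:
  assumes p: "1 \<le> p" and \<alpha>: "\<alpha> \<noteq> 0"
  shows "closedin (Hp_topology p) (Hp_ab p \<alpha> \<beta>)"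
  unfolding closedin_def openin_Hp_topology
proof (intro conjI ballI)
  show "Hp_ab p \<alpha> \<beta> \<subseteq> topspace (Hp_topology p)" using Hp_ab_subset_Hp[OF p] by simp
  fix f assume f: "f \<in> topspace (Hp_topology p) - Hp_ab p \<alpha> \<beta>"
  define D where "D f = \<alpha> * deriv f 0 - \<beta> * f 0" for f
  have fH: "f \<in> Hp p" and "D f \<noteq> 0" using f Hp_ab_iff[OF p \<alpha>, of f \<beta>] by (auto simp: D_def)
  define K where "K = 10 * cmod \<alpha> + cmod \<beta>"
  have K: "K > 0" using \<alpha> by (simp add: K_def add_pos_nonneg)
  define e where "e = cmod (D f) / K"
  have e: "e > 0" using \<open>D f \<noteq> 0\<close> K by (simp add: e_def)
  have "g \<in> topspace (Hp_topology p) - Hp_ab p \<alpha> \<beta>" if g: "g \<in> Hp p" "Hp_norm p (\<lambda>z. g z - f z) < e" for g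
  proof -
    let ?d = "\<lambda>z. g z - f z"
    have dH: "?d \<in> Hp p" by (intro Hp_diff p g fH)
    have "f field_differentiable at 0" "g field_differentiable at 0"
      using Hp_holomorphic[OF fH] Hp_holomorphic[OF g(1)] holomorphic_on_imp_differentiable_at[OF _ open_ball] by auto
    then have dd: "D ?d = D g - D f" by (simp add: D_def deriv_diff algebra_simps)
    have "cmod (D ?d) \<le> K * Hp_norm p ?d"
    proof -
      have "cmod (D ?d) \<le> cmod \<alpha> * cmod (deriv ?d 0) + cmod \<beta> * cmod (?d 0)"
        unfolding D_def using norm_triangle_ineq4[of "\<alpha> * deriv ?d 0" "\<beta> * ?d 0"] by (simp only: norm_mult)
      also have "\<dots> \<le> cmod \<alpha> * (10 * Hp_norm p ?d) + cmod \<beta> * Hp_norm p ?d"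
        using cmod_deriv_0_le_Hp_norm[OF p dH] cmod_le_Hp_norm[OF p dH, of 0]
        by (intro add_mono mult_left_mono) auto
      finally show ?thesis by (simp add: K_def algebra_simps)
    qed
    also have "K * Hp_norm p ?d < K * e" using g K by simp
    also have "\<dots> = cmod (D f)" using K by (simp add: e_def)
    finally have "cmod (D ?d) < cmod (D f)" .
    then have "D g \<noteq> 0" using dd by auto
    then show ?thesis using g Hp_ab_iff[OF p \<alpha>, of g \<beta>] by (auto simp: D_def)
  qed
  then show "\<exists>e>0. \<forall>g\<in>Hp p. Hp_norm p (\<lambda>z. g z - f z) < e \<longrightarrow> g \<in> topspace (Hp_topology p) - Hp_ab p \<alpha> \<beta>"
    using e by blast
qed simp

lemma Hp_dilate_approx:
  assumes p: "1 \<le> p" and f: "f \<in> Hp p" and e: "0 < e"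
  shows "\<exists>d<1. 0 \<le> d \<and> (\<forall>s. d < s \<longrightarrow> s < 1 \<longrightarrow> Hp_norm p (\<lambda>z. f (of_real s * z) - f z) \<le> e)"
proof -
  have "e powr p > 0" using e by simp
  from dilate_tendsto[OF p Hp_holomorphic[OF f] cmean_le_Hp_norm[OF p f] this]
  obtain d where d: "d < 1" "0 \<le> d" "\<And>s R. d < s \<Longrightarrow> s < 1 \<Longrightarrow> 0 \<le> R \<Longrightarrow> R < 1 \<Longrightarrow>
           cmean p (\<lambda>z. f (of_real s * z) - f z) R \<le> e powr p" by blast
  have "Hp_norm p (\<lambda>z. f (of_real s * z) - f z) \<le> e" if s: "d < s" "s < 1" for s
  proof -
    have "(\<lambda>z. f (of_real s * z) - f z) holomorphic_on unit_disc"
      using s d(2) by (intro holomorphic_intros holomorphic_on_dilate Hp_holomorphic[OF f]) auto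
    then have "Hp_norm p (\<lambda>z. f (of_real s * z) - f z) \<le> (e powr p) powr (1 / p)"
      using d(3)[OF s] by (intro Hp_norm_le(2)[OF p]) auto
    then show ?thesis using p e by (simp add: powr_powr)
  qed
  then show ?thesis using d by blast
qed

lemma Hp_norm_cong:
  assumes "\<And>z. z \<in> unit_disc \<Longrightarrow> f z = g z"
  shows "Hp_norm p f = Hp_norm p g"
  unfolding Hp_norm_def Hp_mean_eq_cmean cmean_def
  by (intro SUP_cong arg_cong2[where f = "(powr)"] cavg_cong) (auto simp: assms)

lemma Hinf1_dilate:
  assumes k: "k holomorphic_on unit_disc" "deriv k 0 = 0" and s: "0 \<le> s" "s < 1"
  shows "(\<lambda>z. k (of_real s * z)) \<in> Hinf1"
proof -
  have "bounded (k ` cball 0 s)"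
    using s by (intro compact_imp_bounded compact_continuous_image holomorphic_on_disc_continuous_on[OF k(1)]) auto
  moreover have "(\<lambda>z. k (of_real s * z)) ` unit_disc \<subseteq> k ` cball 0 s"
    using s by (auto intro!: imageI simp: norm_mult mult_left_le)
  ultimately have "bounded ((\<lambda>z. k (of_real s * z)) ` unit_disc)" by (rule bounded_subset)
  moreover have "(k has_field_derivative deriv k 0) (at (of_real s * 0))"
    using holomorphic_derivI[OF k(1) open_ball] by simp
  then have "((\<lambda>z. k (of_real s * z)) has_field_derivative deriv k 0 * of_real s) (at 0)"
    by (rule DERIV_chain2) (auto intro!: derivative_eq_intros)
  then have "deriv (\<lambda>z. k (of_real s * z)) 0 = 0" using k(2) by (simp add: DERIV_imp_deriv)
  ultimately show ?thesis
    using holomorphic_on_dilate[OF k(1) s(1)] s by (simp add: Hinf1_def Hinf_def Hol_def)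
qed

text \<open>For \<open>F\<close> in the space, the quotient \<open>F / g\<close> has vanishing derivative at \<open>0\<close>, so its dilates are
  multipliers from \<open>Hinf1\<close>.\<close>

lemma cyclic_if_bounded_below:
  assumes p: "1 \<le> p" and \<alpha>: "\<alpha> \<noteq> 0"
    and g: "g holomorphic_on unit_disc" "\<alpha> * deriv g 0 = \<beta> * g 0"
    and M: "\<And>z. z \<in> unit_disc \<Longrightarrow> cmod (g z) \<le> M"
    and m: "0 < m" "\<And>z. z \<in> unit_disc \<Longrightarrow> m \<le> cmod (g z)"
  shows "cyclic p \<alpha> \<beta> g"
proof -
  have gH: "g \<in> Hp p" by (rule bounded_Hp(1)[OF p g(1) M])
  have gA: "g \<in> Hp_ab p \<alpha> \<beta>" using gH g(2) Hp_ab_iff[OF p \<alpha>] by blast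
  have nz: "g z \<noteq> 0" if "z \<in> unit_disc" for z using m(2)[OF that] m(1) by auto
  have dg: "(g has_field_derivative deriv g 0) (at 0)"
    using holomorphic_derivI[OF g(1) open_ball] by simp
  have ghA: "(\<lambda>z. g z * h z) \<in> Hp_ab p \<alpha> \<beta>" if h: "h \<in> Hinf1" for h
  proof -
    have hh: "h holomorphic_on unit_disc" "deriv h 0 = 0" using h by (auto simp: Hinf1_def Hinf_def Hol_def)
    have "\<exists>N. \<forall>z\<in>unit_disc. cmod (h z) \<le> N"
      using h by (simp add: Hinf1_def Hinf_def bounded_iff)
    then obtain N where N: "\<And>z. z \<in> unit_disc \<Longrightarrow> cmod (h z) \<le> N" by blast
    have "(\<lambda>z. h z * g z) \<in> Hp p" by (rule Hp_mult_bounded(1)[OF p gH hh(1) N])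
    moreover have "(h has_field_derivative 0) (at 0)"
      using holomorphic_derivI[OF hh(1) open_ball, of 0] hh(2) by simp
    then have "((\<lambda>z. h z * g z) has_field_derivative h 0 * deriv g 0) (at 0)"
      using dg by (auto intro!: derivative_eq_intros)
    then have "deriv (\<lambda>z. h z * g z) 0 = h 0 * deriv g 0" by (rule DERIV_imp_deriv)
    then have "\<alpha> * deriv (\<lambda>z. h z * g z) 0 = \<beta> * (h 0 * g 0)" using g(2) by (simp add: mult.left_commute)
    ultimately show ?thesis using Hp_ab_iff[OF p \<alpha>, of "\<lambda>z. g z * h z" \<beta>] by (simp add: mult.commute)
  qed
  let ?S = "{\<lambda>z. g z * h z |h. h \<in> Hinf1}"
  have "Hp_topology p closure_of ?S \<subseteq> Hp_ab p \<alpha> \<beta>"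
    by (rule closure_of_minimal[OF _ closedin_Hp_ab[OF p \<alpha>]]) (use ghA in auto)
  moreover have "F \<in> Hp_topology p closure_of ?S" if F: "F \<in> Hp_ab p \<alpha> \<beta>" for F
    unfolding in_closure_of
  proof (intro conjI allI impI)
    have FH: "F \<in> Hp p" "\<alpha> * deriv F 0 = \<beta> * F 0" using F Hp_ab_iff[OF p \<alpha>] by auto
    show "F \<in> topspace (Hp_topology p)" using FH by simp
    fix U assume "F \<in> U \<and> openin (Hp_topology p) U"
    then obtain e where e: "e > 0" "\<And>G. G \<in> Hp p \<Longrightarrow> Hp_norm p (\<lambda>z. G z - F z) < e \<Longrightarrow> G \<in> U"
      unfolding openin_Hp_topology by blast
    define k where "k z = inverse (g z) * F z" for z
    have ig: "(\<lambda>z. inverse (g z)) holomorphic_on unit_disc" by (intro holomorphic_intros g(1) nz)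
    have "cmod (inverse (g z)) \<le> inverse m" if "z \<in> unit_disc" for z
      using m(2)[OF that] m(1) by (simp add: norm_inverse le_imp_inverse_le)
    then have kH: "k \<in> Hp p" unfolding k_def by (rule Hp_mult_bounded(1)[OF p FH(1) ig])
    have "deriv k 0 = 0"
    proof -
      have dF: "(F has_field_derivative deriv F 0) (at 0)"
        using holomorphic_derivI[OF Hp_holomorphic[OF FH(1)] open_ball] by simp
      have "(k has_field_derivative (deriv F 0 * g 0 - F 0 * deriv g 0) / (g 0 * g 0)) (at 0)"
        unfolding k_def using nz[of 0]
        by (auto intro!: derivative_eq_intros dF dg simp: field_simps)
      moreover have "\<alpha> * (deriv F 0 * g 0 - F 0 * deriv g 0) = 0"
      proof -
        have "\<alpha> * (deriv F 0 * g 0 - F 0 * deriv g 0) = (\<alpha> * deriv F 0) * g 0 - F 0 * (\<alpha> * deriv g 0)"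
          by (simp add: algebra_simps)
        then show ?thesis using FH(2) g(2) by simp
      qed
      ultimately show ?thesis using \<alpha> by (simp add: DERIV_imp_deriv)
    qed
    define M' where "M' = max M 1"
    have M': "M' > 0" "\<And>z. z \<in> unit_disc \<Longrightarrow> cmod (g z) \<le> M'" using M by (auto simp: M'_def le_max_iff_disj)
    have "e / (2 * M') > 0" using e M' by simp
    from Hp_dilate_approx[OF p kH this] obtain d where d: "d < 1" "0 \<le> d"
      "\<And>s. d < s \<Longrightarrow> s < 1 \<Longrightarrow> Hp_norm p (\<lambda>z. k (of_real s * z) - k z) \<le> e / (2 * M')" by blast
    define s where "s = (d + 1) / 2"
    have s: "d < s" "s < 1" "0 \<le> s" using d by (auto simp: s_def)
    let ?ks = "\<lambda>z. k (of_real s * z)"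
    have ks: "?ks \<in> Hinf1" by (rule Hinf1_dilate[OF Hp_holomorphic[OF kH] \<open>deriv k 0 = 0\<close> s(3,2)])
    have dH: "(\<lambda>z. ?ks z - k z) \<in> Hp p"
    proof (rule Hp_diff[OF p _ kH])
      have "\<exists>N. \<forall>z\<in>unit_disc. cmod (?ks z) \<le> N"
        using ks by (simp add: Hinf1_def Hinf_def bounded_iff)
      then obtain N where "\<And>z. z \<in> unit_disc \<Longrightarrow> cmod (?ks z) \<le> N" by blast
      then show "?ks \<in> Hp p" using ks by (intro bounded_Hp(1)[OF p]) (auto simp: Hinf1_def Hinf_def Hol_def)
    qed
    have "(\<lambda>z. g z * ?ks z) \<in> U"
    proof (rule e(2))
      show "(\<lambda>z. g z * ?ks z) \<in> Hp p" using ghA[OF ks] Hp_ab_subset_Hp[OF p] by blast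
      have "Hp_norm p (\<lambda>z. g z * ?ks z - F z) = Hp_norm p (\<lambda>z. g z * (?ks z - k z))"
        using nz by (intro Hp_norm_cong) (simp add: k_def algebra_simps)
      also have "\<dots> \<le> M' * Hp_norm p (\<lambda>z. ?ks z - k z)"
        by (rule Hp_mult_bounded(2)[OF p dH g(1) M'(2)])
      also have "\<dots> \<le> M' * (e / (2 * M'))" using M' d(3)[OF s(1,2)] by (intro mult_left_mono) auto
      also have "\<dots> < e" using M' e by simp
      finally show "Hp_norm p (\<lambda>z. g z * ?ks z - F z) < e" .
    qed
    then show "\<exists>y. y \<in> ?S \<and> y \<in> U" using ks by blast
  qed
  ultimately show ?thesis using gA unfolding cyclic_def by blast
qed

subsection \<open>Functionals that do not vanish on cyclic functions\<close>

text \<open>The series of differences sums to 0 everywhere, whereas a nonzero coefficient of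
  positive index would give a sum without zeros in a punctured neighbourhood of 0. Index 0 is read
  off at z = 0.\<close>

lemma powser_unique:
  fixes a b :: "nat \<Rightarrow> complex"
  assumes "\<And>z. (\<lambda>n. a n * z ^ n) sums f z" "\<And>z. (\<lambda>n. b n * z ^ n) sums f z"
  shows "a n = b n"
proof (rule ccontr)
  assume ne: "a n \<noteq> b n"
  have s: "(\<lambda>n. (a n - b n) * z ^ n) sums 0" for z
    using sums_diff[OF assms(1)[of z] assms(2)[of z]] by (simp add: algebra_simps)
  have "n \<noteq> 0"
  proof
    assume "n = 0"
    then show False using s[of 0] ne by simp
  qed
  then obtain r where "0 < r" "\<And>z::complex. z \<in> cball 0 r - {0} \<Longrightarrow> (0::complex) \<noteq> 0"
    using powser_0_nonzero[of 1 0 "\<lambda>n. a n - b n" "\<lambda>_. 0" n] s ne by auto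
  from this(2)[of "of_real r"] \<open>0 < r\<close> show False by simp
qed

section \<open>Closure properties of the algebra \<open>Hinf1\<close>\<close>

lemma Hinf1D:
  assumes "k \<in> Hinf1"
  shows "k holomorphic_on unit_disc" "deriv k 0 = 0" "(k has_field_derivative 0) (at 0)"
    "\<exists>N\<ge>0. \<forall>z\<in>unit_disc. cmod (k z) \<le> N"
proof -
  show k: "k holomorphic_on unit_disc" "deriv k 0 = 0" using assms by (auto simp: Hinf1_def Hinf_def Hol_def)
  then show "(k has_field_derivative 0) (at 0)" using holomorphic_derivI[OF k(1) open_ball, of 0] by simp
  have "\<exists>N. \<forall>z\<in>unit_disc. cmod (k z) \<le> N" using assms by (simp add: Hinf1_def Hinf_def bounded_iff)
  then obtain N where N: "\<And>z. z \<in> unit_disc \<Longrightarrow> cmod (k z) \<le> N" by blast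
  moreover have "0 \<le> N" using order_trans[OF norm_ge_zero N[of 0]] by simp
  ultimately show "\<exists>N\<ge>0. \<forall>z\<in>unit_disc. cmod (k z) \<le> N" by blast
qed

lemma Hinf1I:
  assumes "k holomorphic_on unit_disc" "(k has_field_derivative 0) (at 0)" "\<And>z. z \<in> unit_disc \<Longrightarrow> cmod (k z) \<le> N"
  shows "k \<in> Hinf1"
proof -
  have "\<forall>x\<in>k ` unit_disc. cmod x \<le> N" using assms(3) by blast
  then have "bounded (k ` unit_disc)" unfolding bounded_iff by blast
  then show ?thesis using assms(1) DERIV_imp_deriv[OF assms(2)] by (simp add: Hinf1_def Hinf_def Hol_def)
qed

lemma Hinf1_cmult:
  assumes "k \<in> Hinf1"
  shows "(\<lambda>z. c * k z) \<in> Hinf1"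
proof -
  obtain N where N: "\<And>z. z \<in> unit_disc \<Longrightarrow> cmod (k z) \<le> N" using Hinf1D(4)[OF assms] by blast
  show ?thesis
  proof (rule Hinf1I)
    show "(\<lambda>z. c * k z) holomorphic_on unit_disc" by (intro holomorphic_intros Hinf1D(1)[OF assms])
    show "((\<lambda>z. c * k z) has_field_derivative 0) (at 0)"
      using DERIV_cmult[OF Hinf1D(3)[OF assms], of c] by simp
    show "cmod (c * k z) \<le> cmod c * N" if "z \<in> unit_disc" for z
      using N[OF that] by (simp add: norm_mult mult_left_mono)
  qed
qed

lemma Hinf1_add:
  assumes "k \<in> Hinf1" "l \<in> Hinf1"
  shows "(\<lambda>z. k z + l z) \<in> Hinf1"
proof -
  obtain N where N: "\<And>z. z \<in> unit_disc \<Longrightarrow> cmod (k z) \<le> N" using Hinf1D(4)[OF assms(1)] by blast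
  obtain N' where N': "\<And>z. z \<in> unit_disc \<Longrightarrow> cmod (l z) \<le> N'" using Hinf1D(4)[OF assms(2)] by blast
  show ?thesis
  proof (rule Hinf1I)
    show "(\<lambda>z. k z + l z) holomorphic_on unit_disc" by (intro holomorphic_intros Hinf1D(1) assms)
    show "((\<lambda>z. k z + l z) has_field_derivative 0) (at 0)"
      using DERIV_add[OF Hinf1D(3)[OF assms(1)] Hinf1D(3)[OF assms(2)]] by simp
    show "cmod (k z + l z) \<le> N + N'" if "z \<in> unit_disc" for z
      using N[OF that] N'[OF that] norm_triangle_ineq[of "k z" "l z"] by linarith
  qed
qed

lemma Hinf1_mult:
  assumes "k \<in> Hinf1" "l \<in> Hinf1"
  shows "(\<lambda>z. k z * l z) \<in> Hinf1"
proof -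
  obtain N where N: "0 \<le> N" "\<And>z. z \<in> unit_disc \<Longrightarrow> cmod (k z) \<le> N" using Hinf1D(4)[OF assms(1)] by blast
  obtain N' where N': "\<And>z. z \<in> unit_disc \<Longrightarrow> cmod (l z) \<le> N'" using Hinf1D(4)[OF assms(2)] by blast
  show ?thesis
  proof (rule Hinf1I)
    show "(\<lambda>z. k z * l z) holomorphic_on unit_disc" by (intro holomorphic_intros Hinf1D(1) assms)
    show "((\<lambda>z. k z * l z) has_field_derivative 0) (at 0)"
      using DERIV_mult[OF Hinf1D(3)[OF assms(1)] Hinf1D(3)[OF assms(2)]] by simp
    show "cmod (k z * l z) \<le> N * N'" if "z \<in> unit_disc" for z
      using N(1) N(2)[OF that] N'[OF that] by (simp add: norm_mult mult_mono)
  qed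
qed

lemma Hinf1_const: "(\<lambda>_. c) \<in> Hinf1"
  by (rule Hinf1I[of _ "cmod c"]) auto

lemma Hinf1_power:
  assumes "k \<in> Hinf1"
  shows "(\<lambda>z. k z ^ n) \<in> Hinf1"
  by (induction n) (auto intro: Hinf1_const Hinf1_mult[OF assms])

lemma Hinf1_monom:
  assumes "n \<noteq> 1"
  shows "(\<lambda>z. z ^ n) \<in> Hinf1"
proof (rule Hinf1I[of _ 1])
  show "((\<lambda>z::complex. z ^ n) has_field_derivative 0) (at 0)"
    using assms by (auto intro!: derivative_eq_intros)
  show "cmod (z ^ n) \<le> 1" if "z \<in> unit_disc" for z using that by (simp add: norm_power power_le_one)
qed (intro holomorphic_intros)

lemma Hinf1_sum:
  assumes "finite A" "\<And>i. i \<in> A \<Longrightarrow> k i \<in> Hinf1"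
  shows "(\<lambda>z. \<Sum>i\<in>A. k i z) \<in> Hinf1"
  using assms by (induction A rule: finite_induct) (auto intro: Hinf1_const Hinf1_add)

lemma Hinf1_exp:
  assumes "k \<in> Hinf1"
  shows "(\<lambda>z. exp (k z)) \<in> Hinf1"
proof -
  obtain N where N: "\<And>z. z \<in> unit_disc \<Longrightarrow> cmod (k z) \<le> N" using Hinf1D(4)[OF assms] by blast
  show ?thesis
  proof (rule Hinf1I)
    show "(\<lambda>z. exp (k z)) holomorphic_on unit_disc" by (intro holomorphic_intros Hinf1D(1)[OF assms])
    show "((\<lambda>z. exp (k z)) has_field_derivative 0) (at 0)"
      using Hinf1D(3)[OF assms] by (auto intro!: derivative_eq_intros)
    show "cmod (exp (k z)) \<le> exp N" if "z \<in> unit_disc" for z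
      using N[OF that] complex_Re_le_cmod[of "k z"] by simp
  qed
qed

text \<open>These are the quotients by \<open>E\<close> of the functions in the space.
  Multiplicativity is proved on the bounded functions \<open>Hinf1\<close>; \<open>Hp1\<close> is
  where the evaluation formula finally has to hold.\<close>

definition Hp1 :: "real \<Rightarrow> (complex \<Rightarrow> complex) set"
  where "Hp1 p = {k \<in> Hp p. deriv k 0 = 0}"

lemma Hinf1_subset_Hp1:
  assumes "1 \<le> p"
  shows "Hinf1 \<subseteq> Hp1 p"
  using Hinf1D bounded_Hp(1)[OF assms] unfolding Hp1_def by blast

lemma Hp1_deriv: "k \<in> Hp1 p \<Longrightarrow> (k has_field_derivative 0) (at 0)"
  using holomorphic_derivI[OF Hp_holomorphic open_ball, of k p 0] by (auto simp: Hp1_def)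

lemma Hp1_cmult:
  assumes "1 \<le> p" "k \<in> Hp1 p"
  shows "(\<lambda>z. c * k z) \<in> Hp1 p"
  using Hp_cmult[OF assms(1)] DERIV_imp_deriv[OF DERIV_cmult[OF Hp1_deriv[OF assms(2)], of c]] assms(2)
  by (auto simp: Hp1_def)

lemma Hp1_add:
  assumes "1 \<le> p" "k \<in> Hp1 p" "l \<in> Hp1 p"
  shows "(\<lambda>z. k z + l z) \<in> Hp1 p"
  using Hp_add[OF assms(1)] DERIV_imp_deriv[OF DERIV_add[OF Hp1_deriv[OF assms(2)] Hp1_deriv[OF assms(3)]]] assms(2,3)
  by (auto simp: Hp1_def)

lemma Hp1_diff:
  assumes "1 \<le> p" "k \<in> Hp1 p" "l \<in> Hp1 p"
  shows "(\<lambda>z. k z - l z) \<in> Hp1 p"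
  using Hp1_add[OF assms(1,2) Hp1_cmult[OF assms(1,3), of "-1"]] by simp

text \<open>The assumptions describe the functional \<open>\<lambda>f. T f z\<close> at one fixed
  point z. Continuity of T enters as a norm estimate with a constant \<open>C\<close> that may
  depend on z.\<close>

locale cyclic_functional =
  fixes p :: real and \<alpha> \<beta> :: complex and \<Lambda> :: "(complex \<Rightarrow> complex) \<Rightarrow> complex" and C :: real
  assumes p: "1 \<le> p" and \<alpha>: "\<alpha> \<noteq> 0" and C: "0 \<le> C"
    and add: "\<And>f g. f \<in> Hp_ab p \<alpha> \<beta> \<Longrightarrow> g \<in> Hp_ab p \<alpha> \<beta> \<Longrightarrow> \<Lambda> (\<lambda>z. f z + g z) = \<Lambda> f + \<Lambda> g"
    and cmult: "\<And>c f. f \<in> Hp_ab p \<alpha> \<beta> \<Longrightarrow> \<Lambda> (\<lambda>z. c * f z) = c * \<Lambda> f"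
    and bound: "\<And>f. f \<in> Hp_ab p \<alpha> \<beta> \<Longrightarrow> cmod (\<Lambda> f) \<le> C * Hp_norm p f"
    and nonzero: "\<And>g. cyclic p \<alpha> \<beta> g \<Longrightarrow> \<Lambda> g \<noteq> 0"
begin

definition E :: "complex \<Rightarrow> complex"
  where "E z = exp (\<beta> / \<alpha> * z)"

definition \<mu> :: "(complex \<Rightarrow> complex) \<Rightarrow> complex"
  where "\<mu> k = \<Lambda> (\<lambda>z. E z * k z)"

definition D :: real
  where "D = C * exp (cmod (\<beta> / \<alpha>))"

lemma D_nonneg: "0 \<le> D"
  using C by (simp add: D_def)

lemma E_holomorphic: "E holomorphic_on S"
  unfolding E_def by (intro holomorphic_intros)

lemma E_deriv: "(E has_field_derivative \<beta> / \<alpha>) (at 0)"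
  unfolding E_def using \<alpha> by (auto intro!: derivative_eq_intros)

lemma E_0 [simp]: "E 0 = 1"
  by (simp add: E_def)

lemma E_nonzero [simp]: "E z \<noteq> 0"
  by (simp add: E_def)

lemma abs_Re_le:
  assumes "z \<in> unit_disc"
  shows "\<bar>Re (\<beta> / \<alpha> * z)\<bar> \<le> cmod (\<beta> / \<alpha>)"
proof -
  have "\<bar>Re (\<beta> / \<alpha> * z)\<bar> \<le> cmod (\<beta> / \<alpha> * z)" by (rule abs_Re_le_cmod)
  also have "\<dots> \<le> cmod (\<beta> / \<alpha>)" unfolding norm_mult using assms by (intro mult_left_le) auto
  finally show ?thesis .
qed

lemma E_le:
  assumes "z \<in> unit_disc"
  shows "cmod (E z) \<le> exp (cmod (\<beta> / \<alpha>))" "exp (- cmod (\<beta> / \<alpha>)) \<le> cmod (E z)"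
  using abs_Re_le[OF assms] unfolding E_def norm_exp_eq_Re by (simp_all only: exp_le_cancel_iff)

lemma E_mult_in:
  assumes k: "k \<in> Hp1 p"
  shows "(\<lambda>z. E z * k z) \<in> Hp_ab p \<alpha> \<beta>"
proof -
  have "(\<lambda>z. E z * k z) \<in> Hp p"
    using k by (intro Hp_mult_bounded(1)[OF p _ E_holomorphic E_le(1)]) (auto simp: Hp1_def)
  moreover have "((\<lambda>z. E z * k z) has_field_derivative \<beta> / \<alpha> * k 0) (at 0)"
    using DERIV_mult[OF E_deriv Hp1_deriv[OF k]] by simp
  ultimately show ?thesis using \<alpha> Hp_ab_iff[OF p \<alpha>] by (simp add: DERIV_imp_deriv)
qed

lemma mu_add: "k \<in> Hp1 p \<Longrightarrow> l \<in> Hp1 p \<Longrightarrow> \<mu> (\<lambda>z. k z + l z) = \<mu> k + \<mu> l"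
  unfolding \<mu>_def using add[OF E_mult_in E_mult_in, of k l] by (simp add: algebra_simps)

lemma mu_cmult: "k \<in> Hp1 p \<Longrightarrow> \<mu> (\<lambda>z. c * k z) = c * \<mu> k"
  unfolding \<mu>_def using cmult[OF E_mult_in, of k c] by (simp add: algebra_simps)

lemma mu_diff: "k \<in> Hp1 p \<Longrightarrow> l \<in> Hp1 p \<Longrightarrow> \<mu> (\<lambda>z. k z - l z) = \<mu> k - \<mu> l"
  using mu_add[OF _ Hp1_cmult[OF p], of k l "-1"] mu_cmult[of l "-1"] by simp

lemma mu_le_Hp_norm:
  assumes "k \<in> Hp1 p"
  shows "cmod (\<mu> k) \<le> D * Hp_norm p k"
proof -
  have "cmod (\<mu> k) \<le> C * Hp_norm p (\<lambda>z. E z * k z)"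
    unfolding \<mu>_def by (rule bound[OF E_mult_in[OF assms]])
  also have "\<dots> \<le> C * (exp (cmod (\<beta> / \<alpha>)) * Hp_norm p k)"
    using assms C by (intro mult_left_mono Hp_mult_bounded(2)[OF p _ E_holomorphic E_le(1)]) (auto simp: Hp1_def)
  finally show ?thesis by (simp add: D_def)
qed

lemma mu_le_bound:
  assumes "k \<in> Hinf1" "\<And>z. z \<in> unit_disc \<Longrightarrow> cmod (k z) \<le> M"
  shows "cmod (\<mu> k) \<le> D * M"
proof -
  have "cmod (\<mu> k) \<le> D * Hp_norm p k" using Hinf1_subset_Hp1[OF p] assms(1) by (intro mu_le_Hp_norm) auto
  also have "\<dots> \<le> D * M"
    using bounded_Hp(2)[OF p Hinf1D(1)[OF assms(1)] assms(2)] D_nonneg by (rule mult_left_mono)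
  finally show ?thesis .
qed

lemma mu_sum:
  assumes "finite A" "\<And>i. i \<in> A \<Longrightarrow> k i \<in> Hinf1"
  shows "\<mu> (\<lambda>z. \<Sum>i\<in>A. c i * k i z) = (\<Sum>i\<in>A. c i * \<mu> (k i))"
  using assms
proof (induction A rule: finite_induct)
  case empty
  then show ?case using mu_cmult[of "\<lambda>_. 0" 0] Hinf1_const Hinf1_subset_Hp1[OF p] by auto
next
  case (insert x A)
  have *: "(\<lambda>z. c x * k x z) \<in> Hp1 p" "(\<lambda>z. \<Sum>i\<in>A. c i * k i z) \<in> Hp1 p" "k x \<in> Hp1 p"
    using insert Hinf1_subset_Hp1[OF p] by (auto intro!: subsetD[OF Hinf1_subset_Hp1[OF p]] Hinf1_sum Hinf1_cmult)
  show ?case using insert mu_add[OF *(1,2)] mu_cmult[OF *(3)] by simp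
qed

text \<open>Both factors are exponentials of functions with bounded real part, so the product is
  bounded above and away from 0.\<close>

lemma cyclic_E_exp:
  assumes k: "k \<in> Hinf1"
  shows "cyclic p \<alpha> \<beta> (\<lambda>z. E z * exp (k z))"
proof -
  obtain N where N: "\<And>z. z \<in> unit_disc \<Longrightarrow> cmod (k z) \<le> N" using Hinf1D(4)[OF k] by blast
  have ek: "(\<lambda>z. exp (k z)) \<in> Hp1 p" using Hinf1_exp[OF k] Hinf1_subset_Hp1[OF p] by blast
  have Re: "\<bar>Re (k z)\<bar> \<le> N" if "z \<in> unit_disc" for z using N[OF that] abs_Re_le_cmod[of "k z"] by linarith
  show ?thesis
  proof (rule cyclic_if_bounded_below[OF p \<alpha>])
    show "(\<lambda>z. E z * exp (k z)) holomorphic_on unit_disc"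
      by (intro holomorphic_intros E_holomorphic Hinf1D(1)[OF k])
    show "\<alpha> * deriv (\<lambda>z. E z * exp (k z)) 0 = \<beta> * (E 0 * exp (k 0))"
      using E_mult_in[OF ek] Hp_ab_iff[OF p \<alpha>] by blast
    show "0 < exp (- cmod (\<beta> / \<alpha>)) * exp (- N)" by simp
    show "cmod (E z * exp (k z)) \<le> exp (cmod (\<beta> / \<alpha>)) * exp N" if "z \<in> unit_disc" for z
      unfolding norm_mult using Re[OF that] by (intro mult_mono E_le that) auto
    show "exp (- cmod (\<beta> / \<alpha>)) * exp (- N) \<le> cmod (E z * exp (k z))" if "z \<in> unit_disc" for z
      unfolding norm_mult using Re[OF that] by (intro mult_mono E_le that) auto
  qed
qed

lemma mu_exp_nonzero: "k \<in> Hinf1 \<Longrightarrow> \<mu> (\<lambda>z. exp (k z)) \<noteq> 0"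
  unfolding \<mu>_def by (rule nonzero[OF cyclic_E_exp])

lemma mu_one_nonzero: "\<mu> (\<lambda>_. 1) \<noteq> 0"
  using mu_exp_nonzero[OF Hinf1_const[of 0]] by simp

text \<open>The exponential series of \<zeta> k converges uniformly on the disc, and
  \<open>\<mu>\<close> is bounded for the supremum norm by \<open>mu_le_bound\<close>, so it may be
  applied term by term.\<close>

lemma mu_exp_sums:
  assumes k: "k \<in> Hinf1"
  shows "(\<lambda>n. \<mu> (\<lambda>z. k z ^ n) / fact n * \<zeta> ^ n) sums \<mu> (\<lambda>z. exp (\<zeta> * k z))"
proof -
  obtain N where N: "0 \<le> N" "\<And>z. z \<in> unit_disc \<Longrightarrow> cmod (k z) \<le> N" using Hinf1D(4)[OF k] by blast
  define \<rho> where "\<rho> = cmod \<zeta> * N"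
  have \<rho>: "0 \<le> \<rho>" "\<And>z. z \<in> unit_disc \<Longrightarrow> cmod (\<zeta> * k z) \<le> \<rho>" using N by (auto simp: \<rho>_def norm_mult mult_left_mono)
  let ?S = "\<lambda>n z. \<Sum>i\<le>n. (\<zeta> ^ i / fact i) * k z ^ i"
  have eH: "(\<lambda>z. exp (\<zeta> * k z)) \<in> Hinf1" by (intro Hinf1_exp Hinf1_cmult k)
  have SH: "?S n \<in> Hinf1" for n by (intro Hinf1_sum Hinf1_cmult Hinf1_power k) auto
  have le: "cmod (\<mu> (\<lambda>z. exp (\<zeta> * k z)) - \<mu> (?S n)) \<le> D * (exp \<rho> * (\<rho> ^ Suc n / fact n))" for n
  proof -
    have "\<mu> (\<lambda>z. exp (\<zeta> * k z)) - \<mu> (?S n) = \<mu> (\<lambda>z. exp (\<zeta> * k z) - ?S n z)"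
      using eH SH Hinf1_subset_Hp1[OF p] by (subst mu_diff) auto
    moreover have "(\<lambda>z. exp (\<zeta> * k z) - ?S n z) \<in> Hinf1"
      using Hinf1_add[OF eH Hinf1_cmult[OF SH[of n], of "-1"]] by simp
    moreover have "cmod (exp (\<zeta> * k z) - ?S n z) \<le> exp \<rho> * (\<rho> ^ Suc n / fact n)" if z: "z \<in> unit_disc" for z
    proof -
      have "?S n z = (\<Sum>i\<le>n. (\<zeta> * k z) ^ i / fact i)" by (simp add: power_mult_distrib)
      then have "cmod (exp (\<zeta> * k z) - ?S n z) \<le> exp \<bar>Re (\<zeta> * k z)\<bar> * cmod (\<zeta> * k z) ^ Suc n / fact n"
        using Taylor_exp[of "\<zeta> * k z" n] by simp
      also have "\<dots> \<le> exp \<rho> * \<rho> ^ Suc n / fact n"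
        using \<rho>(2)[OF z] abs_Re_le_cmod[of "\<zeta> * k z"]
        by (intro divide_right_mono mult_mono power_mono) auto
      finally show ?thesis by simp
    qed
    ultimately show ?thesis using mu_le_bound by presburger
  qed
  have "(\<lambda>n. \<rho> * (\<rho> ^ n /\<^sub>R fact n)) \<longlonglongrightarrow> \<rho> * 0"
    by (intro tendsto_mult tendsto_const summable_LIMSEQ_zero summable_exp_generic)
  then have "(\<lambda>n. D * (exp \<rho> * (\<rho> ^ Suc n / fact n))) \<longlonglongrightarrow> D * (exp \<rho> * 0)"
    by (intro tendsto_mult tendsto_const) (simp add: divide_inverse mult_ac)
  then have lim: "(\<lambda>n. D * (exp \<rho> * (\<rho> ^ Suc n / fact n))) \<longlonglongrightarrow> 0" by simp
  have "(\<lambda>n. \<mu> (\<lambda>z. exp (\<zeta> * k z)) - \<mu> (?S n)) \<longlonglongrightarrow> 0"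
    by (rule Lim_null_comparison[OF _ lim]) (use le in simp)
  from tendsto_diff[OF tendsto_const this, of "\<mu> (\<lambda>z. exp (\<zeta> * k z))"]
  have "(\<lambda>n. \<mu> (?S n)) \<longlonglongrightarrow> \<mu> (\<lambda>z. exp (\<zeta> * k z))" by simp
  moreover have "\<mu> (?S n) = (\<Sum>i\<le>n. \<mu> (\<lambda>z. k z ^ i) / fact i * \<zeta> ^ i)" for n
    by (subst mu_sum) (auto intro: Hinf1_power k simp: mult_ac)
  ultimately show ?thesis unfolding sums_def_le by simp
qed

text \<open>The entire function \<open>\<zeta> \<mapsto> \<mu> (exp (\<zeta> k))\<close> has no zeros and is of exponential type, so it is
  \<open>exp (a + b \<zeta>)\<close>, and comparing coefficients gives multiplicativity on squares, as in the
  Gleason--Kahane--Zelazko theorem.\<close>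

lemma mu_square:
  assumes k: "k \<in> Hinf1"
  shows "\<mu> (\<lambda>z. k z * k z) * \<mu> (\<lambda>_. 1) = \<mu> k * \<mu> k"
proof -
  obtain N where N: "0 \<le> N" "\<And>z. z \<in> unit_disc \<Longrightarrow> cmod (k z) \<le> N" using Hinf1D(4)[OF k] by blast
  define F where "F \<zeta> = \<mu> (\<lambda>z. exp (\<zeta> * k z))" for \<zeta>
  have sums: "(\<lambda>n. \<mu> (\<lambda>z. k z ^ n) / fact n * \<zeta> ^ n) sums F \<zeta>" for \<zeta>
    unfolding F_def by (rule mu_exp_sums[OF k])
  have "F holomorphic_on ball 0 r" for r
    by (rule power_series_holomorphic[where a = "\<lambda>n. \<mu> (\<lambda>z. k z ^ n) / fact n"]) (use sums in simp)
  then have "F field_differentiable at \<zeta>" for \<zeta>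
    using holomorphic_on_imp_differentiable_at[OF _ open_ball, of F 0 "cmod \<zeta> + 1" \<zeta>] by simp
  then have "F holomorphic_on UNIV" by (simp add: holomorphic_on_def)
  moreover have "F \<zeta> \<noteq> 0" for \<zeta> unfolding F_def by (intro mu_exp_nonzero Hinf1_cmult k)
  moreover have "cmod (F \<zeta>) \<le> D * exp (N * cmod \<zeta>)" for \<zeta>
    unfolding F_def
  proof (rule mu_le_bound)
    fix z assume z: "z \<in> unit_disc"
    have "Re (\<zeta> * k z) \<le> cmod \<zeta> * cmod (k z)" using complex_Re_le_cmod[of "\<zeta> * k z"] by (simp add: norm_mult)
    also have "\<dots> \<le> cmod \<zeta> * N" using N(2)[OF z] by (intro mult_left_mono) auto
    finally show "cmod (exp (\<zeta> * k z)) \<le> exp (N * cmod \<zeta>)" by (simp add: mult.commute)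
  qed (intro Hinf1_exp Hinf1_cmult k)
  ultimately obtain a b where ab: "\<And>\<zeta>. F \<zeta> = exp (a + b * \<zeta>)"
    using entire_zero_free_exponential_type[of F N D] N(1) by blast
  have "(\<lambda>n. exp a * b ^ n / fact n * \<zeta> ^ n) sums F \<zeta>" for \<zeta>
    using sums_mult[OF exp_converges[of "b * \<zeta>"], of "exp a"]
    by (simp add: ab exp_add scaleR_conv_of_real divide_inverse power_mult_distrib mult_ac)
  from powser_unique[OF sums this] have eq: "\<mu> (\<lambda>z. k z ^ n) / fact n = exp a * b ^ n / fact n" for n .
  have "\<mu> (\<lambda>_. 1) = exp a" using eq[of 0] by simp
  moreover have "\<mu> k = exp a * b" using eq[of 1] by simp
  moreover have "\<mu> (\<lambda>z. k z * k z) = exp a * b\<^sup>2" using eq[of 2] by (simp add: power2_eq_square)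
  ultimately show ?thesis by (simp add: power2_eq_square)
qed

text \<open>Polarization: \<open>mu_square\<close> is applied to k + l and expanded.\<close>

lemma mu_mult:
  assumes k: "k \<in> Hinf1" and l: "l \<in> Hinf1"
  shows "\<mu> (\<lambda>z. k z * l z) * \<mu> (\<lambda>_. 1) = \<mu> k * \<mu> l"
proof -
  note H = subsetD[OF Hinf1_subset_Hp1[OF p]]
  have kl: "(\<lambda>z. k z * l z) \<in> Hinf1" by (intro Hinf1_mult k l)
  have "(\<lambda>z. (k z + l z) * (k z + l z)) = (\<lambda>z. (k z * k z + 2 * (k z * l z)) + l z * l z)"
    by (simp add: algebra_simps)
  then have "\<mu> (\<lambda>z. (k z + l z) * (k z + l z)) = \<mu> (\<lambda>z. k z * k z) + 2 * \<mu> (\<lambda>z. k z * l z) + \<mu> (\<lambda>z. l z * l z)"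
    by (simp add: mu_add mu_cmult H Hinf1_add Hinf1_mult Hinf1_cmult k l kl)
  moreover have "\<mu> (\<lambda>z. k z + l z) = \<mu> k + \<mu> l" by (intro mu_add H k l)
  ultimately have "(\<mu> (\<lambda>z. k z * k z) + 2 * \<mu> (\<lambda>z. k z * l z) + \<mu> (\<lambda>z. l z * l z)) * \<mu> (\<lambda>_. 1)
      = (\<mu> k + \<mu> l) * (\<mu> k + \<mu> l)"
    using mu_square[OF Hinf1_add[OF k l]] by simp
  then show ?thesis using mu_square[OF k] mu_square[OF l] by (simp add: algebra_simps)
qed

text \<open>The monomial \<open>z\<close> itself is not available, so \<open>w\<close> is recovered from the characters of
  \<open>z\<^sup>2\<close> and \<open>z\<^sup>3\<close> as their quotient.\<close>

lemma mu_monom: "\<exists>w. \<forall>n. n \<noteq> 1 \<longrightarrow> \<mu> (\<lambda>z. z ^ n) = \<mu> (\<lambda>_. 1) * w ^ n"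
proof -
  let ?u = "\<mu> (\<lambda>_. 1)"
  define m where "m n = \<mu> (\<lambda>z. z ^ n) / ?u" for n
  have u: "?u \<noteq> 0" by (rule mu_one_nonzero)
  have m_add: "m (i + j) = m i * m j" if "i \<noteq> 1" "j \<noteq> 1" for i j
  proof -
    have "\<mu> (\<lambda>z. z ^ (i + j)) * ?u = \<mu> (\<lambda>z. z ^ i) * \<mu> (\<lambda>z. z ^ j)"
      unfolding power_add by (rule mu_mult[OF Hinf1_monom[OF that(1)] Hinf1_monom[OF that(2)]])
    then show ?thesis using u by (simp add: m_def field_simps)
  qed
  have m0: "m 0 = 1" using u by (simp add: m_def)
  \<comment> \<open>Both sides are values of \<open>m 6\<close>, computed from 3 + 3 and from 2 + 2
    + 2.\<close>
  have m6: "m 3 * m 3 = m 2 * m 2 * m 2"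
    using m_add[of 3 3] m_add[of 4 2] m_add[of 2 2] by simp
  \<comment> \<open>If m 2 = 0, then \<open>m6\<close> forces m 3 = 0 as well, so w = 0 is the right
    choice.\<close>
  define w where "w = (if m 2 = 0 then 0 else m 3 / m 2)"
  have w2: "w ^ 2 = m 2" using m6 by (auto simp: w_def power2_eq_square field_simps)
  have w3: "w ^ 3 = m 3"
  proof (cases "m 2 = 0")
    case True
    then show ?thesis using m6 by (auto simp: w_def)
  next
    case False
    have "w ^ 3 = w ^ 2 * w" by (simp add: power2_eq_square power3_eq_cube)
    also have "\<dots> = m 3" using False unfolding w2 by (simp add: w_def)
    finally show ?thesis .
  qed
  have "m n = w ^ n" if "n \<noteq> 1" for n
    using that
  proof (induction n rule: less_induct)
    case (less n)
    show ?case
    proof (cases "n \<in> {0, 2, 3}")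
      case True
      then show ?thesis using m0 w2 w3 by auto
    next
      case False
      \<comment> \<open>Here n \<ge> 4, so n - 2 skips the excluded exponent 1. The exponent 3 would
        run into it and is therefore a base case.\<close>
      then have n: "n - 2 \<noteq> 1" "n - 2 < n" "n = (n - 2) + 2" using less by auto
      have "m n = m (n - 2) * m 2" using m_add[of "n - 2" 2] n by simp
      also have "\<dots> = w ^ n" using less(1)[OF n(2,1)] n(3) by (metis w2 power_add)
      finally show ?thesis .
    qed
  qed
  then have "\<mu> (\<lambda>z. z ^ n) = ?u * w ^ n" if "n \<noteq> 1" for n
    using u that by (simp add: m_def field_simps)
  then show ?thesis by blast
qed

text \<open>If \<open>cmod w \<ge> 1\<close>, then \<open>k = (1 - r) (\<Sum>n<N. (r / w)\<^sup>n z\<^sup>n\<^sup>+\<^sup>2)\<close> would have small norm for \<open>r\<close> near \<open>1\<close>, while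
  \<open>\<mu> k / \<mu> 1 = w\<^sup>2 (1 - r\<^sup>N)\<close> stays away from \<open>0\<close>.\<close>

lemma mu_point_in_disc:
  assumes w: "\<And>n. n \<noteq> 1 \<Longrightarrow> \<mu> (\<lambda>z. z ^ n) = \<mu> (\<lambda>_. 1) * w ^ n"
  shows "cmod w < 1"
proof (rule ccontr)
  assume "\<not> cmod w < 1"
  then have w1: "1 \<le> cmod w" by simp
  then have w0: "w \<noteq> 0" by auto
  define u where "u = cmod (\<mu> (\<lambda>_. 1))"
  have u: "u > 0" using mu_one_nonzero by (simp add: u_def)
  \<comment> \<open>This value makes \<open>D * \<tau>\<close> smaller than u / 2, while |\<mu> k|
    will be at least u / 2.\<close>
  define \<tau> where "\<tau> = u / (u + 4 * D)"
  have \<tau>: "0 < \<tau>" "\<tau> \<le> 1" using u D_nonneg by (auto simp: \<tau>_def)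
  have p2: "2 * p > 0" using p by simp
  \<comment> \<open>The p-means of \<open>k\<close> will be at most
    \<open>2 powr p * sqrt \<epsilon>\<close>; with this \<epsilon> the p-th root of that bound is
    exactly \<tau>.\<close>
  define \<epsilon> where "\<epsilon> = (\<tau> / 2) powr (2 * p)"
  have \<epsilon>: "0 < \<epsilon>" "\<epsilon> < 1" using \<tau> p2 powr_less_mono2[OF p2, of "\<tau> / 2" 1] by (auto simp: \<epsilon>_def)
  define r where "r = 1 - \<epsilon>"
  have r: "0 < r" "r < 1" using \<epsilon> by (auto simp: r_def)
  obtain N where N: "r ^ N < 1 / 2" using real_arch_pow_inv[of "1 / 2" r] r by auto
  \<comment> \<open>Since c w = r, applying \<open>\<mu>\<close> yields a geometric sum in r, and
    |w| \<ge> 1 gives |c| \<le> r, which controls \<open>k\<close> on the disc.\<close>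
  define c where "c = of_real r / w"
  have c: "cmod c \<le> r" "cmod c < 1" using r w1 by (auto simp: c_def norm_divide divide_le_eq mult_le_cancel_left1 intro: le_less_trans[of _ r])
  define k where "k z = (\<Sum>n<N. (of_real (1 - r) * c ^ n) * z ^ (n + 2))" for z
  have kH: "k \<in> Hinf1" unfolding k_def by (intro Hinf1_sum Hinf1_cmult Hinf1_monom) auto
  have "\<mu> k = (\<Sum>n<N. (of_real (1 - r) * c ^ n) * \<mu> (\<lambda>z. z ^ (n + 2)))"
    unfolding k_def by (intro mu_sum Hinf1_monom) auto
  also have "\<dots> = (\<Sum>n<N. \<mu> (\<lambda>_. 1) * w ^ 2 * (of_real (1 - r) * of_real r ^ n))"
  proof (intro sum.cong refl)
    fix n
    have *: "c ^ n * w ^ (n + 2) = of_real r ^ n * w ^ 2"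
      using w0 by (simp add: c_def power_divide power_add power2_eq_square)
    have "\<mu> (\<lambda>z. z ^ (n + 2)) = \<mu> (\<lambda>_. 1) * w ^ (n + 2)" by (rule w) simp
    then have "of_real (1 - r) * c ^ n * \<mu> (\<lambda>z. z ^ (n + 2)) = of_real (1 - r) * \<mu> (\<lambda>_. 1) * (c ^ n * w ^ (n + 2))"
      by (simp only: mult_ac)
    then show "of_real (1 - r) * c ^ n * \<mu> (\<lambda>z. z ^ (n + 2)) = \<mu> (\<lambda>_. 1) * w ^ 2 * (of_real (1 - r) * of_real r ^ n)"
      unfolding * by (simp only: mult_ac)
  qed
  also have "\<dots> = \<mu> (\<lambda>_. 1) * w ^ 2 * ((1 - of_real r) * (\<Sum>n<N. of_real r ^ n))"
    by (simp add: sum_distrib_left mult_ac)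
  also have "(1 - of_real r) * (\<Sum>n<N. of_real r ^ n) = (1 - of_real r ^ N :: complex)"
    by (rule one_diff_power_eq[symmetric])
  finally have "cmod (\<mu> k) = u * cmod w ^ 2 * cmod (1 - of_real r ^ N)"
    by (simp add: u_def norm_mult norm_power)
  also have "cmod (1 - of_real r ^ N) = 1 - r ^ N"
  proof -
    have "1 - of_real r ^ N = complex_of_real (1 - r ^ N)" by simp
    then show ?thesis using N by (simp only: norm_of_real)
  qed
  finally have mk: "cmod (\<mu> k) = u * cmod w ^ 2 * (1 - r ^ N)" .
  have "u * 1 * (1 / 2) \<le> u * cmod w ^ 2 * (1 - r ^ N)"
    using u N w1 by (intro mult_mono) (auto simp: one_le_power)
  then have low: "u / 2 \<le> cmod (\<mu> k)" using mk by simp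
  \<comment> \<open>Summing the geometric series gives a numerator of modulus at most 2 (1 - r).
    Halving \<open>k\<close> removes the 2 and makes the modulus at most 1, so its p-th power is at
    most itself for every p \<ge> 1.\<close>
  have k_le: "cmod (k z / 2) \<le> (1 - r) / cmod (1 - c * z)" "cmod (k z / 2) \<le> 1" if z: "cmod z < 1" for z
  proof -
    have cz: "cmod (c * z) \<le> r" using c(1) z mult_mono[of "cmod c" r "cmod z" 1] r by (simp add: norm_mult)
    have d: "1 - r \<le> cmod (1 - c * z)" using norm_triangle_ineq2[of 1 "c * z"] cz by simp
    have "k z = of_real (1 - r) * z ^ 2 * (\<Sum>n<N. (c * z) ^ n)"
      unfolding k_def sum_distrib_left by (intro sum.cong refl) (simp add: power_mult_distrib power_add power2_eq_square mult_ac)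
    then have "(1 - c * z) * k z = of_real (1 - r) * z ^ 2 * ((1 - c * z) * (\<Sum>n<N. (c * z) ^ n))" by simp
    also have "(1 - c * z) * (\<Sum>n<N. (c * z) ^ n) = 1 - (c * z) ^ N" by (rule one_diff_power_eq[symmetric])
    finally have "cmod (1 - c * z) * cmod (k z) = cmod (of_real (1 - r)) * cmod z ^ 2 * cmod (1 - (c * z) ^ N)"
      by (metis norm_mult norm_power)
    also have "\<dots> \<le> (1 - r) * 1 * 2"
    proof (intro mult_mono)
      have "cmod (1 - (c * z) ^ N) \<le> 1 + cmod ((c * z) ^ N)" using norm_triangle_ineq4[of 1 "(c * z) ^ N"] by simp
      also have "cmod ((c * z) ^ N) \<le> 1" unfolding norm_power using cz r by (intro power_le_one) auto
      finally show "cmod (1 - (c * z) ^ N) \<le> 2" by simp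
      show "cmod (of_real (1 - r)) \<le> 1 - r" using r by (simp only: norm_of_real)
      show "cmod z ^ 2 \<le> 1" using z by (intro power_le_one) auto
    qed (use r in auto)
    finally have *: "cmod (1 - c * z) * cmod (k z / 2) \<le> 1 - r" by (simp add: norm_divide)
    have "0 < cmod (1 - c * z)" using d r by (simp del: zero_less_norm_iff)
    with * show "cmod (k z / 2) \<le> (1 - r) / cmod (1 - c * z)" by (simp only: pos_le_divide_eq mult.commute)
    also have "\<dots> \<le> 1" using d r by (simp add: divide_le_eq_1)
    finally show "cmod (k z / 2) \<le> 1" .
  qed
  have kh: "k holomorphic_on unit_disc" by (rule Hinf1D(1)[OF kH])
  have mean: "cmean p k s \<le> 2 powr p * sqrt \<epsilon>" if s: "0 \<le> s" "s < 1" for s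
  proof -
    define \<delta> where "\<delta> = sqrt \<epsilon>"
    have \<delta>: "\<delta> > 0" "\<delta>\<^sup>2 = \<epsilon>" using \<epsilon> by (auto simp: \<delta>_def)
    have ne: "1 - c * z \<noteq> 0" if "cmod z = s" for z
    proof
      assume "1 - c * z = 0"
      then have "cmod (c * z) = 1" by (metis eq_iff_diff_eq_0 norm_one)
      moreover have "cmod (c * z) \<le> cmod c * 1" unfolding norm_mult using s that by (intro mult_left_mono) auto
      ultimately show False using c(2) by simp
    qed
    have ci: "continuous_on (sphere 0 s) (\<lambda>z. 1 / (cmod (1 - c * z))\<^sup>2)"
      using ne by (auto intro!: continuous_intros)
    have avg: "cavg s (\<lambda>z. 1 / (cmod (1 - c * z))\<^sup>2) \<le> 1 / \<epsilon>"
    proof (cases "s = 0")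
      case True
      have "cavg s (\<lambda>z. 1 / (cmod (1 - c * z))\<^sup>2) = cavg s (\<lambda>z. 1)" using True by (intro cavg_cong) auto
      then show ?thesis using \<epsilon> by simp
    next
      case False
      then have s0: "s > 0" using s by simp
      \<comment> \<open>\<open>a\<close> is the reflection of the pole 1 / c in the circle of radius
        s. On that circle 1 / |1 - c z|^2 is a multiple of the Poisson kernel at \<open>a\<close>,
        so its mean is known exactly.\<close>
      define a where "a = of_real (s\<^sup>2) * cnj c"
      have sc: "s * cmod c < 1" using mult_strict_mono[of s 1 "cmod c" 1] s c by simp
      have ca: "cmod a = s * (s * cmod c)" using s0 by (simp add: a_def norm_mult power2_eq_square)
      have al: "cmod a < s" unfolding ca using s0 sc by simp
      have q: "1 - (s * cmod c)\<^sup>2 > 0" using sc s0 by (simp add: power_less_one_iff abs_square_less_1)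
      have "cavg s (\<lambda>z. 1 / (cmod (1 - c * z))\<^sup>2) = cavg s (\<lambda>z. 1 / (1 - (s * cmod c)\<^sup>2) * poisson s a z)"
      proof (intro cavg_cong s)
        fix z assume z: "cmod z = s"
        have "z - a = z * cnj (1 - c * z)"
          using complex_norm_square[of z] z by (simp add: a_def algebra_simps)
        then have "(cmod (z - a))\<^sup>2 = s\<^sup>2 * (cmod (1 - c * z))\<^sup>2"
          using z by (simp only: norm_mult complex_mod_cnj power_mult_distrib)
        moreover have "s\<^sup>2 - (cmod a)\<^sup>2 = s\<^sup>2 * (1 - (s * cmod c)\<^sup>2)"
          unfolding ca by (simp add: power_mult_distrib algebra_simps)
        ultimately show "1 / (cmod (1 - c * z))\<^sup>2 = 1 / (1 - (s * cmod c)\<^sup>2) * poisson s a z"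
          unfolding poisson_def using s0 q ne[OF z] by simp
      qed
      also have "\<dots> = 1 / (1 - (s * cmod c)\<^sup>2)" unfolding cavg_cmult cavg_poisson[OF al] by simp
      also have "\<dots> \<le> 1 / \<epsilon>"
      proof (intro divide_left_mono)
        have "s * cmod c \<le> 1 * r" using s s0 c(1) by (intro mult_mono) auto
        then have "(s * cmod c)\<^sup>2 \<le> r\<^sup>2" using s0 by (intro power_mono) auto
        also have "r\<^sup>2 \<le> r" using r by (simp add: power2_eq_square mult_left_le)
        finally show "\<epsilon> \<le> 1 - (s * cmod c)\<^sup>2" by (simp add: r_def)
      qed (use q \<epsilon> in auto)
      finally show ?thesis .
    qed
    \<comment> \<open>The bound x \<le> (\<delta> + x^2 / \<delta>) / 2 passes to the square, whose
      mean the Poisson kernel computes. With \<delta> = sqrt \<epsilon> the two summands contribute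
      equally.\<close>
    have pw: "cmod (k z) powr p \<le> 2 powr p * (1 / 2) * (\<delta> + \<epsilon>\<^sup>2 / \<delta> * (1 / (cmod (1 - c * z))\<^sup>2))" if z: "cmod z = s" for z
    proof -
      define x where "x = cmod (k z / 2)"
      have x: "0 \<le> x" "x \<le> 1" "x \<le> \<epsilon> / cmod (1 - c * z)" using k_le[of z] z s by (auto simp: x_def r_def)
      have "x powr p \<le> x" using x p powr_mono'[of 1 p x] by simp
      also have "x \<le> 1 / 2 * (\<delta> + x\<^sup>2 / \<delta>)"
      proof -
        have "0 \<le> (\<delta> - x)\<^sup>2 / \<delta>" using \<delta> by simp
        also have "\<dots> = \<delta> + x\<^sup>2 / \<delta> - 2 * x" using \<delta> by (simp add: power2_eq_square field_simps)
        finally show ?thesis by simp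
      qed
      also have "\<dots> \<le> 1 / 2 * (\<delta> + (\<epsilon> / cmod (1 - c * z))\<^sup>2 / \<delta>)"
        using x \<delta> by (intro mult_left_mono add_left_mono divide_right_mono power_mono) auto
      finally have "2 powr p * x powr p \<le> 2 powr p * (1 / 2 * (\<delta> + (\<epsilon> / cmod (1 - c * z))\<^sup>2 / \<delta>))"
        by (intro mult_left_mono) auto
      moreover have "cmod (k z) powr p = 2 powr p * x powr p"
        using x powr_mult[of 2 x p] by (simp add: x_def norm_divide)
      ultimately show ?thesis by (simp add: power_divide mult.commute)
    qed
    have "cmean p k s \<le> cavg s (\<lambda>z. 2 powr p * (1 / 2) * (\<delta> + \<epsilon>\<^sup>2 / \<delta> * (1 / (cmod (1 - c * z))\<^sup>2)))"
      unfolding cmean_def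
    proof (rule cavg_mono[OF s(1) _ _ pw])
      show "continuous_on (sphere 0 s) (\<lambda>z. cmod (k z) powr p)"
        using p by (intro continuous_on_cmod_powr holomorphic_on_disc_continuous_on[OF kh subset_unit_disc(1)[OF s(2)]]) auto
    qed (intro continuous_on_mult continuous_on_add continuous_on_const ci)
    also have "\<dots> = 2 powr p * (1 / 2) * (\<delta> + \<epsilon>\<^sup>2 / \<delta> * cavg s (\<lambda>z. 1 / (cmod (1 - c * z))\<^sup>2))"
      using cavg_add[OF s(1) continuous_on_const continuous_on_mult[OF continuous_on_const ci], of \<delta> "\<epsilon>\<^sup>2 / \<delta>"]
      by (simp only: cavg_cmult cavg_const)
    also have "\<dots> \<le> 2 powr p * (1 / 2) * (\<delta> + \<epsilon>\<^sup>2 / \<delta> * (1 / \<epsilon>))"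
      using \<delta> avg by (intro mult_left_mono add_left_mono) auto
    also have "\<epsilon>\<^sup>2 / \<delta> * (1 / \<epsilon>) = \<delta>" using \<delta>(1) \<epsilon>(1) unfolding \<delta>(2)[symmetric] by (simp add: power2_eq_square)
    finally show ?thesis by (simp add: \<delta>_def)
  qed
  have "Hp_norm p k \<le> (2 powr p * sqrt \<epsilon>) powr (1 / p)"
    by (rule Hp_norm_le(2)[OF p kh mean])
  also have "sqrt \<epsilon> = (\<tau> / 2) powr p"
    using \<tau> by (simp add: \<epsilon>_def powr_powr flip: powr_half_sqrt)
  also have "(2 powr p * (\<tau> / 2) powr p) powr (1 / p) = \<tau>"
    using \<tau> p by (simp add: powr_powr flip: powr_mult)
  finally have "cmod (\<mu> k) \<le> D * \<tau>"
    using mu_le_Hp_norm[of k] kH Hinf1_subset_Hp1[OF p] D_nonneg by (meson mult_left_mono order.trans subsetD)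
  also have "D * \<tau> < u / 2"
  proof -
    have "u * (u + 4 * D) = D * u * 2 + (u * u + D * u * 2)" by (simp add: algebra_simps)
    moreover have "0 < u * u + D * u * 2" using u D_nonneg by (intro add_pos_nonneg) auto
    ultimately have "D * u * 2 < u * (u + 4 * D)" by (simp only: less_add_same_cancel1)
    then show ?thesis using u D_nonneg by (simp add: \<tau>_def field_simps)
  qed
  finally show False using low by simp
qed

text \<open>The Taylor series of a dilate converges uniformly on the disc, so \<open>\<mu>\<close>
  can be evaluated term by term. The coefficient of z vanishes, which allows index 1 to be left out:
  its monomial is not in \<open>Hinf1\<close>.\<close>

lemma Hinf1_dilate_mu:
  assumes w: "\<And>n. n \<noteq> 1 \<Longrightarrow> \<mu> (\<lambda>z. z ^ n) = \<mu> (\<lambda>_. 1) * w ^ n" "cmod w < 1"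
    and k: "k \<in> Hp1 p" and s: "0 < s" "s < 1"
  shows "\<mu> (\<lambda>z. k (of_real s * z)) = \<mu> (\<lambda>_. 1) * k (of_real s * w)"
proof -
  define a where "a n = (deriv ^^ n) k 0 / fact n" for n
  have kh: "k holomorphic_on unit_disc" using k Hp_holomorphic by (auto simp: Hp1_def)
  have a1: "a 1 = 0" using k by (simp add: a_def Hp1_def)
  have sums: "(\<lambda>n. a n * z ^ n) sums k z" if "z \<in> unit_disc" for z
    using holomorphic_power_series[OF kh that] by (simp add: a_def)
  let ?P = "\<lambda>N z. \<Sum>n\<in>{..<N} - {1}. (a n * of_real s ^ n) * z ^ n"
  let ?ks = "\<lambda>z. k (of_real s * z)"
  have P: "?P N z = (\<Sum>n<N. a n * (of_real s * z) ^ n)" for N z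
  proof -
    have "?P N z = (\<Sum>n<N. (a n * of_real s ^ n) * z ^ n)"
      by (rule sum.mono_neutral_left) (use a1 in auto)
    then show ?thesis by (simp add: power_mult_distrib mult.assoc)
  qed
  have PH: "?P N \<in> Hinf1" for N by (intro Hinf1_sum Hinf1_cmult Hinf1_monom) auto
  have kH: "?ks \<in> Hinf1" using s k kh by (intro Hinf1_dilate) (auto simp: Hp1_def)
  have lim0: "(\<lambda>N. \<mu> (?P N)) \<longlonglongrightarrow> \<mu> (\<lambda>_. 1) * k (of_real s * w)"
  proof -
    have "\<mu> (?P N) = \<mu> (\<lambda>_. 1) * (\<Sum>n<N. a n * (of_real s * w) ^ n)" for N
    proof -
      have "\<mu> (?P N) = (\<Sum>n\<in>{..<N} - {1}. (a n * of_real s ^ n) * \<mu> (\<lambda>z. z ^ n))"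
        by (intro mu_sum Hinf1_monom) auto
      also have "\<dots> = (\<Sum>n\<in>{..<N} - {1}. \<mu> (\<lambda>_. 1) * ((a n * of_real s ^ n) * w ^ n))"
        by (intro sum.cong refl) (simp add: w(1))
      also have "\<dots> = \<mu> (\<lambda>_. 1) * ?P N w" by (simp add: sum_distrib_left)
      finally show ?thesis unfolding P .
    qed
    moreover have "of_real s * w \<in> unit_disc"
      using s w(2) mult_strict_mono[of s 1 "cmod w" 1] by (simp add: norm_mult)
    ultimately show ?thesis using sums unfolding sums_def by (auto intro!: tendsto_mult)
  qed
  have "summable (\<lambda>n. norm (a n * of_real s ^ n))"
  \<comment> \<open>Convergence at (1 + s) / 2, a point strictly between s and 1, gives absolute
    convergence at s and thus a majorant on the closed disc.\<close>
  proof (rule powser_insidea)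
    have "complex_of_real ((1 + s) / 2) \<in> unit_disc" using s by (simp only: mem_ball_0 norm_of_real) simp
    then show "summable (\<lambda>n. a n * of_real ((1 + s) / 2) ^ n)" using sums sums_summable by blast
    have "norm (complex_of_real s) = s" "norm (complex_of_real ((1 + s) / 2)) = (1 + s) / 2"
      using s by (simp_all only: norm_of_real) simp_all
    then show "norm (complex_of_real s) < norm (complex_of_real ((1 + s) / 2))" using s by simp
  qed
  then have "uniform_limit (cball 0 1) (\<lambda>N z. \<Sum>n<N. a n * (of_real s * z) ^ n) (\<lambda>z. \<Sum>n. a n * (of_real s * z) ^ n) sequentially"
    by (rule Weierstrass_m_test[rotated])
       (use s in \<open>auto simp: norm_mult norm_power power_mult_distrib intro!: mult_left_mono mult_left_le power_le_one\<close>)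
  then have "uniform_limit unit_disc (\<lambda>N z. \<Sum>n<N. a n * (of_real s * z) ^ n) (\<lambda>z. \<Sum>n. a n * (of_real s * z) ^ n) sequentially"
    by (rule uniform_limit_on_subset) auto
  moreover have "(\<Sum>n. a n * (of_real s * z) ^ n) = ?ks z" if "z \<in> unit_disc" for z
  proof -
    have "of_real s * z \<in> unit_disc"
      using s that mult_strict_mono[of s 1 "cmod z" 1] by (simp add: norm_mult)
    from sums_unique[OF sums[OF this]] show ?thesis by simp
  qed
  ultimately have ul: "uniform_limit unit_disc (\<lambda>N z. \<Sum>n<N. a n * (of_real s * z) ^ n) ?ks sequentially"
    by (subst (asm) uniform_limit_cong') (auto simp only:)
  have "(\<lambda>N. \<mu> (?P N) - \<mu> ?ks) \<longlonglongrightarrow> 0"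
  proof (rule LIMSEQ_I)
    fix e :: real assume e: "0 < e"
    define e' where "e' = e / (D + 1)"
    have e': "e' > 0" "D * e' < e" using e D_nonneg by (auto simp: e'_def field_simps)
    obtain N0 where N0: "\<And>N z. N \<ge> N0 \<Longrightarrow> z \<in> unit_disc \<Longrightarrow> dist (\<Sum>n<N. a n * (of_real s * z) ^ n) (?ks z) < e'"
      using uniform_limitD[OF ul e'(1)] unfolding eventually_sequentially by blast
    have "norm (\<mu> (?P N) - \<mu> ?ks - 0) < e" if "N \<ge> N0" for N
    proof -
      have "\<mu> (?P N) - \<mu> ?ks = \<mu> (\<lambda>z. ?P N z - ?ks z)"
        using PH kH Hinf1_subset_Hp1[OF p] by (subst mu_diff) auto
      moreover have "(\<lambda>z. ?P N z - ?ks z) \<in> Hinf1"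
        using Hinf1_add[OF PH[of N] Hinf1_cmult[OF kH, of "-1"]] by simp
      moreover have "cmod (?P N z - ?ks z) \<le> e'" if "z \<in> unit_disc" for z
        using N0[OF \<open>N \<ge> N0\<close> that] unfolding P by (simp add: dist_norm)
      ultimately have "cmod (\<mu> (?P N) - \<mu> ?ks) \<le> D * e'" using mu_le_bound by presburger
      then show ?thesis using e'(2) by simp
    qed
    then show "\<exists>N0. \<forall>N\<ge>N0. norm (\<mu> (?P N) - \<mu> ?ks - 0) < e" by blast
  qed
  then have "(\<lambda>N. \<mu> (?P N)) \<longlonglongrightarrow> \<mu> ?ks" by (simp add: LIM_zero_iff)
  then show ?thesis using lim0 LIMSEQ_unique by blast
qed

text \<open>Both sides depend continuously on k in the Hardy norm, by \<open>mu_le_Hp_norm\<close>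
  and by \<open>cmod_le_Hp_norm\<close> at the point w, and they agree on the dilates of k.\<close>

lemma mu_eval:
  assumes w: "\<And>n. n \<noteq> 1 \<Longrightarrow> \<mu> (\<lambda>z. z ^ n) = \<mu> (\<lambda>_. 1) * w ^ n" "cmod w < 1"
    and k: "k \<in> Hp1 p"
  shows "\<mu> k = \<mu> (\<lambda>_. 1) * k w"
proof -
  define u where "u = cmod (\<mu> (\<lambda>_. 1))"
  define K where "K = (1 + 3 * cmod w) / (1 - cmod w)"
  have K: "0 \<le> K" using w(2) by (simp add: K_def)
  have kH: "k \<in> Hp p" using k by (simp add: Hp1_def)
  have "cmod (\<mu> k - \<mu> (\<lambda>_. 1) * k w) \<le> 0 + e" if e: "0 < e" for e
  proof -
    define e' where "e' = e / (D + u * K + 1)"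
    have pos: "D + u * K + 1 > 0" using D_nonneg K by (simp add: u_def add_nonneg_pos)
    have e': "e' > 0" using e pos by (simp add: e'_def)
    obtain d where d: "d < 1" "0 \<le> d" "\<And>s. d < s \<Longrightarrow> s < 1 \<Longrightarrow> Hp_norm p (\<lambda>z. k (of_real s * z) - k z) \<le> e'"
      using Hp_dilate_approx[OF p kH e'] by blast
    define s where "s = (d + 1) / 2"
    have s: "d < s" "s < 1" "0 < s" using d by (auto simp: s_def)
    let ?ks = "\<lambda>z. k (of_real s * z)"
    have ks: "?ks \<in> Hinf1" using s k Hp_holomorphic[OF kH] by (intro Hinf1_dilate) (auto simp: Hp1_def)
    then have ks1: "?ks \<in> Hp1 p" using Hinf1_subset_Hp1[OF p] by blast
    have dH: "(\<lambda>z. ?ks z - k z) \<in> Hp1 p" by (rule Hp1_diff[OF p ks1 k])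
    have n: "Hp_norm p (\<lambda>z. ?ks z - k z) \<le> e'" using d(3)[OF s(1,2)] .
    have "\<mu> ?ks = \<mu> (\<lambda>_. 1) * ?ks w" by (rule Hinf1_dilate_mu[OF w k s(3,2)])
    then have eq: "\<mu> k - \<mu> (\<lambda>_. 1) * k w = \<mu> (\<lambda>_. 1) * (?ks w - k w) - \<mu> (\<lambda>z. ?ks z - k z)"
      unfolding mu_diff[OF ks1 k] by (simp add: ring_distribs)
    have "cmod (\<mu> k - \<mu> (\<lambda>_. 1) * k w) \<le> u * cmod (?ks w - k w) + cmod (\<mu> (\<lambda>z. ?ks z - k z))"
      unfolding eq u_def norm_mult[symmetric] by (rule norm_triangle_ineq4)
    also have "\<dots> \<le> u * (K * e') + D * e'"
    proof (intro add_mono mult_left_mono)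
      have "cmod (?ks w - k w) \<le> K * Hp_norm p (\<lambda>z. ?ks z - k z)"
        unfolding K_def using dH by (intro cmod_le_Hp_norm[OF p _ w(2)]) (simp add: Hp1_def)
      also have "\<dots> \<le> K * e'" using n K by (rule mult_left_mono)
      finally show "cmod (?ks w - k w) \<le> K * e'" .
      have "cmod (\<mu> (\<lambda>z. ?ks z - k z)) \<le> D * Hp_norm p (\<lambda>z. ?ks z - k z)" by (rule mu_le_Hp_norm[OF dH])
      also have "\<dots> \<le> D * e'" using n D_nonneg by (rule mult_left_mono)
      finally show "cmod (\<mu> (\<lambda>z. ?ks z - k z)) \<le> D * e'" .
    qed (simp add: u_def)
    also have "\<dots> \<le> (D + u * K + 1) * e'" using e' by (simp add: algebra_simps)
    also have "\<dots> = e" using pos by (simp add: e'_def)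
    finally show ?thesis by simp
  qed
  then have "cmod (\<mu> k - \<mu> (\<lambda>_. 1) * k w) \<le> 0" by (rule field_le_epsilon)
  then show ?thesis by simp
qed

text \<open>The division by \<open>E\<close> is undone: for k = f / E, \<open>\<mu> k\<close> is
  \<open>\<Lambda> f\<close>, the constant \<open>\<mu>\<close> of 1 is \<open>\<Lambda> E\<close>,
  and k w is f w / E w.\<close>

lemma functional_eq_eval:
  "\<exists>w. cmod w < 1 \<and> \<Lambda> E \<noteq> 0 \<and> (\<forall>f\<in>Hp_ab p \<alpha> \<beta>. \<Lambda> f = \<Lambda> E / E w * f w)"
proof -
  obtain w where w: "\<And>n. n \<noteq> 1 \<Longrightarrow> \<mu> (\<lambda>z. z ^ n) = \<mu> (\<lambda>_. 1) * w ^ n" using mu_monom by blast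
  have w1: "cmod w < 1" by (rule mu_point_in_disc[OF w])
  have mE: "\<mu> (\<lambda>_. 1) = \<Lambda> E" by (simp add: \<mu>_def)
  have "\<Lambda> f = \<Lambda> E / E w * f w" if f: "f \<in> Hp_ab p \<alpha> \<beta>" for f
  proof -
    define k where "k z = inverse (E z) * f z" for z
    have fH: "f \<in> Hp p" "\<alpha> * deriv f 0 = \<beta> * f 0" using f Hp_ab_iff[OF p \<alpha>] by auto
    have "cmod (inverse (E z)) \<le> inverse (exp (- cmod (\<beta> / \<alpha>)))" if "z \<in> unit_disc" for z
      unfolding norm_inverse using E_le(2)[OF that] by (intro le_imp_inverse_le) auto
    then have kH: "k \<in> Hp p"
      unfolding k_def by (intro Hp_mult_bounded(1)[OF p fH(1)] holomorphic_intros E_holomorphic) auto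
    have "(k has_field_derivative (deriv f 0 - \<beta> / \<alpha> * f 0)) (at 0)"
    proof -
      have "(f has_field_derivative deriv f 0) (at 0)"
        using holomorphic_derivI[OF Hp_holomorphic[OF fH(1)] open_ball] by simp
      then show ?thesis unfolding k_def by (auto intro!: derivative_eq_intros E_deriv)
    qed
    moreover have "deriv f 0 - \<beta> / \<alpha> * f 0 = 0" using fH(2) \<alpha> by (simp add: field_simps)
    ultimately have "deriv k 0 = 0" by (simp add: DERIV_imp_deriv)
    then have "\<mu> k = \<mu> (\<lambda>_. 1) * k w" using kH by (intro mu_eval[OF w w1]) (simp_all add: Hp1_def)
    moreover have "\<mu> k = \<Lambda> f" by (simp add: \<mu>_def k_def mult.assoc[symmetric])
    ultimately show ?thesis by (simp add: mE k_def field_simps)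
  qed
  then show ?thesis using w1 mu_one_nonzero mE by auto
qed

end

subsection \<open>Weighted composition operators\<close>

lemma linear_on_Hp_abD:
  assumes "linear_on_Hp_ab p \<alpha> \<beta> T" "z \<in> unit_disc" "f \<in> Hp_ab p \<alpha> \<beta>"
  shows "g \<in> Hp_ab p \<alpha> \<beta> \<Longrightarrow> T (\<lambda>w. f w + g w) z = T f z + T g z" "T (\<lambda>w. c * f w) z = c * T f z"
  using assms unfolding linear_on_Hp_ab_def by auto

text \<open>The functions with modulus below 1 at z form an open set, tested with the compact set
  \<open>{z}\<close>. Its preimage contains the functions of the space in some ball around 0, and
  homogeneity turns this ball into a bound.\<close>

lemma continuous_map_eval_bounded:
  assumes p: "1 \<le> p" and \<alpha>: "\<alpha> \<noteq> 0" and lin: "linear_on_Hp_ab p \<alpha> \<beta> T"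
    and cont: "continuous_map (subtopology (Hp_topology p) (Hp_ab p \<alpha> \<beta>)) Hol_topology T"
    and z: "z \<in> unit_disc"
  shows "\<exists>C\<ge>0. \<forall>f\<in>Hp_ab p \<alpha> \<beta>. cmod (T f z) \<le> C * Hp_norm p f"
proof -
  let ?X = "Hp_ab p \<alpha> \<beta>"
  let ?U = "{h \<in> Hol. cmod (h z) < 1}"
  have top: "topspace (subtopology (Hp_topology p) ?X) = ?X"
    using Hp_ab_subset_Hp[OF p, of \<alpha> \<beta>] by auto
  have TH: "T f \<in> Hol" if "f \<in> ?X" for f
    using continuous_map_image_subset_topspace[OF cont] that unfolding top by auto
  have "openin Hol_topology ?U"
    unfolding openin_Hol_topology
  proof (intro conjI ballI)
    fix h assume h: "h \<in> ?U"
    then have pos: "0 < 1 - cmod (h z)" by simp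
    have near: "\<forall>g\<in>Hol. (\<forall>w\<in>{z}. cmod (g w - h w) < 1 - cmod (h z)) \<longrightarrow> g \<in> ?U"
    proof (intro ballI impI)
      fix g assume g: "g \<in> Hol" "\<forall>w\<in>{z}. cmod (g w - h w) < 1 - cmod (h z)"
      then have "cmod (g z) < 1" using norm_triangle_sub[of "g z" "h z"] by simp
      then show "g \<in> ?U" using g(1) by simp
    qed
    show "\<exists>K e. compact K \<and> K \<subseteq> unit_disc \<and> 0 < e \<and>
        (\<forall>g\<in>Hol. (\<forall>w\<in>K. cmod (g w - h w) < e) \<longrightarrow> g \<in> ?U)"
      by (rule exI[of _ "{z}"], rule exI[of _ "1 - cmod (h z)"], intro conjI near pos) (use z in simp_all)
  qed simp
  from openin_continuous_map_preimage[OF cont this]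
  have "openin (subtopology (Hp_topology p) ?X) {f \<in> ?X. T f \<in> ?U}" unfolding top .
  then obtain V where V: "openin (Hp_topology p) V" "{f \<in> ?X. T f \<in> ?U} = V \<inter> ?X"
    unfolding openin_subtopology by blast
  have zero: "(\<lambda>_. 0) \<in> ?X"
    using Hp_ab_iff[OF p \<alpha>, of "\<lambda>_. 0"] bounded_Hp(1)[OF p, of "\<lambda>_. 0" 0] by simp
  have "T (\<lambda>_. 0) z = 0" using linear_on_Hp_abD(2)[OF lin z zero, of 0] by simp
  then have "(\<lambda>_. 0) \<in> {f \<in> ?X. T f \<in> ?U}" using zero TH[OF zero] by simp
  then have zV: "(\<lambda>_. 0) \<in> V" unfolding V(2) by (rule IntD1)
  from V(1) have "\<forall>f\<in>V. \<exists>e>0. \<forall>g\<in>Hp p. Hp_norm p (\<lambda>z. g z - f z) < e \<longrightarrow> g \<in> V"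
    unfolding openin_Hp_topology by (rule conjunct2)
  from bspec[OF this zV] obtain e where "e > 0 \<and> (\<forall>g\<in>Hp p. Hp_norm p (\<lambda>z. g z - 0) < e \<longrightarrow> g \<in> V)"
    by (elim exE)
  then have e: "e > 0" "\<And>g. g \<in> Hp p \<Longrightarrow> Hp_norm p g < e \<Longrightarrow> g \<in> V" by simp_all
  have lt: "cmod (T f z) < 1" if "f \<in> ?X" "Hp_norm p f < e" for f
  proof -
    have "f \<in> V \<inter> ?X" using e(2)[of f] that Hp_ab_subset_Hp[OF p, of \<alpha> \<beta>] by blast
    then have "f \<in> {f \<in> ?X. T f \<in> ?U}" unfolding V(2) .
    then show ?thesis by simp
  qed
  have "cmod (T f z) \<le> 2 / e * Hp_norm p f" if f: "f \<in> ?X" for f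
  proof (rule field_le_epsilon)
    have fH: "f \<in> Hp p" using f Hp_ab_subset_Hp[OF p] by blast
    have n: "0 \<le> Hp_norm p f" by (rule Hp_norm_nonneg[OF fH])
    fix \<epsilon> :: real assume \<epsilon>: "0 < \<epsilon>"
    \<comment> \<open>The summand \<epsilon> keeps t positive when the norm of f is 0, and it gives
      the strict inequality that puts f / t into the ball of radius e.\<close>
    define t where "t = 2 / e * Hp_norm p f + \<epsilon>"
    have t: "t > 0" using n e \<epsilon> by (simp add: t_def add_nonneg_pos)
    have fX: "(\<lambda>w. of_real (1 / t) * f w) \<in> ?X"
    proof -
      have "(f has_field_derivative deriv f 0) (at 0)"
        using holomorphic_derivI[OF Hp_holomorphic[OF fH] open_ball] by simp
      then have "deriv (\<lambda>w. of_real (1 / t) * f w) 0 = of_real (1 / t) * deriv f 0"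
        by (intro DERIV_imp_deriv DERIV_cmult)
      then have "\<alpha> * deriv (\<lambda>w. of_real (1 / t) * f w) 0 = of_real (1 / t) * (\<alpha> * deriv f 0)"
        by (simp only: mult.left_commute)
      also have "\<alpha> * deriv f 0 = \<beta> * f 0" using f Hp_ab_iff[OF p \<alpha>] by blast
      finally have "\<alpha> * deriv (\<lambda>w. of_real (1 / t) * f w) 0 = \<beta> * (of_real (1 / t) * f 0)"
        by (simp only: mult.left_commute)
      then show ?thesis using Hp_cmult[OF p fH] Hp_ab_iff[OF p \<alpha>] by blast
    qed
    have "Hp_norm p (\<lambda>w. of_real (1 / t) * f w) \<le> 1 / t * Hp_norm p f"
      using t by (intro Hp_mult_bounded(2)[OF p fH]) (auto simp: norm_divide)
    also have "\<dots> < e"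
    proof -
      have "e * t = 2 * Hp_norm p f + e * \<epsilon>" using e by (simp add: t_def field_simps)
      moreover have "e * \<epsilon> > 0" using e \<epsilon> by simp
      ultimately have "Hp_norm p f < e * t" using n by simp
      then show ?thesis using t by (simp add: field_simps)
    qed
    finally have "cmod (T (\<lambda>w. of_real (1 / t) * f w) z) < 1" by (rule lt[OF fX])
    then have "cmod (of_real (1 / t) * T f z) < 1" by (simp only: linear_on_Hp_abD(2)[OF lin z f])
    then have "cmod (T f z) < t" using t by (simp add: norm_mult norm_divide field_simps)
    then show "cmod (T f z) \<le> 2 / e * Hp_norm p f + \<epsilon>" by (simp add: t_def)
  qed
  then show ?thesis using e by (intro exI[of _ "2 / e"]) auto
qed

theorem theorem4p2:
  fixes p :: real and \<alpha> \<beta> :: complex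
    and T :: "(complex \<Rightarrow> complex) \<Rightarrow> complex \<Rightarrow> complex"
  assumes "1 \<le> p"
    and "(cmod \<alpha>)\<^sup>2 + (cmod \<beta>)\<^sup>2 = 1"
    and "\<alpha> \<noteq> 0"
    and "linear_on_Hp_ab p \<alpha> \<beta> T"
    and "continuous_map (subtopology (Hp_topology p) (Hp_ab p \<alpha> \<beta>)) Hol_topology T"
    and "\<forall>g. cyclic p \<alpha> \<beta> g \<longrightarrow> (\<forall>z\<in>unit_disc. T g z \<noteq> 0)"
  shows "\<exists>\<phi> \<psi>. \<phi> holomorphic_on unit_disc \<and> \<phi> ` unit_disc \<subseteq> unit_disc \<and>
    \<psi> holomorphic_on unit_disc \<and> \<psi> ` unit_disc \<subseteq> - {0} \<and>
    (\<forall>f\<in>Hp_ab p \<alpha> \<beta>. \<forall>z\<in>unit_disc. T f z = \<psi> z * f (\<phi> z))"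
proof -
  let ?X = "Hp_ab p \<alpha> \<beta>"
  define E where "E z = exp (\<beta> / \<alpha> * z)" for z
  have "\<exists>w. cmod w < 1 \<and> T E z \<noteq> 0 \<and> (\<forall>f\<in>?X. T f z = T E z / E w * f w)" if z: "z \<in> unit_disc" for z
  proof -
    obtain C where C: "0 \<le> C" "\<And>f. f \<in> ?X \<Longrightarrow> cmod (T f z) \<le> C * Hp_norm p f"
      using continuous_map_eval_bounded[OF assms(1,3,4,5) z] by blast
    interpret F: cyclic_functional p \<alpha> \<beta> "\<lambda>f. T f z" C
      by unfold_locales (use assms z C linear_on_Hp_abD[OF assms(4) z] in auto)
    have "F.E = E" by (simp add: F.E_def E_def fun_eq_iff)
    then show ?thesis using F.functional_eq_eval by simp
  qed
  then obtain \<phi> where \<phi>: "\<And>z. z \<in> unit_disc \<Longrightarrow> cmod (\<phi> z) < 1" "\<And>z. z \<in> unit_disc \<Longrightarrow> T E z \<noteq> 0"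
    "\<And>f z. f \<in> ?X \<Longrightarrow> z \<in> unit_disc \<Longrightarrow> T f z = T E z / E (\<phi> z) * f (\<phi> z)"
    by metis
  have E: "E holomorphic_on S" for S unfolding E_def by (intro holomorphic_intros)
  have E0: "E z \<noteq> 0" for z by (simp add: E_def)
  have EX: "(\<lambda>z. E z * z ^ n) \<in> ?X" if "n \<noteq> 1" for n
  proof -
    define M where "M = exp (cmod (\<beta> / \<alpha>))"
    have E_le: "cmod (E z) \<le> M" if "z \<in> unit_disc" for z
    proof -
      have "Re (\<beta> / \<alpha> * z) \<le> cmod (\<beta> / \<alpha> * z)" by (rule complex_Re_le_cmod)
      also have "\<dots> \<le> cmod (\<beta> / \<alpha>)" unfolding norm_mult using that by (intro mult_left_le) auto
      finally show ?thesis by (simp add: E_def M_def)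
    qed
    have "(\<lambda>z. E z * z ^ n) \<in> Hp p"
      using Hinf1_monom[OF that] Hinf1_subset_Hp1[OF assms(1)]
      by (intro Hp_mult_bounded(1)[OF assms(1) _ E E_le]) (auto simp: Hp1_def)
    moreover have "((\<lambda>z. E z * z ^ n) has_field_derivative \<beta> / \<alpha> * 0 ^ n) (at 0)"
      unfolding E_def using that assms(3) by (cases n) (auto intro!: derivative_eq_intros)
    ultimately show ?thesis using assms(3) Hp_ab_iff[OF assms(1,3)] by (simp add: DERIV_imp_deriv E_def)
  qed
  have TH: "T f holomorphic_on unit_disc" if "f \<in> ?X" for f
    using continuous_map_image_subset_topspace[OF assms(5)] that Hp_ab_subset_Hp[OF assms(1), of \<alpha> \<beta>]
    by (auto simp: Hol_def)
  have EE: "E \<in> ?X" using EX[of 0] by simp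
  \<comment> \<open>In the quotient of \<open>T\<close> at E z^n by \<open>T E\<close> the weight
    cancels and \<phi>^n remains. For n = 1 the function E z is not in the space.\<close>
  have pow: "(\<lambda>z. \<phi> z ^ n) holomorphic_on unit_disc" if "n \<noteq> 1" for n
  proof -
    have "(\<lambda>z. T (\<lambda>z. E z * z ^ n) z / T E z) holomorphic_on unit_disc"
      using \<phi>(2) by (intro holomorphic_on_divide TH EX EE that) auto
    then show ?thesis
      by (rule holomorphic_transform) (use \<phi>(2) E0 in \<open>simp add: \<phi>(3)[OF EX[OF that]]\<close>)
  qed
  \<comment> \<open>The map \<phi> was chosen separately at every point, so nothing is known
    beforehand about its dependence on z.\<close>
  have hol: "\<phi> holomorphic_on unit_disc"
    by (rule holomorphic_of_square_cube) (use pow in auto)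
  define \<psi> where "\<psi> z = T E z / E (\<phi> z)" for z
  have img: "\<phi> ` unit_disc \<subseteq> unit_disc" using \<phi>(1) by auto
  have "(\<lambda>z. E (\<phi> z)) holomorphic_on unit_disc"
    using holomorphic_on_compose_gen[OF hol E img] by (simp add: o_def)
  then have "\<psi> holomorphic_on unit_disc" unfolding \<psi>_def using E0 by (intro holomorphic_on_divide TH EE) auto
  moreover have "\<psi> ` unit_disc \<subseteq> - {0}" using \<phi>(2) E0 by (auto simp: \<psi>_def)
  moreover have "\<forall>f\<in>?X. \<forall>z\<in>unit_disc. T f z = \<psi> z * f (\<phi> z)" using \<phi>(3) by (simp add: \<psi>_def)
  ultimately show ?thesis using hol img by blast
qed

end
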